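(* Assume that $\tau$ is in the limit circle case at $a$ and in the limit point case at $b$. The Donoghue $m$-function $M_{T_0,\mathcal N_i}^{Do}(\cdot):\mathbb C\setminus\mathbb R\to\mathcal B(\mathcal N_i)$ for $T_0$ satisfies $$M_{T_0,\mathcal N_i}^{Do}(\pm i)=\pm i\, I_{\mathcal N_i},$$ $$M_{T_0,\mathcal N_i}^{Do}(z)=\left[-i+\frac{\widetilde\psi^{\,\prime}(z,a)-\widetilde\psi^{\,\prime}(-i,a)}{\operatorname{Im}\big(\widetilde\psi^{\,\prime}(i,a)\big)}\right]I_{\mathcal N_i},\qquad z\in\mathbb C\setminus\mathbb R,\ z\neq\pm i.$$
   Context: Let $(a,b)\subseteq\mathbb R$ (possibly unbounded) and let $p,q,r$ be Lebesgue measurable functions on $(a,b)$ with $r>0$ a.e., $r\in L^1_{loc}((a,b))$; $p>0$ a.e., $1/p\in L^1_{loc}((a,b))$; $q$ real-valued a.e., $q\in L^1_{loc}((a,b))$. Put $\tau f=\frac1r\big[-(pf')'+qf\big]$, $f^{[1]}=pf'$, and $W(f,g)(x)=f(x)g^{[1]}(x)-f^{[1]}(x)g(x)$. Let $L^2_r((a,b))=L^2((a,b);r\,dx)$ with inner product $(\cdot,\cdot)_{L^2_r((a,b))}$ linear in the second argument. The maximal operator is $T_{max}f=\tau f$ with $\mathrm{dom}(T_{max})=\{g\in L^2_r((a,b)) : g,g^{[1]}\in AC_{loc}((a,b)),\ \tau g\in L^2_r((a,b))\}$. The minimal operator $T_{min}$ is the closure of the restriction of $T_{max}$ to those $g\in\mathrm{dom}(T_{max})$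 with compact support in $(a,b)$. For $f,g\in\mathrm{dom}(T_{max})$ the limits $W(f,g)(a)=\lim_{x\downarrow a}W(f,g)(x)$ and $W(f,g)(b)=\lim_{x\uparrow b}W(f,g)(x)$ exist. $\tau$ is in the limit circle case at an endpoint if for every $z\in\mathbb C$ all solutions of $\tau u=zu$ are in $L^2_r$ near that endpoint; otherwise it is in the limit point case there. Put $\mathcal N_z=\ker(T_{max}-zI)$; in the present situation $\dim\mathcal N_{\pm i}=1$. Generalized boundary values at $a$: fix real-valued $v_1,v_2\in\mathrm{dom}(T_{max})$ with $W(v_1,v_2)(a)=1$ and, for $g\in\mathrm{dom}(T_{max})$, set $\widetilde g(a)=-W(v_2,g)(a)$ and $\widetilde g^{\,\prime}(a)=W(v_1,g)(a)$. (If $T_{min}$ is bounded from below one takes $v_1,v_2$ equal near $a$ to a nonprincipal solution $\widehat u_a(\lambda_0,\cdot)$ and a principal solution $u_a(\lambda_0,\cdot)$ of $\tau u=\lambda_0u$ with $W(\widehat u_a,u_a)=1$, $\lambda_0\in\mathbb R$.) $T_0$ denotes the self-adjoint extension of $T_{min}$ given by restricting $T_{max}$ to $\mathrm{dom}(T_0)=\{g\in\mathrm{dom}(T_{max}) : \widetilde g(a)=0\}$. For $z\in\rho(T_0)$, $\psi(z,\cdot)$ is the unique solution of $\tau y=zy$ with $\psi(z,\cdot)\in L^2_r((a,b))$ and $\widetilde\psi(z,a)=1$; $\widetilde\psi^{\,\prime}(z,a)$ is its second generalized boundary value at $a$. For a self-adjoint extension $T$ of $T_{min}$, the Donoghue $m$-function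 is $M_{T,\mathcal N_i}^{Do}(z)=zI_{\mathcal N_i}+(z^2+1)P_{\mathcal N_i}(T-zI)^{-1}P_{\mathcal N_i}\big|_{\mathcal N_i}$, $z\in\mathbb C\setminus\mathbb R$, where $P_{\mathcal N_i}$ is the orthogonal projection of $L^2_r((a,b))$ onto $\mathcal N_i$ and $I_{\mathcal N_i}$ is the identity on $\mathcal N_i$. *)

theory Defs
  imports "HOL-Analysis.Analysis"
begin

text \<open>
  The open interval \<open>(a, b)\<close>, possibly unbounded, is \<^term>\<open>einterval a b\<close> with extended real
  endpoints. Functions on it are total functions on the reals; nothing below depends on
  their values outside \<open>(a, b)\<close>. Elements of \<open>L\<^sup>2\<close> are represented by functions, and equality
  in \<open>L\<^sup>2\<close> is equality almost everywhere.
\<close>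

type_synonym cfun = "real \<Rightarrow> complex"

definition L1_loc :: "ereal \<Rightarrow> ereal \<Rightarrow> (real \<Rightarrow> real) set" where
  "L1_loc a b = {f. \<forall>K. compact K \<and> K \<subseteq> einterval a b \<longrightarrow> set_integrable lebesgue K f}"

definition AC_on :: "real \<Rightarrow> real \<Rightarrow> cfun \<Rightarrow> bool" where
  "AC_on c d f \<longleftrightarrow>
     (\<forall>\<epsilon>>0. \<exists>\<delta>>0. \<forall>(n::nat) s t.
        (\<forall>i<n. c \<le> s i \<and> s i \<le> t i \<and> t i \<le> d) \<and>
        disjoint_family_on (\<lambda>i. {s i<..<t i}) {..<n} \<and>
        (\<Sum>i<n. t i - s i) < \<delta>
        \<longrightarrow> (\<Sum>i<n. cmod (f (t i) - f (s i))) < \<epsilon>)"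

definition AC_loc :: "ereal \<Rightarrow> ereal \<Rightarrow> cfun set" where
  "AC_loc a b = {f. \<forall>c d. a < ereal c \<and> c \<le> d \<and> ereal d < b \<longrightarrow> AC_on c d f}"

definition sl_coefficients ::
    "ereal \<Rightarrow> ereal \<Rightarrow> (real \<Rightarrow> real) \<Rightarrow> (real \<Rightarrow> real) \<Rightarrow> (real \<Rightarrow> real) \<Rightarrow> bool" where
  "sl_coefficients a b p q r \<longleftrightarrow>
     a < b \<and>
     p \<in> borel_measurable (lebesgue_on (einterval a b)) \<and>
     q \<in> borel_measurable (lebesgue_on (einterval a b)) \<and>
     r \<in> borel_measurable (lebesgue_on (einterval a b)) \<and>
     (AE x in lebesgue_on (einterval a b). r x > 0) \<and> r \<in> L1_loc a b \<and>
     (AE x in lebesgue_on (einterval a b). p x > 0) \<and> (\<lambda>x. 1 / p x) \<in> L1_loc a b \<and>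
     q \<in> L1_loc a b"

text \<open>
  The product \<open>p f'\<close> is only determined almost everywhere; the statement that
  \<open>f\<^sup>[\<^sup>1\<^sup>] = p f'\<close> is locally absolutely continuous means that it has a representative in
  \<^const>\<open>AC_loc\<close>. That representative is unique on \<open>(a, b)\<close> by continuity, and it is the
  one used pointwise, e.g. in the Wronskian.
\<close>

definition is_quasi_deriv :: "ereal \<Rightarrow> ereal \<Rightarrow> (real \<Rightarrow> real) \<Rightarrow> cfun \<Rightarrow> cfun \<Rightarrow> bool" where
  "is_quasi_deriv a b p f h \<longleftrightarrow>
     h \<in> AC_loc a b \<and>
     (AE x in lebesgue_on (einterval a b).
        h x = complex_of_real (p x) * vector_derivative f (at x))"

definition quasi_deriv :: "ereal \<Rightarrow> ereal \<Rightarrow> (real \<Rightarrow> real) \<Rightarrow> cfun \<Rightarrow> cfun" where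
  "quasi_deriv a b p f = (SOME h. is_quasi_deriv a b p f h)"

definition D_tau :: "ereal \<Rightarrow> ereal \<Rightarrow> (real \<Rightarrow> real) \<Rightarrow> cfun set" where
  "D_tau a b p = {f. f \<in> AC_loc a b \<and> (\<exists>h. is_quasi_deriv a b p f h)}"

definition tau ::
    "ereal \<Rightarrow> ereal \<Rightarrow> (real \<Rightarrow> real) \<Rightarrow> (real \<Rightarrow> real) \<Rightarrow> (real \<Rightarrow> real) \<Rightarrow> cfun \<Rightarrow> cfun" where
  "tau a b p q r f = (\<lambda>x.
     (1 / complex_of_real (r x)) *
       (- vector_derivative (quasi_deriv a b p f) (at x) + complex_of_real (q x) * f x))"

definition wronskian :: "ereal \<Rightarrow> ereal \<Rightarrow> (real \<Rightarrow> real) \<Rightarrow> cfun \<Rightarrow> cfun \<Rightarrow> cfun" where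
  "wronskian a b p f g = (\<lambda>x. f x * quasi_deriv a b p g x - quasi_deriv a b p f x * g x)"

definition wronskian_at_left_end ::
    "ereal \<Rightarrow> ereal \<Rightarrow> (real \<Rightarrow> real) \<Rightarrow> cfun \<Rightarrow> cfun \<Rightarrow> complex" where
  "wronskian_at_left_end a b p f g = Lim (at_right a) (wronskian a b p f g \<circ> real_of_ereal)"

definition is_solution ::
    "ereal \<Rightarrow> ereal \<Rightarrow> (real \<Rightarrow> real) \<Rightarrow> (real \<Rightarrow> real) \<Rightarrow> (real \<Rightarrow> real)
      \<Rightarrow> complex \<Rightarrow> cfun \<Rightarrow> bool" where
  "is_solution a b p q r z u \<longleftrightarrow>
     u \<in> D_tau a b p \<and>
     (AE x in lebesgue_on (einterval a b). tau a b p q r u x = z * u x)"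

definition weighted_measure :: "ereal \<Rightarrow> ereal \<Rightarrow> (real \<Rightarrow> real) \<Rightarrow> real measure" where
  "weighted_measure a b r = density (lebesgue_on (einterval a b)) (\<lambda>x. ennreal (r x))"

definition L2 :: "real measure \<Rightarrow> cfun set" where
  "L2 \<mu> = {f. f \<in> borel_measurable \<mu> \<and> integrable \<mu> (\<lambda>x. (cmod (f x))\<^sup>2)}"

definition L2_inner :: "real measure \<Rightarrow> cfun \<Rightarrow> cfun \<Rightarrow> complex" where
  "L2_inner \<mu> f g = (LINT x|\<mu>. cnj (f x) * g x)"

definition L2_norm :: "real measure \<Rightarrow> cfun \<Rightarrow> real" where
  "L2_norm \<mu> f = sqrt (LINT x|\<mu>. (cmod (f x))\<^sup>2)"

definition limit_circle_left ::
    "ereal \<Rightarrow> ereal \<Rightarrow> (real \<Rightarrow> real) \<Rightarrow> (real \<Rightarrow> real) \<Rightarrow> (real \<Rightarrow> real) \<Rightarrow> bool" where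
  "limit_circle_left a b p q r \<longleftrightarrow>
     (\<forall>z u. is_solution a b p q r z u \<longrightarrow>
        (\<exists>c. c \<in> einterval a b \<and> u \<in> L2 (weighted_measure a (ereal c) r)))"

definition limit_circle_right ::
    "ereal \<Rightarrow> ereal \<Rightarrow> (real \<Rightarrow> real) \<Rightarrow> (real \<Rightarrow> real) \<Rightarrow> (real \<Rightarrow> real) \<Rightarrow> bool" where
  "limit_circle_right a b p q r \<longleftrightarrow>
     (\<forall>z u. is_solution a b p q r z u \<longrightarrow>
        (\<exists>c. c \<in> einterval a b \<and> u \<in> L2 (weighted_measure (ereal c) b r)))"

abbreviation limit_point_right ::
    "ereal \<Rightarrow> ereal \<Rightarrow> (real \<Rightarrow> real) \<Rightarrow> (real \<Rightarrow> real) \<Rightarrow> (real \<Rightarrow> real) \<Rightarrow> bool" where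
  "limit_point_right a b p q r \<equiv> \<not> limit_circle_right a b p q r"

text \<open>An unbounded operator is a domain together with an action on it.\<close>

type_synonym l2_operator = "cfun set \<times> (cfun \<Rightarrow> cfun)"

definition T_max ::
    "ereal \<Rightarrow> ereal \<Rightarrow> (real \<Rightarrow> real) \<Rightarrow> (real \<Rightarrow> real) \<Rightarrow> (real \<Rightarrow> real) \<Rightarrow> l2_operator" where
  "T_max a b p q r =
     ({g \<in> L2 (weighted_measure a b r).
         g \<in> D_tau a b p \<and> tau a b p q r g \<in> L2 (weighted_measure a b r)},
      tau a b p q r)"

text \<open>The kernel of \<open>T - z\<close>.\<close>

definition operator_kernel :: "real measure \<Rightarrow> l2_operator \<Rightarrow> complex \<Rightarrow> cfun set" where
  "operator_kernel \<mu> T z = {g \<in> fst T. AE x in \<mu>. snd T g x - z * g x = 0}"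

definition resolvent :: "real measure \<Rightarrow> l2_operator \<Rightarrow> complex \<Rightarrow> cfun \<Rightarrow> cfun" where
  "resolvent \<mu> T z h = (SOME f. f \<in> fst T \<and> (AE x in \<mu>. snd T f x - z * f x = h x))"

definition orth_proj :: "real measure \<Rightarrow> cfun set \<Rightarrow> cfun \<Rightarrow> cfun" where
  "orth_proj \<mu> N f = (SOME h. h \<in> N \<and> (\<forall>k\<in>N. L2_inner \<mu> k (\<lambda>x. f x - h x) = 0))"

definition bounded_operator_on :: "real measure \<Rightarrow> cfun set \<Rightarrow> (cfun \<Rightarrow> cfun) \<Rightarrow> bool" where
  "bounded_operator_on \<mu> N A \<longleftrightarrow>
     (\<forall>u\<in>N. A u \<in> N) \<and>
     (\<forall>u\<in>N. \<forall>v\<in>N. (AE x in \<mu>. u x = v x) \<longrightarrow> (AE x in \<mu>. A u x = A v x)) \<and>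
     (\<forall>u\<in>N. \<forall>v\<in>N. \<forall>\<alpha> \<beta>.
        AE x in \<mu>. A (\<lambda>y. \<alpha> * u y + \<beta> * v y) x = \<alpha> * A u x + \<beta> * A v x) \<and>
     (\<exists>C. \<forall>u\<in>N. L2_norm \<mu> (A u) \<le> C * L2_norm \<mu> u)"

definition is_scalar_operator_on ::
    "real measure \<Rightarrow> cfun set \<Rightarrow> (cfun \<Rightarrow> cfun) \<Rightarrow> complex \<Rightarrow> bool" where
  "is_scalar_operator_on \<mu> N A c \<longleftrightarrow> (\<forall>u\<in>N. AE x in \<mu>. A u x = c * u x)"

definition donoghue_m ::
    "real measure \<Rightarrow> l2_operator \<Rightarrow> cfun set \<Rightarrow> complex \<Rightarrow> cfun \<Rightarrow> cfun" where
  "donoghue_m \<mu> T N z u = (\<lambda>x.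
     z * u x + (z\<^sup>2 + 1) * orth_proj \<mu> N (resolvent \<mu> T z (orth_proj \<mu> N u)) x)"

text \<open>
  Generalized boundary values of \<open>g\<close> at the left endpoint: \<open>bv\<close> stands for the paper's
  \<open>g\<close>-tilde at \<open>a\<close> and \<open>bv'\<close> for \<open>g\<close>-tilde-prime at \<open>a\<close>; each depends on only one of
  \<open>v1\<close>, \<open>v2\<close>.
\<close>

definition bv :: "ereal \<Rightarrow> ereal \<Rightarrow> (real \<Rightarrow> real) \<Rightarrow> cfun \<Rightarrow> cfun \<Rightarrow> complex" where
  "bv a b p v2 g = - wronskian_at_left_end a b p v2 g"

definition bv' :: "ereal \<Rightarrow> ereal \<Rightarrow> (real \<Rightarrow> real) \<Rightarrow> cfun \<Rightarrow> cfun \<Rightarrow> complex" where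
  "bv' a b p v1 g = wronskian_at_left_end a b p v1 g"

definition boundary_pair ::
    "ereal \<Rightarrow> ereal \<Rightarrow> (real \<Rightarrow> real) \<Rightarrow> (real \<Rightarrow> real) \<Rightarrow> (real \<Rightarrow> real)
      \<Rightarrow> cfun \<Rightarrow> cfun \<Rightarrow> bool" where
  "boundary_pair a b p q r v1 v2 \<longleftrightarrow>
     v1 \<in> fst (T_max a b p q r) \<and> v2 \<in> fst (T_max a b p q r) \<and>
     (\<forall>x\<in>einterval a b. v1 x \<in> \<real> \<and> v2 x \<in> \<real>) \<and>
     wronskian_at_left_end a b p v1 v2 = 1"

definition T_0 ::
    "ereal \<Rightarrow> ereal \<Rightarrow> (real \<Rightarrow> real) \<Rightarrow> (real \<Rightarrow> real) \<Rightarrow> (real \<Rightarrow> real) \<Rightarrow> cfun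
      \<Rightarrow> l2_operator" where
  "T_0 a b p q r v2 =
     ({g \<in> fst (T_max a b p q r). bv a b p v2 g = 0}, snd (T_max a b p q r))"

text \<open>The solution \<open>\<psi>(z, \<cdot>)\<close>, unique as a function on \<open>(a, b)\<close> when \<open>z\<close> is in the resolvent set
  of \<^const>\<open>T_0\<close>, in particular for non-real \<open>z\<close>.\<close>

definition psi ::
    "ereal \<Rightarrow> ereal \<Rightarrow> (real \<Rightarrow> real) \<Rightarrow> (real \<Rightarrow> real) \<Rightarrow> (real \<Rightarrow> real) \<Rightarrow> cfun
      \<Rightarrow> complex \<Rightarrow> cfun" where
  "psi a b p q r v2 z =
     (SOME y. is_solution a b p q r z y \<and> y \<in> L2 (weighted_measure a b r) \<and>
        bv a b p v2 y = 1)"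

end

theory Submission
  imports Defs
begin

text \<open>
  Write \<open>\<psi>\<^sub>z\<close> for the square integrable solution of \<open>\<tau>y = zy\<close> with
  boundary value \<open>1\<close> at \<open>a\<close>, and \<open>m(z)\<close> for its second boundary value.
  Lagrange's identity says that the Wronskian of solutions \<open>u\<close>, \<open>v\<close> at the spectral
  parameters \<open>z\<close>, \<open>w\<close> is absolutely continuous with derivative \<open>(z - w) r u
  v\<close>. In the limit point case at \<open>b\<close> the Wronskian of two square integrable solutions at
  non-real parameters tends to \<open>0\<close> at \<open>b\<close>, so that integration over \<open>(a,
  b)\<close> gives, by the Pluecker identity for the boundary values at \<open>a\<close>, \<open>m(z) - m(w) =
  (z - w) \<integral> r \<psi>\<^sub>z \<psi>\<^sub>w\<close>. For \<open>w = cnj z\<close> the same computation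
  shows that a non-trivial square integrable solution, as supplied by Weyl's theory at \<open>b\<close> and the
  limit circle hypothesis at \<open>a\<close>, has a non-zero boundary value; hence
  \<open>\<psi>\<^sub>z\<close> exists and is unique for non-real \<open>z\<close>, \<open>\<psi>\<close>
  commutes with conjugation, the kernel \<open>N\<close> is spanned by \<open>\<psi>\<^sub>i\<close>, and
  \<open>Im m(i)\<close> is the squared norm of \<open>\<psi>\<^sub>i\<close>. The function
  \<open>(\<psi>\<^sub>z - \<psi>\<^sub>i) / (z - i)\<close> has boundary value \<open>0\<close> and is the
  resolvent of \<open>T\<^sub>0\<close> at \<open>z\<close> applied to \<open>\<psi>\<^sub>i\<close>. Projecting
  it to \<open>N\<close> turns the Donoghue m-function into multiplication by \<open>-i + (z + i)
  \<langle>\<psi>\<^sub>i, \<psi>\<^sub>z\<rangle> / \<langle>\<psi>\<^sub>i, \<psi>\<^sub>i\<rangle>\<close>,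
  and since \<open>cnj \<psi>\<^sub>i = \<psi>\<^sub>-\<^sub>i\<close> the identity for \<open>m(z) -
  m(-i)\<close> gives the claim (\<open>M_scalar\<close>). Only solutions enter the argument: neither the
  self-adjointness of \<open>T\<^sub>0\<close> nor the vanishing at \<open>b\<close> of Wronskians of arbitrary
  functions in the maximal domain is needed.

  The vanishing of Wronskians at \<open>b\<close> (\<open>weyl_wronskian_limit\<close>) is Weyl's nested disk
  argument. For \<open>B\<close> near \<open>b\<close>, the solutions \<open>\<theta> + m\<phi>\<close> that
  vanish at \<open>B\<close> have vanishing Wronskians at \<open>B\<close>. Their parameters converge to the
  limit point so fast that their error times the norm of \<open>\<phi>\<close> on \<open>(c, B)\<close> tends to
  \<open>0\<close>, because this norm is unbounded. The unboundedness follows from the limit point hypothesis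
  and the fact that the limit circle case at one parameter implies it at all parameters
  (\<open>all_sq_int_right\<close>).

  All of this rests on the analysis of absolutely continuous functions: they are almost everywhere
  differentiable (\<open>AC_differentiable_ae\<close>), they are determined up to a constant by their derivative
  (\<open>AC_zero_derivative_imp_const\<close>), and indefinite integrals have the integrand as derivative
  almost everywhere (\<open>lebesgue_differentiation\<close>). These results follow from Vitali's covering
  theorem. They make the differential expression, which is formulated with pointwise derivatives, equivalent to
  a system of two integral equations, which is solved by Picard iteration (\<open>linear_system_exists\<close>).
\<close>

section \<open>Vitali coverings by intervals\<close>

text \<open>
  Vitali's covering theorem for compact intervals of the real line, with a finite disjoint subfamily that covers
  \<open>S\<close> up to a set of small measure. The set \<open>S\<close> need not be measurable. The points of
  \<open>S\<close> need not be midpoints of the covering intervals, so one-sided intervals are admitted.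
\<close>

lemma vitali_finite_cover:
  fixes l r :: "'i \<Rightarrow> real"
  assumes lr: "\<And>i. i \<in> K \<Longrightarrow> l i < r i \<and> c \<le> l i \<and> r i \<le> d"
    and fine: "\<And>x \<delta>. x \<in> S \<Longrightarrow> 0 < \<delta> \<Longrightarrow> \<exists>i\<in>K. l i \<le> x \<and> x \<le> r i \<and> r i - l i < \<delta>"
    and "e > 0"
  obtains C T where "finite C" "C \<subseteq> K"
    "\<And>i j. i \<in> C \<Longrightarrow> j \<in> C \<Longrightarrow> i \<noteq> j \<Longrightarrow> {l i..r i} \<inter> {l j..r j} = {}"
    "T \<in> lmeasurable" "measure lebesgue T < e" "S \<subseteq> T \<union> (\<Union>i\<in>C. {l i..r i})"
proof -
  define a where "a = (\<lambda>i. (l i + r i) / 2)"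
  define \<rho> where "\<rho> = (\<lambda>i. (r i - l i) / 2)"
  have cb: "cball (a i) (\<rho> i) = {l i..r i}" for i
    by (auto simp: a_def \<rho>_def cball_eq_atLeastAtMost field_simps)
  have 1: "0 < \<rho> i" if "i \<in> K" for i
    using lr[OF that] by (simp add: \<rho>_def)
  have 2: "\<exists>i. i \<in> K \<and> x \<in> cball (a i) (\<rho> i) \<and> \<rho> i < \<delta>" if x: "x \<in> S" "0 < \<delta>" for x \<delta>
  proof -
    obtain i where "i \<in> K" "l i \<le> x" "x \<le> r i" "r i - l i < \<delta>"
      using fine[OF x] by blast
    then show ?thesis
      unfolding cb by (intro exI[of _ i]) (auto simp: \<rho>_def)
  qed
  obtain C0 where C0: "countable C0" "C0 \<subseteq> K"
    and pw: "pairwise (\<lambda>i j. disjnt (cball (a i) (\<rho> i)) (cball (a j) (\<rho> j))) C0"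
    and neg: "negligible (S - (\<Union>i\<in>C0. cball (a i) (\<rho> i)))"
    by (rule Vitali_covering_theorem_cballs[of K \<rho> S a, OF 1 2]) (assumption | rule that)+
  define D where "D = (\<lambda>i. {l i..r i}) ` C0"
  have sub: "\<Union>D \<subseteq> {c..d}"
    unfolding D_def using lr C0(2) by fastforce
  have UD: "\<Union>D' \<in> lmeasurable" if "D' \<subseteq> D" for D'
  proof (rule fmeasurableI2[of "{c..d}"])
    show "\<Union>D' \<in> sets lebesgue"
    proof (rule sets.countable_Union)
      show "countable D'" using countable_subset[OF that] C0(1) by (simp add: D_def)
      have "D \<subseteq> sets lebesgue" unfolding D_def by auto
      with that show "D' \<subseteq> sets lebesgue" by (rule order_trans)
    qed
    show "\<Union>D' \<subseteq> {c..d}" using sub Union_mono[OF that] by (rule order_trans[rotated])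
  qed simp
  \<comment> \<open>The countable Vitali family has finite total length, so a finite part leaves measure less than \<open>e\<close>.\<close>
  obtain D' where D': "D' \<subseteq> D" "finite D'"
    "measure lebesgue (\<Union>D) - e < measure lebesgue (\<Union>D')"
  proof (rule measure_countable_Union_approachable[of D e "measure lebesgue {c..d}"])
    show "countable D" using C0(1) by (simp add: D_def)
    show "\<And>K. K \<in> D \<Longrightarrow> K \<in> lmeasurable" by (auto simp: D_def)
    show "measure lebesgue (\<Union>D') \<le> measure lebesgue {c..d}" if "D' \<subseteq> D" "finite D'" for D'
      using order_trans[OF Union_mono[OF that(1)] sub] UD[OF that(1)]
      by (intro measure_mono_fmeasurable fmeasurableD) simp_all
  qed (use \<open>e > 0\<close> in auto)
  obtain C where C: "C \<subseteq> C0" "finite C" "D' = (\<lambda>i. {l i..r i}) ` C"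
    using D'(1,2) unfolding D_def by (meson finite_subset_image)
  define N where "N = S - \<Union>D"
  have N: "negligible N" using neg unfolding N_def D_def cb by simp
  define T where "T = N \<union> (\<Union>D - \<Union>D')"
  have Nn: "N \<in> null_sets lebesgue" using N negligible_iff_null_sets by blast
  have dm: "\<Union>D - \<Union>D' \<in> lmeasurable" using UD[OF order_refl] UD[OF D'(1)] by auto
  show thesis
  proof
    show "finite C" by (rule C)
    show "C \<subseteq> K" using C C0 by auto
    show "{l i..r i} \<inter> {l j..r j} = {}" if "i \<in> C" "j \<in> C" "i \<noteq> j" for i j
      using pw that C(1) unfolding pairwise_def cb disjnt_def by blast
    show "T \<in> lmeasurable" unfolding T_def using N dm
      by (simp add: fmeasurable.Un negligible_imp_measurable)
    have "measure lebesgue T = measure lebesgue (\<Union>D - \<Union>D')"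
      unfolding T_def using Nn dm by (simp add: measure_Un_null_set Un_commute[of N] fmeasurableD)
    also have "\<dots> = measure lebesgue (\<Union>D) - measure lebesgue (\<Union>D')"
      using UD[OF order_refl] UD[OF D'(1)] D'(1) by (intro measurable_measure_Diff) auto
    finally show "measure lebesgue T < e" using D'(3) by simp
    show "S \<subseteq> T \<union> (\<Union>i\<in>C. {l i..r i})"
      unfolding T_def N_def using C(3) by auto
  qed
qed

section \<open>Increments of absolutely continuous functions\<close>

text \<open>
  The increment of a function over a compact interval, as a function of the interval. The increment of the
  identity is the length.
\<close>

definition increment :: "(real \<Rightarrow> 'a::real_normed_vector) \<Rightarrow> real set \<Rightarrow> 'a" where
  "increment f K = f (Sup K) - f (Inf K)"

lemma increment_Icc [simp]: "l \<le> r \<Longrightarrow> increment f {l..r} = f r - f l"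
  by (simp add: increment_def)

lemma increment_division:
  fixes f :: "real \<Rightarrow> 'a::real_normed_vector"
  assumes "q division_of {l..r}" "l \<le> r"
  shows "(\<Sum>K\<in>q. increment f K) = f r - f l"
proof -
  let ?f = "(\<lambda>K::real set. if K = {} then 0 else f(interval_upperbound K) - f(interval_lowerbound K))"
  interpret operative_real plus 0 ?f
    rewrites "comm_monoid_set.F (+) 0 = sum"
    by standard[1] (auto simp add: sum_def)
  have "sum ?f q = ?f (cbox l r)"
    using assms(1) by (metis (no_types, lifting) box_real(2) division)
  moreover have "sum ?f q = (\<Sum>K\<in>q. increment f K)"
  proof (rule sum.cong)
    fix K assume "K \<in> q"
    then have "K \<noteq> {}" using assms(1) by auto
    then show "?f K = increment f K" by (auto simp: increment_def)
  qed simp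
  ultimately show ?thesis using assms by simp
qed

text \<open>
  Finite sets of compact subintervals of \<open>[c, d]\<close> with disjoint interiors; degenerate intervals are
  allowed, since they occur in divisions.
\<close>

definition interval_family :: "real \<Rightarrow> real \<Rightarrow> real set set \<Rightarrow> bool" where
  "interval_family c d D \<longleftrightarrow> finite D \<and> (\<forall>K\<in>D. \<exists>l r. l \<le> r \<and> K = {l..r} \<and> c \<le> l \<and> r \<le> d) \<and>
     (\<forall>K\<in>D. \<forall>L\<in>D. K \<noteq> L \<longrightarrow> interior K \<inter> interior L = {})"

lemma AC_on_interval_family:
  assumes "AC_on c d f" "\<epsilon> > 0"
  obtains \<delta> where "\<delta> > 0"
    "\<And>D. interval_family c d D \<Longrightarrow> (\<Sum>K\<in>D. increment (\<lambda>x. x) K) < \<delta> \<Longrightarrow>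
        (\<Sum>K\<in>D. cmod (increment f K)) < \<epsilon>"
proof -
  obtain \<delta> where \<delta>: "\<delta> > 0" and ac: "\<And>(n::nat) s t.
        (\<forall>i<n. c \<le> s i \<and> s i \<le> t i \<and> t i \<le> d) \<Longrightarrow>
        disjoint_family_on (\<lambda>i. {s i<..<t i}) {..<n} \<Longrightarrow>
        (\<Sum>i<n. t i - s i) < \<delta>
        \<Longrightarrow> (\<Sum>i<n. cmod (f (t i) - f (s i))) < \<epsilon>"
    using assms unfolding AC_on_def by meson
  show thesis
  proof
    fix D assume D: "interval_family c d D" and len: "(\<Sum>K\<in>D. increment (\<lambda>x. x) K) < \<delta>"
    have "finite D" using D by (simp add: interval_family_def)
    then obtain e where e: "bij_betw e {..<card D} D"
      using ex_bij_betw_nat_finite[of D] by (auto simp: atLeast0LessThan)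
    have form: "\<exists>l r. l \<le> r \<and> e i = {l..r} \<and> c \<le> l \<and> r \<le> d" if "i < card D" for i
      using D bij_betwE[OF e] that by (auto simp: interval_family_def)
    have s: "(\<Sum>i<card D. g (e i)) = (\<Sum>K\<in>D. g K)" for g :: "real set \<Rightarrow> real"
      using sum.reindex_bij_betw[OF e] .
    have "(\<Sum>i<card D. cmod (f (Sup (e i)) - f (Inf (e i)))) < \<epsilon>"
    proof (rule ac)
      show "\<forall>i<card D. c \<le> Inf (e i) \<and> Inf (e i) \<le> Sup (e i) \<and> Sup (e i) \<le> d"
        using form by fastforce
      show "disjoint_family_on (\<lambda>i. {Inf (e i)<..<Sup (e i)}) {..<card D}"
        unfolding disjoint_family_on_def
      proof (intro ballI impI)
        fix i j assume ij: "i \<in> {..<card D}" "j \<in> {..<card D}" "i \<noteq> j"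
        then have "e i \<noteq> e j" using e by (auto simp: bij_betw_def inj_on_def)
        then have "interior (e i) \<inter> interior (e j) = {}"
          using D bij_betwE[OF e] ij by (auto simp: interval_family_def)
        moreover have "interior (e k) = {Inf (e k)<..<Sup (e k)}" if "k < card D" for k
          using form[OF that] by auto
        ultimately show "{Inf (e i)<..<Sup (e i)} \<inter> {Inf (e j)<..<Sup (e j)} = {}"
          using ij by simp
      qed
      show "(\<Sum>i<card D. Sup (e i) - Inf (e i)) < \<delta>"
        using len s[of "increment (\<lambda>x. x)"] by (simp add: increment_def)
    qed
    then show "(\<Sum>K\<in>D. cmod (increment f K)) < \<epsilon>"
      using s[of "\<lambda>K. cmod (increment f K)"] by (simp add: increment_def)
  qed (rule \<delta>)
qed

text \<open>
  Finite sets of non-degenerate compact subintervals of \<open>[c, d]\<close> that are disjoint, endpoints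
  included.
\<close>

definition disjoint_intervals :: "real \<Rightarrow> real \<Rightarrow> real set set \<Rightarrow> bool" where
  "disjoint_intervals c d D \<longleftrightarrow> finite D \<and> (\<forall>K\<in>D. \<exists>l r. l < r \<and> K = {l..r} \<and> c \<le> l \<and> r \<le> d) \<and>
     (\<forall>K\<in>D. \<forall>L\<in>D. K \<noteq> L \<longrightarrow> K \<inter> L = {})"

lemma disjoint_intervals_imp_family: "disjoint_intervals c d D \<Longrightarrow> interval_family c d D"
  unfolding disjoint_intervals_def interval_family_def
  by (meson disjoint_iff interior_subset less_imp_le subsetD)

text \<open>
  If a family \<open>D2\<close> of intervals fills another family \<open>D1\<close> up to gaps of small total
  length, then the total increments of an absolutely continuous function over both families are close. The gaps
  are made into intervals by extending \<open>D2\<close> to divisions of the members of \<open>D1\<close>.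
\<close>

lemma AC_on_gap:
  assumes "AC_on c d f" "\<epsilon> > 0"
  obtains \<delta> where "\<delta> > 0"
    "\<And>D1 D2. disjoint_intervals c d D1 \<Longrightarrow> disjoint_intervals c d D2 \<Longrightarrow>
       (\<And>L. L \<in> D2 \<Longrightarrow> \<exists>K\<in>D1. L \<subseteq> K) \<Longrightarrow>
       (\<Sum>K\<in>D1. increment (\<lambda>x. x) K) - (\<Sum>K\<in>D2. increment (\<lambda>x. x) K) < \<delta> \<Longrightarrow>
       cmod ((\<Sum>K\<in>D1. increment f K) - (\<Sum>K\<in>D2. increment f K)) < \<epsilon>"
proof -
  obtain \<delta> where \<delta>: "\<delta> > 0" and ac:
    "\<And>D. interval_family c d D \<Longrightarrow> (\<Sum>K\<in>D. increment (\<lambda>x. x) K) < \<delta> \<Longrightarrow>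
        (\<Sum>K\<in>D. cmod (increment f K)) < \<epsilon>"
    using AC_on_interval_family[OF assms] by blast
  show thesis
  proof
    fix D1 D2
    assume D1: "disjoint_intervals c d D1" and D2: "disjoint_intervals c d D2"
      and sub: "\<And>L. L \<in> D2 \<Longrightarrow> \<exists>K\<in>D1. L \<subseteq> K"
      and len: "(\<Sum>K\<in>D1. increment (\<lambda>x. x) K) - (\<Sum>K\<in>D2. increment (\<lambda>x. x) K) < \<delta>"
    have fin: "finite D1" "finite D2" using D1 D2 by (auto simp: disjoint_intervals_def)
    define p where "p = (\<lambda>K. {L\<in>D2. L \<subseteq> K})"
    have "\<exists>q. p K \<subseteq> q \<and> q division_of K" if K: "K \<in> D1" for K
    proof -
      obtain l r where lr: "l < r" "K = {l..r}"
        using D1 K by (auto simp: disjoint_intervals_def)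
      have "p K division_of \<Union>(p K)"
      proof (rule division_ofI)
        fix L assume "L \<in> p K"
        then have "\<exists>l r. l < r \<and> L = {l..r}"
          using D2 by (force simp: p_def disjoint_intervals_def)
        then show "L \<noteq> {}" "\<exists>a b. L = cbox a b" by (auto simp: box_real)
      next
        fix L M assume "L \<in> p K" "M \<in> p K" "L \<noteq> M"
        then show "interior L \<inter> interior M = {}"
          using disjoint_intervals_imp_family[OF D2] by (auto simp: p_def interval_family_def)
      qed (use fin in \<open>auto simp: p_def\<close>)
      moreover have "\<Union>(p K) \<subseteq> cbox l r" by (auto simp: p_def lr)
      ultimately show ?thesis
        using partial_division_extend_interval[of "p K" l r] lr by (metis box_real(2))
    qed
    then obtain q where q: "\<And>K. K \<in> D1 \<Longrightarrow> p K \<subseteq> q K" "\<And>K. K \<in> D1 \<Longrightarrow> q K division_of K"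
      by metis
    have finq: "finite (q K)" if "K \<in> D1" for K using q(2)[OF that] by auto
    define G where "G = (\<Union>K\<in>D1. q K - p K)"
    have dis: "K \<inter> K' = {}" if "K \<in> D1" "K' \<in> D1" "K \<noteq> K'" for K K'
      using D1 that by (auto simp: disjoint_intervals_def)
    have D2eq: "D2 = (\<Union>K\<in>D1. p K)" using sub by (auto simp: p_def)
    have nonempty: "L \<noteq> {}" "L \<subseteq> K" if "L \<in> q K" "K \<in> D1" for L K
      using q(2)[OF that(2)] that(1) by auto
    have djq: "q K \<inter> q K' = {}" if "K \<in> D1" "K' \<in> D1" "K \<noteq> K'" for K K'
    proof (rule ccontr)
      assume "q K \<inter> q K' \<noteq> {}"
      then obtain L where L: "L \<in> q K" "L \<in> q K'" by auto
      have "L \<subseteq> K \<inter> K'" using nonempty(2) L that by simp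
      then show False using nonempty(1)[OF L(1) that(1)] dis[OF that] by simp
    qed
    have split: "(\<Sum>K\<in>D1. increment g K) = (\<Sum>K\<in>D2. increment g K) + (\<Sum>K\<in>G. increment g K)"
      for g :: "real \<Rightarrow> 'b::real_normed_vector"
    proof -
      have "(\<Sum>K\<in>D1. increment g K) = (\<Sum>K\<in>D1. \<Sum>L\<in>q K. increment g L)"
      proof (rule sum.cong)
        fix K assume K: "K \<in> D1"
        obtain l r where lr: "l < r" "K = {l..r}"
          using D1 K by (auto simp: disjoint_intervals_def)
        then show "increment g K = (\<Sum>L\<in>q K. increment g L)"
          using increment_division[of "q K" l r g] q(2)[OF K] by simp
      qed simp
      also have "\<dots> = (\<Sum>K\<in>D1. (\<Sum>L\<in>p K. increment g L) + (\<Sum>L\<in>q K - p K. increment g L))"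
        by (intro sum.cong refl) (metis (no_types) add.commute finq q(1) sum.subset_diff)
      also have "\<dots> = (\<Sum>K\<in>D1. \<Sum>L\<in>p K. increment g L) + (\<Sum>K\<in>D1. \<Sum>L\<in>q K - p K. increment g L)"
        by (rule sum.distrib)
      also have "(\<Sum>K\<in>D1. \<Sum>L\<in>p K. increment g L) = (\<Sum>K\<in>D2. increment g K)"
        unfolding D2eq
      proof (intro sum.UNION_disjoint[symmetric] ballI impI)
        fix K K' assume K: "K \<in> D1" "K' \<in> D1" "K \<noteq> K'"
        show "p K \<inter> p K' = {}" using djq[OF K] q(1)[OF K(1)] q(1)[OF K(2)] by auto
      qed (use fin in \<open>auto simp: p_def\<close>)
      also have "(\<Sum>K\<in>D1. \<Sum>L\<in>q K - p K. increment g L) = (\<Sum>K\<in>G. increment g K)"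
        unfolding G_def
      proof (intro sum.UNION_disjoint[symmetric] ballI impI)
        fix K K' assume K: "K \<in> D1" "K' \<in> D1" "K \<noteq> K'"
        show "(q K - p K) \<inter> (q K' - p K') = {}" using djq[OF K] by auto
      qed (use fin finq in auto)
      finally show ?thesis .
    qed
    have G: "interval_family c d G"
      unfolding interval_family_def
    proof (intro conjI ballI impI)
      show "finite G" unfolding G_def using fin finq by auto
    next
      fix L assume "L \<in> G"
      then obtain K where K: "K \<in> D1" "L \<in> q K" by (auto simp: G_def)
      obtain l r where lr: "l < r" "K = {l..r}" "c \<le> l" "r \<le> d"
        using D1 K by (auto simp: disjoint_intervals_def)
      obtain a b where ab: "L = {a..b}" using q(2)[OF K(1)] K(2) by (metis box_real(2) division_ofD(4))
      have "a \<le> b" using nonempty[OF K(2,1)] ab by auto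
      then show "\<exists>l r. l \<le> r \<and> L = {l..r} \<and> c \<le> l \<and> r \<le> d"
        using nonempty[OF K(2,1)] ab lr by (intro exI[of _ a] exI[of _ b]) auto
    next
      fix L M assume "L \<in> G" "M \<in> G" "L \<noteq> M"
      then obtain K K' where K: "K \<in> D1" "L \<in> q K" "K' \<in> D1" "M \<in> q K'" by (auto simp: G_def)
      show "interior L \<inter> interior M = {}"
      proof (cases "K = K'")
        case True
        then show ?thesis using q(2)[OF K(1)] K \<open>L \<noteq> M\<close> by auto
      next
        case False
        then have "L \<inter> M = {}"
          using nonempty(2)[OF K(2,1)] nonempty(2)[OF K(4,3)] dis[OF K(1,3)] by blast
        then show ?thesis using interior_subset[of L] interior_subset[of M] by blast
      qed
    qed
    have "(\<Sum>K\<in>D1. increment f K) - (\<Sum>K\<in>D2. increment f K) = (\<Sum>K\<in>G. increment f K)"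
      using split[of f] by simp
    also have "cmod \<dots> \<le> (\<Sum>K\<in>G. cmod (increment f K))" by (rule norm_sum)
    also have "\<dots> < \<epsilon>"
      using ac[OF G] len split[of "\<lambda>x. x"] by simp
    finally show "cmod ((\<Sum>K\<in>D1. increment f K) - (\<Sum>K\<in>D2. increment f K)) < \<epsilon>" .
  qed (rule \<delta>)
qed

section \<open>Almost everywhere differentiability of absolutely continuous functions\<close>

lemma disjoint_intervals_image:
  fixes l r :: "'i \<Rightarrow> real"
  assumes "finite C" and lr: "\<forall>i\<in>C. l i < r i \<and> c \<le> l i \<and> r i \<le> d"
    and dis: "\<forall>i\<in>C. \<forall>j\<in>C. i \<noteq> j \<longrightarrow> {l i..r i} \<inter> {l j..r j} = {}"
  shows "disjoint_intervals c d ((\<lambda>i. {l i..r i}) ` C)"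
    and "(\<Sum>K\<in>(\<lambda>i. {l i..r i}) ` C. increment f K) = (\<Sum>i\<in>C. f (r i) - f (l i))"
    and "(\<Sum>K\<in>(\<lambda>i. {l i..r i}) ` C. cmod (increment g K)) = (\<Sum>i\<in>C. cmod (g (r i) - g (l i)))"
    and "measure lebesgue (\<Union>i\<in>C. {l i..r i}) = (\<Sum>i\<in>C. r i - l i)"
proof -
  show "disjoint_intervals c d ((\<lambda>i. {l i..r i}) ` C)"
    unfolding disjoint_intervals_def
  proof (intro conjI ballI impI)
    show "finite ((\<lambda>i. {l i..r i}) ` C)" using assms(1) by simp
  next
    fix K assume "K \<in> (\<lambda>i. {l i..r i}) ` C"
    then obtain i where i: "i \<in> C" "K = {l i..r i}" by auto
    then show "\<exists>l r. l < r \<and> K = {l..r} \<and> c \<le> l \<and> r \<le> d"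
      using bspec[OF lr i(1)] by blast
  next
    fix K L assume "K \<in> (\<lambda>i. {l i..r i}) ` C" "L \<in> (\<lambda>i. {l i..r i}) ` C" "K \<noteq> L"
    then obtain i j where i: "i \<in> C" "K = {l i..r i}" "j \<in> C" "L = {l j..r j}" by auto
    then have "i \<noteq> j" using \<open>K \<noteq> L\<close> by auto
    then show "K \<inter> L = {}" using dis i by simp
  qed
  have inj: "inj_on (\<lambda>i. {l i..r i}) C"
  proof (rule inj_onI, rule ccontr)
    fix i j assume ij: "i \<in> C" "j \<in> C" "{l i..r i} = {l j..r j}" "i \<noteq> j"
    then have "{l i..r i} = {}" using bspec[OF bspec[OF dis ij(1)] ij(2)] ij(4) by (simp only: ij(3) Int_absorb)
    then show False using bspec[OF lr ij(1)] by simp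
  qed
  have inc: "increment h {l i..r i} = h (r i) - h (l i)" if "i \<in> C"
    for i and h :: "real \<Rightarrow> 'z::real_normed_vector"
    using bspec[OF lr that] by simp
  show "(\<Sum>K\<in>(\<lambda>i. {l i..r i}) ` C. increment f K) = (\<Sum>i\<in>C. f (r i) - f (l i))"
    unfolding sum.reindex[OF inj] o_def using inc by (intro sum.cong) auto
  show "(\<Sum>K\<in>(\<lambda>i. {l i..r i}) ` C. cmod (increment g K)) = (\<Sum>i\<in>C. cmod (g (r i) - g (l i)))"
    unfolding sum.reindex[OF inj] o_def by (intro sum.cong) (simp_all add: inc)
  have "measure lebesgue (\<Union>i\<in>C. {l i..r i}) = (\<Sum>i\<in>C. measure lebesgue {l i..r i})"
    using assms(1) dis by (intro measure_negligible_finite_Union_image) (auto simp: pairwise_def)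
  also have "\<dots> = (\<Sum>i\<in>C. r i - l i)"
  proof (rule sum.cong)
    fix i assume "i \<in> C"
    then show "measure lebesgue {l i..r i} = r i - l i"
      using lr by (simp add: less_imp_le)
  qed simp
  finally show "measure lebesgue (\<Union>i\<in>C. {l i..r i}) = (\<Sum>i\<in>C. r i - l i)" .
qed

lemma small_closed_interval_in_open:
  fixes x :: real
  assumes "open V" "x \<in> V"
  obtains \<epsilon> where "\<epsilon> > 0" "\<And>l r. l \<le> x \<Longrightarrow> x \<le> r \<Longrightarrow> r - l < \<epsilon> \<Longrightarrow> {l..r} \<subseteq> V"
proof -
  obtain \<epsilon> where "\<epsilon> > 0" "ball x \<epsilon> \<subseteq> V" using assms openE by blast
  then show thesis by (intro that[of \<epsilon>]) (auto simp: subset_iff dist_real_def)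
qed

text \<open>
  The points near which both slopes above \<open>\<beta>\<close> and slopes below \<open>\<alpha>\<close> occur.
  Slopes are taken over arbitrarily short intervals that contain the point, possibly as an endpoint.
\<close>

definition oscillation_set :: "(real \<Rightarrow> real) \<Rightarrow> real \<Rightarrow> real \<Rightarrow> real set" where
  "oscillation_set u \<alpha> \<beta> = {x.
     (\<forall>\<delta>>0. \<exists>l r. l \<le> x \<and> x \<le> r \<and> l < r \<and> r - l < \<delta> \<and> u r - u l < \<alpha> * (r - l)) \<and>
     (\<forall>\<delta>>0. \<exists>l r. l \<le> x \<and> x \<le> r \<and> l < r \<and> r - l < \<delta> \<and> u r - u l > \<beta> * (r - l))}"

text \<open>
  The points near which slopes of arbitrarily large modulus occur.
\<close>

definition steep_set :: "(real \<Rightarrow> real) \<Rightarrow> real set" where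
  "steep_set u = {x. \<forall>\<kappa>. \<forall>\<delta>>0. \<exists>l r. l \<le> x \<and> x \<le> r \<and> l < r \<and> r - l < \<delta> \<and>
     \<bar>u r - u l\<bar> > \<kappa> * (r - l)}"

text \<open>
  Let \<open>e\<close> be the outer measure of the set. It is covered, up to small measure, by intervals with
  slope below \<open>\<alpha>\<close> of total length about \<open>e\<close>, and then, inside of these, by
  intervals with slope above \<open>\<beta>\<close> of total length about \<open>e\<close>. The gaps between the
  two families are small, so both total increments almost agree; hence \<open>\<beta> e \<le> \<alpha> e\<close>
  up to an arbitrarily small error, and \<open>e = 0\<close>.
\<close>

lemma negligible_oscillation_set:
  fixes u :: "real \<Rightarrow> real"
  assumes ac: "AC_on c d (\<lambda>x. complex_of_real (u x))" and "\<alpha> < \<beta>"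
  shows "negligible (oscillation_set u \<alpha> \<beta> \<inter> {c<..<d})"
proof -
  define E where "E = oscillation_set u \<alpha> \<beta> \<inter> {c<..<d}"
  define \<M> where "\<M> = {T. E \<subseteq> T \<and> T \<in> lmeasurable}"
  define e where "e = (INF T\<in>\<M>. measure lebesgue T)"
  have ne: "{c<..<d} \<in> \<M>" unfolding \<M>_def E_def by auto
  have bdd: "bdd_below (measure lebesgue ` \<M>)" by (rule bdd_belowI[of _ 0]) auto
  have e_le: "e \<le> measure lebesgue T" if "E \<subseteq> T" "T \<in> lmeasurable" for T
    unfolding e_def using bdd that by (intro cINF_lower) (auto simp: \<M>_def)
  have key: "(\<beta> - \<alpha>) * e \<le> \<eta> * (1 + 2 * \<bar>\<alpha>\<bar> + 2 * \<bar>\<beta>\<bar>)" if "\<eta> > 0" for \<eta>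
  proof -
    obtain \<delta>0 where \<delta>0: "\<delta>0 > 0" and gap:
      "\<And>D1 D2. disjoint_intervals c d D1 \<Longrightarrow> disjoint_intervals c d D2 \<Longrightarrow>
         (\<And>L. L \<in> D2 \<Longrightarrow> \<exists>K\<in>D1. L \<subseteq> K) \<Longrightarrow>
         (\<Sum>K\<in>D1. increment (\<lambda>x. x) K) - (\<Sum>K\<in>D2. increment (\<lambda>x. x) K) < \<delta>0 \<Longrightarrow>
         cmod ((\<Sum>K\<in>D1. increment (\<lambda>x. complex_of_real (u x)) K)
              - (\<Sum>K\<in>D2. increment (\<lambda>x. complex_of_real (u x)) K)) < \<eta>"
      using AC_on_gap[OF ac \<open>\<eta> > 0\<close>] by blast
    define \<delta> where "\<delta> = min (\<delta>0 / 4) \<eta>"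
    have \<delta>: "\<delta> > 0" "\<delta> \<le> \<delta>0 / 4" "\<delta> \<le> \<eta>" using \<delta>0 \<open>\<eta> > 0\<close> by (auto simp: \<delta>_def)
    have "(INF T\<in>\<M>. measure lebesgue T) < e + \<delta> / 2" using \<delta> by (simp add: e_def)
    then obtain T0 where T0: "E \<subseteq> T0" "T0 \<in> lmeasurable" "measure lebesgue T0 < e + \<delta> / 2"
      using cINF_less_iff[of \<M> "measure lebesgue" "e + \<delta> / 2"] ne bdd by (auto simp: \<M>_def)
    obtain U where U: "open U" "T0 \<subseteq> U" "U - T0 \<in> lmeasurable" "emeasure lebesgue (U - T0) < ennreal (\<delta> / 2)"
      using sets_lebesgue_outer_open[of T0 "\<delta> / 2"] T0(2) \<delta>(1) by auto
    have mU: "measure lebesgue (U - T0) < \<delta> / 2"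
      using U(4) \<delta>(1) unfolding emeasure_eq_measure2[OF U(3)]
      by (simp add: ennreal_less_iff del: ennreal_half)
    define V where "V = U \<inter> {c<..<d}"
    have V: "open V" "E \<subseteq> V" "V \<subseteq> {c<..<d}" using U T0 by (auto simp: V_def E_def)
    have Vm: "V \<in> lmeasurable" using V by (intro bounded_set_imp_lmeasurable)
        (auto intro: bounded_subset[of "{c<..<d}"] borel_open)
    have mV: "measure lebesgue V < e + \<delta>"
    proof -
      have "measure lebesgue V \<le> measure lebesgue (T0 \<union> (U - T0))"
        using Vm fmeasurable.Un[OF T0(2) U(3)] unfolding V_def
        by (intro measure_mono_fmeasurable) (auto simp: fmeasurableD)
      also have "\<dots> \<le> measure lebesgue T0 + measure lebesgue (U - T0)"
        using T0(2) U(3) by (intro measure_Un_le) (auto simp: fmeasurableD)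
      finally show ?thesis using mU T0(3) by simp
    qed
    define K1 where "K1 = {(l, r). l < r \<and> {l..r} \<subseteq> V \<and> u r - u l < \<alpha> * (r - l)}"
    obtain C1 T1 where C1: "finite C1" "C1 \<subseteq> K1"
      "\<And>i j. i \<in> C1 \<Longrightarrow> j \<in> C1 \<Longrightarrow> i \<noteq> j \<Longrightarrow> {fst i..snd i} \<inter> {fst j..snd j} = {}"
      "T1 \<in> lmeasurable" "measure lebesgue T1 < \<delta>" "E \<subseteq> T1 \<union> (\<Union>i\<in>C1. {fst i..snd i})"
    proof (rule vitali_finite_cover[of K1 fst snd c d E \<delta>])
      show "fst i < snd i \<and> c \<le> fst i \<and> snd i \<le> d" if "i \<in> K1" for i
      proof -
        have "fst i < snd i" "{fst i..snd i} \<subseteq> {c<..<d}" using that V(3) by (auto simp: K1_def)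
        then have "fst i \<in> {c<..<d}" "snd i \<in> {c<..<d}"
          by (meson atLeastAtMost_iff less_imp_le order_refl subsetD)+
        then show ?thesis using \<open>fst i < snd i\<close> by auto
      qed
      show "\<exists>i\<in>K1. fst i \<le> x \<and> x \<le> snd i \<and> snd i - fst i < \<delta>'" if x: "x \<in> E" "0 < \<delta>'" for x \<delta>'
      proof -
        obtain \<epsilon> where \<epsilon>: "\<epsilon> > 0" "\<And>l r. l \<le> x \<Longrightarrow> x \<le> r \<Longrightarrow> r - l < \<epsilon> \<Longrightarrow> {l..r} \<subseteq> V"
          using small_closed_interval_in_open[OF V(1)] V(2) x(1) by blast
        have "\<exists>l r. l \<le> x \<and> x \<le> r \<and> l < r \<and> r - l < min \<epsilon> \<delta>' \<and> u r - u l < \<alpha> * (r - l)"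
          using x \<epsilon>(1) unfolding E_def oscillation_set_def by (auto simp del: min_less_iff_conj)
        then obtain l r where "l \<le> x" "x \<le> r" "l < r" "r - l < min \<epsilon> \<delta>'" "u r - u l < \<alpha> * (r - l)"
          by blast
        then show ?thesis using \<epsilon>(2)[of l r] by (intro bexI[of _ "(l, r)"]) (auto simp: K1_def)
      qed
    qed (use \<delta> in auto)
    have C1K: "fst i < snd i \<and> c \<le> fst i \<and> snd i \<le> d" "{fst i..snd i} \<subseteq> V"
      "u (snd i) - u (fst i) < \<alpha> * (snd i - fst i)" if "i \<in> C1" for i
    proof -
      have "i \<in> K1" using that C1(2) by auto
      then show *: "{fst i..snd i} \<subseteq> V" "u (snd i) - u (fst i) < \<alpha> * (snd i - fst i)"
        by (auto simp: K1_def)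
      have "fst i < snd i" using \<open>i \<in> K1\<close> by (auto simp: K1_def)
      moreover have "{fst i..snd i} \<subseteq> {c<..<d}" using * V(3) by auto
      then have "fst i \<in> {c<..<d}" "snd i \<in> {c<..<d}"
        using calculation by (meson atLeastAtMost_iff less_imp_le order_refl subsetD)+
      ultimately show "fst i < snd i \<and> c \<le> fst i \<and> snd i \<le> d" by auto
    qed
    \<comment> \<open>The endpoints are discarded, so that the remaining points are interior to the first intervals.\<close>
    define P where "P = fst ` C1 \<union> snd ` C1"
    have P: "negligible P" unfolding P_def using C1(1) by (intro negligible_finite) auto
    define K2 where "K2 = {(l, r). l < r \<and> (\<exists>i\<in>C1. {l..r} \<subseteq> {fst i<..<snd i}) \<and> u r - u l > \<beta> * (r - l)}"
    obtain C2 T2 where C2: "finite C2" "C2 \<subseteq> K2"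
      "\<And>i j. i \<in> C2 \<Longrightarrow> j \<in> C2 \<Longrightarrow> i \<noteq> j \<Longrightarrow> {fst i..snd i} \<inter> {fst j..snd j} = {}"
      "T2 \<in> lmeasurable" "measure lebesgue T2 < \<delta>" "E - T1 - P \<subseteq> T2 \<union> (\<Union>i\<in>C2. {fst i..snd i})"
    proof (rule vitali_finite_cover[of K2 fst snd c d "E - T1 - P" \<delta>])
      show "fst i < snd i \<and> c \<le> fst i \<and> snd i \<le> d" if iK: "i \<in> K2" for i
      proof -
        obtain j where j: "fst i < snd i" "j \<in> C1" "{fst i..snd i} \<subseteq> {fst j<..<snd j}"
          using iK unfolding K2_def by (cases i) (simp, blast)
        then have "fst i \<in> {fst j<..<snd j}" "snd i \<in> {fst j<..<snd j}"
          by (meson atLeastAtMost_iff less_imp_le order_refl subsetD)+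
        then have "fst j < fst i" "snd i < snd j" by auto
        then show ?thesis using j(1) C1K(1)[OF j(2)] by auto
      qed
      show "\<exists>i\<in>K2. fst i \<le> x \<and> x \<le> snd i \<and> snd i - fst i < \<delta>'"
        if x: "x \<in> E - T1 - P" "0 < \<delta>'" for x \<delta>'
      proof -
        obtain j where j: "j \<in> C1" "x \<in> {fst j..snd j}" using x C1(6) by auto
        have "x \<noteq> fst j" "x \<noteq> snd j" using x(1) j(1) by (auto simp: P_def)
        then have "x \<in> {fst j<..<snd j}" using j(2) by auto
        then obtain \<epsilon> where \<epsilon>: "\<epsilon> > 0"
          "\<And>l r. l \<le> x \<Longrightarrow> x \<le> r \<Longrightarrow> r - l < \<epsilon> \<Longrightarrow> {l..r} \<subseteq> {fst j<..<snd j}"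
          using small_closed_interval_in_open[of "{fst j<..<snd j}" x] by (metis open_greaterThanLessThan)
        have "\<exists>l r. l \<le> x \<and> x \<le> r \<and> l < r \<and> r - l < min \<epsilon> \<delta>' \<and> u r - u l > \<beta> * (r - l)"
          using x \<epsilon>(1) unfolding E_def oscillation_set_def by (auto simp del: min_less_iff_conj)
        then obtain l r where "l \<le> x" "x \<le> r" "l < r" "r - l < min \<epsilon> \<delta>'" "u r - u l > \<beta> * (r - l)"
          by blast
        then show ?thesis using \<epsilon>(2)[of l r] j(1)
          by (intro bexI[of _ "(l, r)"]) (auto simp: K2_def intro!: bexI[of _ j])
      qed
    qed (use \<delta> in auto)
    have C2K: "fst i < snd i \<and> c \<le> fst i \<and> snd i \<le> d" "\<exists>j\<in>C1. {fst i..snd i} \<subseteq> {fst j..snd j}"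
      "u (snd i) - u (fst i) > \<beta> * (snd i - fst i)" if "i \<in> C2" for i
    proof -
      have i: "i \<in> K2" using that C2(2) by auto
      then show "u (snd i) - u (fst i) > \<beta> * (snd i - fst i)"
        by (auto simp: K2_def)
      obtain j where j: "fst i < snd i" "j \<in> C1" "{fst i..snd i} \<subseteq> {fst j<..<snd j}"
        using i unfolding K2_def by (cases i) (simp, blast)
      moreover have "{fst j<..<snd j} \<subseteq> {fst j..snd j}" by auto
      ultimately show "\<exists>j\<in>C1. {fst i..snd i} \<subseteq> {fst j..snd j}" by blast
      from j have "fst i \<in> {fst j<..<snd j}" "snd i \<in> {fst j<..<snd j}"
        by (meson atLeastAtMost_iff less_imp_le order_refl subsetD)+
      then have "fst j < fst i" "snd i < snd j" by auto
      then show "fst i < snd i \<and> c \<le> fst i \<and> snd i \<le> d" using j(1) C1K(1)[OF j(2)] by auto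
    qed
    have C1': "\<forall>i\<in>C1. fst i < snd i \<and> c \<le> fst i \<and> snd i \<le> d"
      "\<forall>i\<in>C1. \<forall>j\<in>C1. i \<noteq> j \<longrightarrow> {fst i..snd i} \<inter> {fst j..snd j} = {}"
      using C1K(1) C1(3) by blast+
    have C2': "\<forall>i\<in>C2. fst i < snd i \<and> c \<le> fst i \<and> snd i \<le> d"
      "\<forall>i\<in>C2. \<forall>j\<in>C2. i \<noteq> j \<longrightarrow> {fst i..snd i} \<inter> {fst j..snd j} = {}"
      using C2K(1) C2(3) by blast+
    note I1 = disjoint_intervals_image[OF C1(1) C1']
    note I2 = disjoint_intervals_image[OF C2(1) C2']
    define X where "X = (\<Sum>i\<in>C1. snd i - fst i)"
    define Y where "Y = (\<Sum>i\<in>C2. snd i - fst i)"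
    have UC: "(\<Union>i\<in>C1. {fst i..snd i}) \<in> lmeasurable" "(\<Union>i\<in>C2. {fst i..snd i}) \<in> lmeasurable"
      using C1(1) C2(1) by (auto intro!: fmeasurable.finite_UN)
    have X1: "X \<le> measure lebesgue V"
      unfolding X_def I1(4)[symmetric] using UC Vm C1K(2)
      by (intro measure_mono_fmeasurable) (auto simp: fmeasurableD)
    have Y1: "Y \<le> measure lebesgue V"
      unfolding Y_def I2(4)[symmetric] using UC Vm C1K(2) C2K(2)
      by (intro measure_mono_fmeasurable) (fastforce simp: fmeasurableD)+
    have "e \<le> measure lebesgue (T1 \<union> (\<Union>i\<in>C1. {fst i..snd i}))"
      using C1(4,6) UC by (intro e_le) auto
    also have "\<dots> \<le> measure lebesgue T1 + X"
      unfolding X_def I1(4)[symmetric] using C1(4) UC by (intro measure_Un_le) (auto simp: fmeasurableD)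
    finally have X2: "e \<le> \<delta> + X" using C1(5) by simp
    have "e \<le> measure lebesgue ((T1 \<union> (P \<union> T2)) \<union> (\<Union>i\<in>C2. {fst i..snd i}))"
      using C1(4) C2(4,6) UC P by (intro e_le) (auto intro!: fmeasurable.Un simp: negligible_imp_measurable)
    also have "\<dots> \<le> measure lebesgue (T1 \<union> (P \<union> T2)) + Y"
      unfolding Y_def I2(4)[symmetric] using C1(4) C2(4) UC P
      by (intro measure_Un_le) (auto intro!: fmeasurableD fmeasurable.Un simp: negligible_imp_measurable)
    also have "measure lebesgue (T1 \<union> (P \<union> T2)) \<le> measure lebesgue T1 + measure lebesgue (P \<union> T2)"
      using C1(4) C2(4) P
      by (intro measure_Un_le) (auto intro!: fmeasurableD fmeasurable.Un simp: negligible_imp_measurable)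
    also have "measure lebesgue (P \<union> T2) \<le> measure lebesgue P + measure lebesgue T2"
      using C2(4) P
      by (intro measure_Un_le) (auto intro!: fmeasurableD simp: negligible_imp_measurable)
    also have "measure lebesgue P = 0" using P by (simp add: negligible_imp_measure0)
    finally have Y2: "e \<le> 2 * \<delta> + Y" using C1(5) C2(5) by simp
    have XY: "X - Y < \<delta>0" using X1 Y2 mV \<delta> by simp
    have "cmod ((\<Sum>i\<in>C1. complex_of_real (u (snd i)) - complex_of_real (u (fst i)))
             - (\<Sum>i\<in>C2. complex_of_real (u (snd i)) - complex_of_real (u (fst i)))) < \<eta>"
      unfolding I1(2)[of "\<lambda>x. complex_of_real (u x)", symmetric]
        I2(2)[of "\<lambda>x. complex_of_real (u x)", symmetric]
    proof (rule gap[OF I1(1) I2(1)])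
      show "\<exists>K\<in>(\<lambda>i. {fst i..snd i}) ` C1. L \<subseteq> K" if "L \<in> (\<lambda>i. {fst i..snd i}) ` C2" for L
        using that C2K(2) by auto
      show "(\<Sum>K\<in>(\<lambda>i. {fst i..snd i}) ` C1. increment (\<lambda>x. x) K) -
            (\<Sum>K\<in>(\<lambda>i. {fst i..snd i}) ` C2. increment (\<lambda>x. x) K) < \<delta>0"
        unfolding I1(2) I2(2) using XY by (simp add: X_def Y_def)
    qed
    also have "(\<Sum>i\<in>C1. complex_of_real (u (snd i)) - complex_of_real (u (fst i)))
             - (\<Sum>i\<in>C2. complex_of_real (u (snd i)) - complex_of_real (u (fst i)))
        = of_real ((\<Sum>i\<in>C1. u (snd i) - u (fst i)) - (\<Sum>i\<in>C2. u (snd i) - u (fst i)))"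
      by simp
    finally have "\<bar>(\<Sum>i\<in>C1. u (snd i) - u (fst i)) - (\<Sum>i\<in>C2. u (snd i) - u (fst i))\<bar> < \<eta>"
      unfolding norm_of_real .
    moreover have "(\<Sum>i\<in>C1. u (snd i) - u (fst i)) \<le> \<alpha> * X"
      unfolding X_def sum_distrib_left using C1K(3) by (intro sum_mono) (auto intro: less_imp_le)
    moreover have "(\<Sum>i\<in>C2. u (snd i) - u (fst i)) \<ge> \<beta> * Y"
      unfolding Y_def sum_distrib_left using C2K(3) by (intro sum_mono) (auto intro: less_imp_le)
    ultimately have 1: "\<beta> * Y \<le> \<alpha> * X + \<eta>" by linarith
    have "\<bar>X - e\<bar> \<le> 2 * \<delta>" "\<bar>Y - e\<bar> \<le> 2 * \<delta>" using X1 X2 Y1 Y2 mV \<delta> by linarith+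
    then have "\<bar>\<alpha>\<bar> * \<bar>X - e\<bar> \<le> \<bar>\<alpha>\<bar> * (2 * \<eta>)" "\<bar>\<beta>\<bar> * \<bar>Y - e\<bar> \<le> \<bar>\<beta>\<bar> * (2 * \<eta>)"
      using \<delta> by (intro mult_left_mono; linarith)+
    then have "\<alpha> * X - \<alpha> * e \<le> \<bar>\<alpha>\<bar> * (2 * \<eta>)" "\<beta> * e - \<beta> * Y \<le> \<bar>\<beta>\<bar> * (2 * \<eta>)"
      unfolding abs_mult[symmetric] right_diff_distrib by linarith+
    then show ?thesis using 1 by (simp add: algebra_simps)
  qed
  have "e \<le> 0"
  proof (rule ccontr)
    assume "\<not> e \<le> 0"
    define \<kappa> where "\<kappa> = 1 + 2 * \<bar>\<alpha>\<bar> + 2 * \<bar>\<beta>\<bar>"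
    have "\<kappa> > 0" unfolding \<kappa>_def by (simp add: add_pos_nonneg)
    have "(\<beta> - \<alpha>) * e > 0" using \<open>\<not> e \<le> 0\<close> \<open>\<alpha> < \<beta>\<close> by simp
    moreover have "(\<beta> - \<alpha>) * e \<le> (\<beta> - \<alpha>) * e / (2 * \<kappa>) * \<kappa>"
      using key[of "(\<beta> - \<alpha>) * e / (2 * \<kappa>)"] calculation \<open>\<kappa> > 0\<close> by (simp add: \<kappa>_def[symmetric])
    moreover have "(\<beta> - \<alpha>) * e / (2 * \<kappa>) * \<kappa> = (\<beta> - \<alpha>) * e / 2"
      using \<open>\<kappa> > 0\<close> by simp
    ultimately show False by linarith
  qed
  have "negligible E"
    unfolding negligible_outer
  proof (intro allI impI)
    fix \<epsilon> :: real assume "\<epsilon> > 0"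
    then have "(INF T\<in>\<M>. measure lebesgue T) < \<epsilon>" using \<open>e \<le> 0\<close> by (simp add: e_def)
    then show "\<exists>T. E \<subseteq> T \<and> T \<in> lmeasurable \<and> measure lebesgue T < \<epsilon>"
      using cINF_less_iff[of \<M> "measure lebesgue" \<epsilon>] ne bdd by (auto simp: \<M>_def)
  qed
  then show ?thesis unfolding E_def .
qed

text \<open>
  Locally the variation is at most \<open>1\<close>, while intervals of slope at least \<open>\<kappa>\<close>
  and total length \<open>X\<close> contribute \<open>\<kappa> X\<close> to it.
\<close>

lemma negligible_steep_set:
  fixes u :: "real \<Rightarrow> real"
  assumes ac: "AC_on c d (\<lambda>x. complex_of_real (u x))"
  shows "negligible (steep_set u \<inter> {c<..<d})"
proof -
  obtain \<delta> where \<delta>: "\<delta> > 0" and var: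
    "\<And>D. interval_family c d D \<Longrightarrow> (\<Sum>K\<in>D. increment (\<lambda>x. x) K) < \<delta> \<Longrightarrow>
        (\<Sum>K\<in>D. cmod (increment (\<lambda>x. complex_of_real (u x)) K)) < 1"
    using AC_on_interval_family[OF ac zero_less_one] by blast
  show ?thesis
  proof (subst locally_negligible_alt, intro ballI)
    fix x0 assume x0: "x0 \<in> steep_set u \<inter> {c<..<d}"
    define L where "L = {max c (x0 - \<delta> / 4)<..<min d (x0 + \<delta> / 4)}"
    define E where "E = steep_set u \<inter> L"
    have "negligible E"
      unfolding negligible_outer
    proof (intro allI impI)
      fix \<epsilon> :: real assume \<epsilon>: "\<epsilon> > 0"
      define \<kappa> where "\<kappa> = 2 / \<epsilon>"
      define K where "K = {(l, r). l < r \<and> {l..r} \<subseteq> L \<and> \<bar>u r - u l\<bar> > \<kappa> * (r - l)}"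
      obtain C T where C: "finite C" "C \<subseteq> K"
        "\<And>i j. i \<in> C \<Longrightarrow> j \<in> C \<Longrightarrow> i \<noteq> j \<Longrightarrow> {fst i..snd i} \<inter> {fst j..snd j} = {}"
        "T \<in> lmeasurable" "measure lebesgue T < \<epsilon> / 2" "E \<subseteq> T \<union> (\<Union>i\<in>C. {fst i..snd i})"
      proof (rule vitali_finite_cover[of K fst snd c d E "\<epsilon> / 2"])
        show "fst i < snd i \<and> c \<le> fst i \<and> snd i \<le> d" if "i \<in> K" for i
        proof -
          have "fst i < snd i" "{fst i..snd i} \<subseteq> L" using that by (auto simp: K_def)
          then have "fst i \<in> L" "snd i \<in> L" by auto
          then show ?thesis using \<open>fst i < snd i\<close> by (auto simp: L_def)
        qed
        show "\<exists>i\<in>K. fst i \<le> x \<and> x \<le> snd i \<and> snd i - fst i < \<delta>'" if x: "x \<in> E" "0 < \<delta>'" for x \<delta>'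
        proof -
          obtain \<epsilon>' where \<epsilon>': "\<epsilon>' > 0" "\<And>l r. l \<le> x \<Longrightarrow> x \<le> r \<Longrightarrow> r - l < \<epsilon>' \<Longrightarrow> {l..r} \<subseteq> L"
            using small_closed_interval_in_open[of L x] x(1) unfolding E_def L_def
            by (metis IntD2 open_greaterThanLessThan)
          have "\<exists>l r. l \<le> x \<and> x \<le> r \<and> l < r \<and> r - l < min \<epsilon>' \<delta>' \<and> \<bar>u r - u l\<bar> > \<kappa> * (r - l)"
            using x \<epsilon>'(1) unfolding E_def steep_set_def by (auto simp del: min_less_iff_conj)
          then obtain l r where "l \<le> x" "x \<le> r" "l < r" "r - l < min \<epsilon>' \<delta>'" "\<bar>u r - u l\<bar> > \<kappa> * (r - l)"
            by blast
          then show ?thesis using \<epsilon>'(2)[of l r] by (intro bexI[of _ "(l, r)"]) (auto simp: K_def)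
        qed
      qed (use \<epsilon> in auto)
      have CK: "fst i < snd i \<and> c \<le> fst i \<and> snd i \<le> d" "{fst i..snd i} \<subseteq> L"
        "\<bar>u (snd i) - u (fst i)\<bar> > \<kappa> * (snd i - fst i)" if "i \<in> C" for i
      proof -
        have "i \<in> K" using that C(2) by auto
        then have *: "fst i < snd i" "{fst i..snd i} \<subseteq> L" by (auto simp: K_def)
        show "\<bar>u (snd i) - u (fst i)\<bar> > \<kappa> * (snd i - fst i)" "{fst i..snd i} \<subseteq> L"
          using \<open>i \<in> K\<close> by (auto simp: K_def)
        have "fst i \<in> L" "snd i \<in> L" using * by auto
        then show "fst i < snd i \<and> c \<le> fst i \<and> snd i \<le> d" using * by (auto simp: L_def)
      qed
      have C': "\<forall>i\<in>C. fst i < snd i \<and> c \<le> fst i \<and> snd i \<le> d"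
        "\<forall>i\<in>C. \<forall>j\<in>C. i \<noteq> j \<longrightarrow> {fst i..snd i} \<inter> {fst j..snd j} = {}"
        using CK(1) C(3) by blast+
      note I = disjoint_intervals_image[OF C(1) C']
      define X where "X = (\<Sum>i\<in>C. snd i - fst i)"
      have UC: "(\<Union>i\<in>C. {fst i..snd i}) \<in> lmeasurable"
        using C(1) by (auto intro!: fmeasurable.finite_UN)
      have "L \<subseteq> {x0 - \<delta> / 4..x0 + \<delta> / 4}" by (auto simp: L_def)
      then have "(\<Union>i\<in>C. {fst i..snd i}) \<subseteq> {x0 - \<delta> / 4..x0 + \<delta> / 4}"
        using CK(2) by blast
      then have "measure lebesgue (\<Union>i\<in>C. {fst i..snd i}) \<le> measure lebesgue {x0 - \<delta> / 4..x0 + \<delta> / 4}"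
        using UC by (intro measure_mono_fmeasurable) (auto simp: fmeasurableD)
      then have "X \<le> measure lebesgue {x0 - \<delta> / 4..x0 + \<delta> / 4}"
        unfolding I(4) X_def[symmetric] .
      then have "X < \<delta>" using \<delta> by simp
      have "(\<Sum>i\<in>C. cmod (complex_of_real (u (snd i)) - complex_of_real (u (fst i)))) < 1"
        using var[OF disjoint_intervals_imp_family[OF I(1)]] \<open>X < \<delta>\<close>
        by (simp add: I(2) I(3)[of "\<lambda>x. complex_of_real (u x)"] X_def del: of_real_diff)
      moreover have "\<kappa> * X \<le> (\<Sum>i\<in>C. cmod (complex_of_real (u (snd i)) - complex_of_real (u (fst i))))"
        unfolding X_def sum_distrib_left using CK(3)
        by (intro sum_mono) (auto simp flip: of_real_diff intro: less_imp_le)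
      ultimately have "\<kappa> * X < 1" by linarith
      then have "X < \<epsilon> / 2" using \<epsilon> by (simp add: \<kappa>_def field_simps)
      show "\<exists>T. E \<subseteq> T \<and> T \<in> lmeasurable \<and> measure lebesgue T < \<epsilon>"
      proof (intro exI conjI)
        show "E \<subseteq> T \<union> (\<Union>i\<in>C. {fst i..snd i})" by (rule C)
        show "T \<union> (\<Union>i\<in>C. {fst i..snd i}) \<in> lmeasurable" using C(4) UC by auto
        have "measure lebesgue (T \<union> (\<Union>i\<in>C. {fst i..snd i})) \<le> measure lebesgue T + X"
          unfolding X_def I(4)[symmetric] using C(4) UC
          by (intro measure_Un_le) (auto simp: fmeasurableD)
        then show "measure lebesgue (T \<union> (\<Union>i\<in>C. {fst i..snd i})) < \<epsilon>"
          using C(5) \<open>X < \<epsilon> / 2\<close> by simp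
      qed
    qed
    then have "negligible (steep_set u \<inter> {c<..<d} \<inter> L)"
      by (rule negligible_subset) (auto simp: E_def)
    moreover have "openin (top_of_set (steep_set u \<inter> {c<..<d})) (steep_set u \<inter> {c<..<d} \<inter> L)"
      unfolding L_def by (intro openin_open_Int) simp
    moreover have "x0 \<in> L" using x0 \<delta> by (simp add: L_def)
    ultimately show "\<exists>U. openin (top_of_set (steep_set u \<inter> {c<..<d})) U \<and> x0 \<in> U \<and> negligible U"
      using x0 by blast
  qed
qed

lemma has_vector_derivative_intervalI:
  fixes F :: "real \<Rightarrow> 'a::real_normed_vector"
  assumes "\<And>\<epsilon>. \<epsilon> > 0 \<Longrightarrow> \<exists>\<delta>>0. \<forall>l r. (l = x \<or> r = x) \<longrightarrow> l < r \<longrightarrow> r - l < \<delta> \<longrightarrow>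
     norm (F r - F l - (r - l) *\<^sub>R D) \<le> \<epsilon> * (r - l)"
  shows "(F has_vector_derivative D) (at x)"
  unfolding has_vector_derivative_def has_derivative_at_alt
proof (intro conjI allI impI)
  show "bounded_linear (\<lambda>h. h *\<^sub>R D)" by (rule bounded_linear_scaleR_left)
  fix \<epsilon> :: real assume "0 < \<epsilon>"
  then obtain \<delta> where \<delta>: "\<delta> > 0" "\<And>l r. (l = x \<or> r = x) \<Longrightarrow> l < r \<Longrightarrow> r - l < \<delta> \<Longrightarrow>
     norm (F r - F l - (r - l) *\<^sub>R D) \<le> \<epsilon> * (r - l)"
    using assms by metis
  show "\<exists>d>0. \<forall>y. norm (y - x) < d \<longrightarrow> norm (F y - F x - (y - x) *\<^sub>R D) \<le> \<epsilon> * norm (y - x)"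
  proof (intro exI conjI allI impI)
    fix y assume y: "norm (y - x) < \<delta>"
    consider "y = x" | "x < y" | "y < x" by linarith
    then show "norm (F y - F x - (y - x) *\<^sub>R D) \<le> \<epsilon> * norm (y - x)"
    proof cases
      case 2 then show ?thesis using \<delta>(2)[of x y] y by simp
    next
      case 3
      have "norm (F y - F x - (y - x) *\<^sub>R D) = norm (F x - F y - (x - y) *\<^sub>R D)"
        by (subst norm_minus_cancel[symmetric]) (simp add: algebra_simps)
      then show ?thesis using \<delta>(2)[of y x] y 3 by simp
    qed simp
  qed (rule \<delta>)
qed

text \<open>
  Outside of the steep set and the oscillation sets with rational parameters, the infimum \<open>L\<close> of
  the eventual upper bounds of the slopes is the derivative.
\<close>

lemma AC_real_differentiable_ae:
  assumes ac: "AC_on c d (\<lambda>x. complex_of_real (u x))"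
  obtains N where "negligible N"
    "\<And>x. x \<in> {c<..<d} - N \<Longrightarrow> \<exists>D. (u has_vector_derivative D) (at x)"
proof
  define N where "N = (steep_set u \<inter> {c<..<d}) \<union>
     (\<Union>z\<in>{z\<in>\<rat> \<times> \<rat>. fst z < snd z}. oscillation_set u (fst z) (snd z) \<inter> {c<..<d})"
  show "negligible N"
    unfolding N_def
  proof (intro negligible_Un negligible_steep_set[OF ac] negligible_countable_Union)
    have "countable ((\<rat>::real set) \<times> (\<rat>::real set))" by (intro countable_SIGMA countable_rat)
    then show "countable ((\<lambda>z. oscillation_set u (fst z) (snd z) \<inter> {c<..<d}) ` {z \<in> \<rat> \<times> \<rat>. fst z < snd z})"
      by (intro countable_image countable_subset[of "{z \<in> \<rat> \<times> \<rat>. fst z < snd z}" "\<rat> \<times> \<rat>"]) auto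
  qed (auto intro: negligible_oscillation_set[OF ac])
  fix x assume x: "x \<in> {c<..<d} - N"
  then have "x \<notin> steep_set u" by (auto simp: N_def)
  then obtain \<kappa> \<delta>0 where \<delta>0: "\<delta>0 > 0" and \<kappa>: "\<And>l r. l \<le> x \<Longrightarrow> x \<le> r \<Longrightarrow> l < r \<Longrightarrow> r - l < \<delta>0 \<Longrightarrow>
     \<bar>u r - u l\<bar> \<le> \<kappa> * (r - l)"
    unfolding steep_set_def by (auto simp: not_less) (meson not_less)
  \<comment> \<open>The eventual upper bounds of the slopes at \<open>x\<close>.\<close>
  define B where "B = {\<beta>. \<exists>\<delta>>0. \<forall>l r. l \<le> x \<longrightarrow> x \<le> r \<longrightarrow> l < r \<longrightarrow> r - l < \<delta> \<longrightarrow> u r - u l \<le> \<beta> * (r - l)}"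
  have "\<kappa> \<in> B" unfolding B_def using \<delta>0 \<kappa> by (auto simp: abs_le_iff)
  have Bge: "\<beta> \<ge> - \<kappa>" if \<beta>: "\<beta> \<in> B" for \<beta>
  proof -
    obtain \<delta> where \<delta>: "\<delta> > 0" "\<And>l r. l \<le> x \<Longrightarrow> x \<le> r \<Longrightarrow> l < r \<Longrightarrow> r - l < \<delta> \<Longrightarrow> u r - u l \<le> \<beta> * (r - l)"
      using \<beta> unfolding B_def by blast
    define h where "h = min \<delta> \<delta>0 / 2"
    have h: "h > 0" "h < \<delta>" "h < \<delta>0" using \<delta>(1) \<delta>0 by (auto simp: h_def)
    have "- \<kappa> * h \<le> u (x + h) - u x" using \<kappa>[of x "x + h"] h by (simp add: abs_le_iff)
    also have "\<dots> \<le> \<beta> * h" using \<delta>(2)[of x "x + h"] h by simp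
    finally show ?thesis using h(1) by (meson mult_le_cancel_right not_less)
  qed
  have bdd: "bdd_below B" by (rule bdd_belowI) (rule Bge)
  define L where "L = Inf B"
  have "(u has_vector_derivative L) (at x)"
  proof (rule has_vector_derivative_intervalI)
    fix \<epsilon> :: real assume \<epsilon>: "\<epsilon> > 0"
    have "Inf B < L + \<epsilon>" using \<epsilon> by (simp add: L_def)
    then obtain \<beta> where "\<beta> \<in> B" and \<beta>: "\<beta> < L + \<epsilon>"
      using cInf_less_iff[of B "L + \<epsilon>"] \<open>\<kappa> \<in> B\<close> bdd by auto
    then obtain \<delta>1 where \<delta>1: "\<delta>1 > 0"
      "\<And>l r. l \<le> x \<Longrightarrow> x \<le> r \<Longrightarrow> l < r \<Longrightarrow> r - l < \<delta>1 \<Longrightarrow> u r - u l \<le> \<beta> * (r - l)"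
      unfolding B_def by blast
    \<comment> \<open>Since \<open>\<beta>'\<close> is no eventual upper bound and \<open>x\<close> is in no oscillation set, \<open>\<alpha>'\<close> is an eventual lower bound.\<close>
    obtain \<alpha>' where \<alpha>': "\<alpha>' \<in> \<rat>" "L - \<epsilon> < \<alpha>'" "\<alpha>' < L" using Rats_dense_in_real[of "L - \<epsilon>" L] \<epsilon> by auto
    obtain \<beta>' where \<beta>': "\<beta>' \<in> \<rat>" "\<alpha>' < \<beta>'" "\<beta>' < L" using Rats_dense_in_real[of \<alpha>' L] \<alpha>' by auto
    have "\<beta>' \<notin> B" using \<beta>'(3) cInf_lower[OF _ bdd, of \<beta>'] by (auto simp: L_def)
    then have *: "\<forall>\<delta>>0. \<exists>l r. l \<le> x \<and> x \<le> r \<and> l < r \<and> r - l < \<delta> \<and> u r - u l > \<beta>' * (r - l)"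
      unfolding B_def by (simp add: not_le)
    have "x \<notin> oscillation_set u \<alpha>' \<beta>'" using x \<alpha>' \<beta>' unfolding N_def by auto
    then have "\<exists>\<delta>>0. \<forall>l r. l \<le> x \<and> x \<le> r \<and> l < r \<and> r - l < \<delta> \<longrightarrow> \<not> u r - u l < \<alpha>' * (r - l)"
      using * unfolding oscillation_set_def by blast
    then obtain \<delta>2 where \<delta>2: "\<delta>2 > 0"
      "\<And>l r. l \<le> x \<Longrightarrow> x \<le> r \<Longrightarrow> l < r \<Longrightarrow> r - l < \<delta>2 \<Longrightarrow> \<alpha>' * (r - l) \<le> u r - u l"
      by (auto simp: not_less)
    have "norm (u r - u l - (r - l) *\<^sub>R L) \<le> \<epsilon> * (r - l)"
      if lr: "l = x \<or> r = x" "l < r" "r - l < min \<delta>1 \<delta>2" for l r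
    proof -
      have "u r - u l \<le> \<beta> * (r - l)" "\<alpha>' * (r - l) \<le> u r - u l"
        using \<delta>1(2)[of l r] \<delta>2(2)[of l r] lr by auto
      moreover have "\<beta> * (r - l) \<le> (L + \<epsilon>) * (r - l)" "(L - \<epsilon>) * (r - l) \<le> \<alpha>' * (r - l)"
        using \<beta> \<alpha>'(2) lr by (intro mult_right_mono; simp)+
      ultimately show ?thesis by (simp add: abs_le_iff algebra_simps)
    qed
    then show "\<exists>\<delta>>0. \<forall>l r. (l = x \<or> r = x) \<longrightarrow> l < r \<longrightarrow> r - l < \<delta> \<longrightarrow>
       norm (u r - u l - (r - l) *\<^sub>R L) \<le> \<epsilon> * (r - l)"
      using \<delta>1(1) \<delta>2(1) by (intro exI[of _ "min \<delta>1 \<delta>2"]) auto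
  qed
  then show "\<exists>D. (u has_vector_derivative D) (at x)" by blast
qed

text \<open>
  Increments that are bounded by those of absolutely continuous functions are absolutely continuous; this gives
  closure under differences, products and components.
\<close>

lemma AC_on_lincomb:
  assumes f: "AC_on c d f" and g: "AC_on c d g" and "M > 0"
    and le: "\<And>x y. c \<le> x \<Longrightarrow> x \<le> y \<Longrightarrow> y \<le> d \<Longrightarrow>
      cmod (h y - h x) \<le> M * cmod (f y - f x) + M * cmod (g y - g x)"
  shows "AC_on c d h"
  unfolding AC_on_def
proof (intro allI impI)
  fix \<epsilon> :: real assume "\<epsilon> > 0"
  then have \<epsilon>': "\<epsilon> / (2 * M) > 0" using \<open>M > 0\<close> by simp
  obtain \<delta>1 where \<delta>1: "\<delta>1 > 0" "\<And>(n::nat) s t.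
        (\<forall>i<n. c \<le> s i \<and> s i \<le> t i \<and> t i \<le> d) \<Longrightarrow>
        disjoint_family_on (\<lambda>i. {s i<..<t i}) {..<n} \<Longrightarrow>
        (\<Sum>i<n. t i - s i) < \<delta>1 \<Longrightarrow> (\<Sum>i<n. cmod (f (t i) - f (s i))) < \<epsilon> / (2 * M)"
    using f \<epsilon>' unfolding AC_on_def by meson
  obtain \<delta>2 where \<delta>2: "\<delta>2 > 0" "\<And>(n::nat) s t.
        (\<forall>i<n. c \<le> s i \<and> s i \<le> t i \<and> t i \<le> d) \<Longrightarrow>
        disjoint_family_on (\<lambda>i. {s i<..<t i}) {..<n} \<Longrightarrow>
        (\<Sum>i<n. t i - s i) < \<delta>2 \<Longrightarrow> (\<Sum>i<n. cmod (g (t i) - g (s i))) < \<epsilon> / (2 * M)"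
    using g \<epsilon>' unfolding AC_on_def by meson
  show "\<exists>\<delta>>0. \<forall>(n::nat) s t.
        (\<forall>i<n. c \<le> s i \<and> s i \<le> t i \<and> t i \<le> d) \<and>
        disjoint_family_on (\<lambda>i. {s i<..<t i}) {..<n} \<and>
        (\<Sum>i<n. t i - s i) < \<delta> \<longrightarrow> (\<Sum>i<n. cmod (h (t i) - h (s i))) < \<epsilon>"
  proof (intro exI conjI allI impI)
    show "min \<delta>1 \<delta>2 > 0" using \<delta>1 \<delta>2 by simp
    fix n :: nat and s t :: "nat \<Rightarrow> real"
    assume a: "(\<forall>i<n. c \<le> s i \<and> s i \<le> t i \<and> t i \<le> d) \<and>
        disjoint_family_on (\<lambda>i. {s i<..<t i}) {..<n} \<and> (\<Sum>i<n. t i - s i) < min \<delta>1 \<delta>2"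
    have "(\<Sum>i<n. cmod (h (t i) - h (s i))) \<le>
        (\<Sum>i<n. M * cmod (f (t i) - f (s i)) + M * cmod (g (t i) - g (s i)))"
      using a by (intro sum_mono le) auto
    also have "\<dots> = M * (\<Sum>i<n. cmod (f (t i) - f (s i))) + M * (\<Sum>i<n. cmod (g (t i) - g (s i)))"
      by (simp add: sum.distrib sum_distrib_left)
    also have "\<dots> < M * (\<epsilon> / (2 * M)) + M * (\<epsilon> / (2 * M))"
      using a \<open>M > 0\<close> by (intro add_strict_mono mult_strict_left_mono \<delta>1(2) \<delta>2(2)) auto
    also have "\<dots> = \<epsilon>" using \<open>M > 0\<close> by simp
    finally show "(\<Sum>i<n. cmod (h (t i) - h (s i))) < \<epsilon>" .
  qed
qed

lemma AC_on_mono_norm: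
  assumes f: "AC_on c d f" and le: "\<And>x y. cmod (g y - g x) \<le> cmod (f y - f x)"
  shows "AC_on c d g"
proof (rule AC_on_lincomb[OF f f zero_less_one])
  fix x y
  show "cmod (g y - g x) \<le> 1 * cmod (f y - f x) + 1 * cmod (f y - f x)"
    using le[of y x] norm_ge_zero[of "f y - f x"] by linarith
qed

lemma AC_differentiable_ae:
  assumes ac: "AC_on c d f"
  obtains N where "negligible N"
    "\<And>x. x \<in> {c<..<d} - N \<Longrightarrow> \<exists>D. (f has_vector_derivative D) (at x)"
proof -
  have re: "AC_on c d (\<lambda>x. complex_of_real (Re (f x)))"
    by (rule AC_on_mono_norm[OF ac])
      (metis abs_Re_le_cmod minus_complex.simps(1) norm_of_real of_real_diff)
  have im: "AC_on c d (\<lambda>x. complex_of_real (Im (f x)))"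
    by (rule AC_on_mono_norm[OF ac])
      (metis abs_Im_le_cmod minus_complex.simps(2) norm_of_real of_real_diff)
  obtain N1 where N1: "negligible N1"
    "\<And>x. x \<in> {c<..<d} - N1 \<Longrightarrow> \<exists>D. ((\<lambda>x. Re (f x)) has_vector_derivative D) (at x)"
    using AC_real_differentiable_ae[OF re] by blast
  obtain N2 where N2: "negligible N2"
    "\<And>x. x \<in> {c<..<d} - N2 \<Longrightarrow> \<exists>D. ((\<lambda>x. Im (f x)) has_vector_derivative D) (at x)"
    using AC_real_differentiable_ae[OF im] by blast
  show thesis
  proof (rule that[of "N1 \<union> N2"])
    show "negligible (N1 \<union> N2)" using N1 N2 by simp
    fix x assume "x \<in> {c<..<d} - (N1 \<union> N2)"
    then obtain D1 D2 where "((\<lambda>x. Re (f x)) has_vector_derivative D1) (at x)"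
      "((\<lambda>x. Im (f x)) has_vector_derivative D2) (at x)" using N1(2)[of x] N2(2)[of x] by auto
    then have "(f has_vector_derivative Complex D1 D2) (at x)"
      by (simp add: has_vector_derivative_complex_iff has_real_derivative_iff_has_vector_derivative)
    then show "\<exists>D. (f has_vector_derivative D) (at x)" by blast
  qed
qed

text \<open>
  Intervals with small slope cover \<open>[c, d]\<close> up to gaps of small total length, and over the gaps the
  increments are small by absolute continuity.
\<close>

lemma AC_zero_derivative_imp_const:
  assumes ac: "AC_on c d f" and "c < d" and N: "negligible N"
    and deriv: "\<And>x. x \<in> {c<..<d} - N \<Longrightarrow> (f has_vector_derivative 0) (at x)"
  shows "f d = f c"
proof -
  have "cmod (f d - f c) \<le> \<epsilon>" if \<epsilon>: "\<epsilon> > 0" for \<epsilon>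
  proof -
    define \<eta> where "\<eta> = \<epsilon> / (2 * (d - c))"
    have \<eta>: "\<eta> > 0" using \<epsilon> \<open>c < d\<close> by (simp add: \<eta>_def)
    obtain \<delta> where \<delta>: "\<delta> > 0" and gap:
      "\<And>D1 D2. disjoint_intervals c d D1 \<Longrightarrow> disjoint_intervals c d D2 \<Longrightarrow>
       (\<And>L. L \<in> D2 \<Longrightarrow> \<exists>K\<in>D1. L \<subseteq> K) \<Longrightarrow>
       (\<Sum>K\<in>D1. increment (\<lambda>x. x) K) - (\<Sum>K\<in>D2. increment (\<lambda>x. x) K) < \<delta> \<Longrightarrow>
       cmod ((\<Sum>K\<in>D1. increment f K) - (\<Sum>K\<in>D2. increment f K)) < \<epsilon> / 2"
      using AC_on_gap[OF ac half_gt_zero[OF \<epsilon>]] by blast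
    define K where "K = {(l, r). l < r \<and> c \<le> l \<and> r \<le> d \<and> cmod (f r - f l) \<le> \<eta> * (r - l)}"
    obtain C T where C: "finite C" "C \<subseteq> K"
      "\<And>i j. i \<in> C \<Longrightarrow> j \<in> C \<Longrightarrow> i \<noteq> j \<Longrightarrow> {fst i..snd i} \<inter> {fst j..snd j} = {}"
      "T \<in> lmeasurable" "measure lebesgue T < \<delta>" "{c<..<d} - N \<subseteq> T \<union> (\<Union>i\<in>C. {fst i..snd i})"
    proof (rule vitali_finite_cover[of K fst snd c d "{c<..<d} - N" \<delta>])
      show "\<exists>i\<in>K. fst i \<le> x \<and> x \<le> snd i \<and> snd i - fst i < \<delta>'"
        if x: "x \<in> {c<..<d} - N" "0 < \<delta>'" for x \<delta>'
      proof -
        have "(f has_vector_derivative 0) (at x)" using deriv x by blast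
        then obtain \<rho> where \<rho>: "\<rho> > 0" "\<And>y. norm (y - x) < \<rho> \<Longrightarrow> norm (f y - f x) \<le> \<eta> * norm (y - x)"
          unfolding has_vector_derivative_def has_derivative_at_alt using \<eta> by auto
        define h where "h = min (min \<rho> \<delta>') (d - x) / 2"
        have h: "h > 0" "h < \<rho>" "h < \<delta>'" "x + h < d" using \<rho>(1) x by (auto simp: h_def min_def field_simps)
        show ?thesis using \<rho>(2)[of "x + h"] h x
          by (intro bexI[of _ "(x, x + h)"]) (auto simp: K_def)
      qed
    qed (use \<delta> in \<open>auto simp: K_def\<close>)
    have CK: "fst i < snd i \<and> c \<le> fst i \<and> snd i \<le> d" "cmod (f (snd i) - f (fst i)) \<le> \<eta> * (snd i - fst i)"
      if "i \<in> C" for i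
      using that C(2) by (auto simp: K_def)
    have C': "\<forall>i\<in>C. fst i < snd i \<and> c \<le> fst i \<and> snd i \<le> d"
        "\<forall>i\<in>C. \<forall>j\<in>C. i \<noteq> j \<longrightarrow> {fst i..snd i} \<inter> {fst j..snd j} = {}"
      using CK(1) C(3) by blast+
    note I = disjoint_intervals_image[OF C(1) C']
    define X where "X = (\<Sum>i\<in>C. snd i - fst i)"
    have UC: "(\<Union>i\<in>C. {fst i..snd i}) \<in> lmeasurable"
      using C(1) by (auto intro!: fmeasurable.finite_UN)
    have "measure lebesgue (\<Union>i\<in>C. {fst i..snd i}) \<le> measure lebesgue {c..d}"
      using UC CK(1) by (intro measure_mono_fmeasurable) (force simp: fmeasurableD)+
    then have X1: "X \<le> d - c" unfolding I(4) X_def using \<open>c < d\<close> by simp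
    have Nm: "N \<in> lmeasurable" "measure lebesgue N = 0"
      using N negligible_imp_measurable negligible_imp_measure0 by auto
    have "measure lebesgue {c<..<d} \<le> measure lebesgue ((N \<union> T) \<union> (\<Union>i\<in>C. {fst i..snd i}))"
      using C(4,6) UC Nm(1) by (intro measure_mono_fmeasurable) (auto intro!: fmeasurable.Un)
    also have "\<dots> \<le> measure lebesgue (N \<union> T) + measure lebesgue (\<Union>i\<in>C. {fst i..snd i})"
      using C(4) UC Nm(1) by (intro measure_Un_le) (auto intro!: fmeasurableD fmeasurable.Un)
    also have "measure lebesgue (N \<union> T) \<le> measure lebesgue N + measure lebesgue T"
      using C(4) Nm(1) by (intro measure_Un_le) (auto intro!: fmeasurableD)
    finally have X2: "d - c < \<delta> + X" unfolding I(4) X_def[symmetric] using C(5) Nm(2) \<open>c < d\<close> by simp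
    have D1: "disjoint_intervals c d {{c..d}}" using \<open>c < d\<close> by (auto simp: disjoint_intervals_def)
    have sub: "\<exists>K\<in>{{c..d}}. L \<subseteq> K" if "L \<in> (\<lambda>i. {fst i..snd i}) ` C" for L
      using that CK(1) by fastforce
    have "cmod ((\<Sum>K\<in>{{c..d}}. increment f K) - (\<Sum>K\<in>(\<lambda>i. {fst i..snd i}) ` C. increment f K)) < \<epsilon> / 2"
      using X2 \<open>c < d\<close> by (intro gap[OF D1 I(1) sub]) (auto simp: I(2) X_def[symmetric])
    then have 1: "cmod (f d - f c - (\<Sum>i\<in>C. f (snd i) - f (fst i))) < \<epsilon> / 2"
      using \<open>c < d\<close> by (simp add: I(2))
    have "cmod (\<Sum>i\<in>C. f (snd i) - f (fst i)) \<le> (\<Sum>i\<in>C. cmod (f (snd i) - f (fst i)))" by (rule norm_sum)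
    also have "\<dots> \<le> \<eta> * X" unfolding X_def sum_distrib_left by (intro sum_mono CK(2))
    also have "\<dots> \<le> \<eta> * (d - c)" using X1 \<eta> by (intro mult_left_mono) auto
    also have "\<dots> = \<epsilon> / 2" using \<open>c < d\<close> unfolding \<eta>_def by (simp add: field_simps)
    finally show ?thesis
      using 1 norm_triangle_ineq2[of "f d - f c" "\<Sum>i\<in>C. f (snd i) - f (fst i)"] by linarith
  qed
  then have "cmod (f d - f c) \<le> 0" by (rule field_le_epsilon) simp
  then show ?thesis by simp
qed

section \<open>Lebesgue differentiation and indefinite integrals\<close>

text \<open>
  Lebesgue's differentiation theorem for Henstock--Kurzweil integrable functions. Intervals with an endpoint
  \<open>x\<close> at which the difference quotient deviates from \<open>g x\<close> by more than \<open>1 / (n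
  + 1)\<close> form a partial tagged division, and Henstock's lemma bounds their total length.
\<close>

theorem lebesgue_differentiation:
  fixes g :: "real \<Rightarrow> 'a::euclidean_space"
  assumes g: "g integrable_on {c..d}"
  obtains N where "negligible N"
    "\<And>x. x \<in> {c<..<d} - N \<Longrightarrow> ((\<lambda>x. integral {c..x} g) has_vector_derivative g x) (at x)"
proof
  define F where "F = (\<lambda>x. integral {c..x} g)"
  define bad where "bad = (\<lambda>\<epsilon> x l r. norm (F r - F l - (r - l) *\<^sub>R g x) > \<epsilon> * (r - l))"
  define E where "E = (\<lambda>n::nat. {x \<in> {c<..<d}. \<forall>\<delta>>0. \<exists>l r. (l = x \<or> r = x) \<and> l < r \<and> r - l < \<delta> \<and>
      bad (1 / Suc n) x l r})"
  have Fdiff: "F r - F l = integral {l..r} g" if "c \<le> l" "l \<le> r" "r \<le> d" for l r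
  proof -
    have "g integrable_on {c..r}" using g by (rule integrable_on_subinterval) (use that in auto)
    then show ?thesis
      using Henstock_Kurzweil_Integration.integral_combine[of c l r g] that unfolding F_def
      by (metis add_diff_cancel_left')
  qed
  have neg: "negligible (E n)" for n
    unfolding negligible_outer
  proof (intro allI impI)
    fix \<epsilon> :: real assume \<epsilon>: "\<epsilon> > 0"
    have pos: "\<epsilon> / (2 * Suc n) > 0" using \<epsilon> by simp
    obtain \<gamma> where \<gamma>: "gauge \<gamma>" "\<And>p. \<lbrakk>p tagged_partial_division_of (cbox c d); \<gamma> fine p\<rbrakk> \<Longrightarrow>
        sum (\<lambda>(x,k). norm (measure lborel k *\<^sub>R g x - integral k g)) p < \<epsilon> / (2 * Suc n)"
      using Henstock_lemma[of g c d, OF _ pos] g by auto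
    define K where "K = {(x, l, r). l < r \<and> c \<le> l \<and> r \<le> d \<and> (l = x \<or> r = x) \<and> {l..r} \<subseteq> \<gamma> x \<and>
       bad (1 / Suc n) x l r}"
    define L :: "real \<times> real \<times> real \<Rightarrow> real" where "L = (\<lambda>i. fst (snd i))"
    define R :: "real \<times> real \<times> real \<Rightarrow> real" where "R = (\<lambda>i. snd (snd i))"
    obtain C T where C: "finite C" "C \<subseteq> K"
      "\<And>i j. i \<in> C \<Longrightarrow> j \<in> C \<Longrightarrow> i \<noteq> j \<Longrightarrow> {L i..R i} \<inter> {L j..R j} = {}"
      "T \<in> lmeasurable" "measure lebesgue T < \<epsilon> / 2" "E n \<subseteq> T \<union> (\<Union>i\<in>C. {L i..R i})"
    proof (rule vitali_finite_cover[of K L R c d "E n" "\<epsilon> / 2"])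
      show "L i < R i \<and> c \<le> L i \<and> R i \<le> d" if "i \<in> K" for i
        using that by (auto simp: K_def L_def R_def)
      show "\<exists>i\<in>K. L i \<le> x \<and> x \<le> R i \<and> R i - L i < \<delta>'" if x: "x \<in> E n" "0 < \<delta>'" for x \<delta>'
      proof -
        have op: "open (\<gamma> x \<inter> {c<..<d})" "x \<in> \<gamma> x \<inter> {c<..<d}"
          using \<gamma>(1) x(1) by (auto simp: gauge_def E_def)
        obtain \<rho> where \<rho>: "\<rho> > 0" "\<And>l r. l \<le> x \<Longrightarrow> x \<le> r \<Longrightarrow> r - l < \<rho> \<Longrightarrow> {l..r} \<subseteq> \<gamma> x \<inter> {c<..<d}"
          using small_closed_interval_in_open[OF op] by blast
        have "\<exists>l r. (l = x \<or> r = x) \<and> l < r \<and> r - l < min \<rho> \<delta>' \<and> bad (1 / Suc n) x l r"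
          using x \<rho>(1) unfolding E_def by (auto simp del: min_less_iff_conj)
        then obtain l r where lr: "l = x \<or> r = x" "l < r" "r - l < min \<rho> \<delta>'" "bad (1 / Suc n) x l r"
          by blast
        have sub: "{l..r} \<subseteq> \<gamma> x \<inter> {c<..<d}" using lr by (intro \<rho>(2)) auto
        have "l \<in> {l..r}" "r \<in> {l..r}" using lr(2) by auto
        then have "l \<in> {c<..<d}" "r \<in> {c<..<d}" using sub by blast+
        then show ?thesis using lr sub
          by (intro bexI[of _ "(x, l, r)"]) (auto simp: K_def L_def R_def)
      qed
    qed (use \<epsilon> in auto)
    have CK: "L i < R i \<and> c \<le> L i \<and> R i \<le> d" "L i = fst i \<or> R i = fst i" "{L i..R i} \<subseteq> \<gamma> (fst i)"
      "bad (1 / Suc n) (fst i) (L i) (R i)" if "i \<in> C" for i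
    proof -
      have "i \<in> K" using that C(2) by blast
      then show "L i < R i \<and> c \<le> L i \<and> R i \<le> d" "L i = fst i \<or> R i = fst i" "{L i..R i} \<subseteq> \<gamma> (fst i)"
        "bad (1 / Suc n) (fst i) (L i) (R i)"
        by (auto simp: K_def L_def R_def)
    qed
    have C': "\<forall>i\<in>C. L i < R i \<and> c \<le> L i \<and> R i \<le> d"
        "\<forall>i\<in>C. \<forall>j\<in>C. i \<noteq> j \<longrightarrow> {L i..R i} \<inter> {L j..R j} = {}"
      using CK(1) C(3) by blast+
    note I = disjoint_intervals_image[OF C(1) C']
    define X where "X = (\<Sum>i\<in>C. R i - L i)"
    have UC: "(\<Union>i\<in>C. {L i..R i}) \<in> lmeasurable"
      using C(1) by (auto intro!: fmeasurable.finite_UN)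
    define p where "p = (\<lambda>i. (fst i, {L i..R i})) ` C"
    have inj: "inj_on (\<lambda>i. (fst i, {L i..R i})) C"
    proof (rule inj_onI, rule ccontr)
      fix i j assume ij: "i \<in> C" "j \<in> C" "(fst i, {L i..R i}) = (fst j, {L j..R j})" "i \<noteq> j"
      then have "{L i..R i} = {L j..R j}" by simp
      then have "{L i..R i} = {}" using C(3)[OF ij(1,2,4)] by blast
      then show False using CK(1)[OF ij(1)] by simp
    qed
    have "p tagged_partial_division_of cbox c d"
      unfolding tagged_partial_division_of_def
    proof (intro conjI allI impI)
      show "finite p" using C(1) by (simp add: p_def)
    next
      fix x k assume "(x, k) \<in> p"
      then obtain i where i: "i \<in> C" "x = fst i" "k = {L i..R i}" by (auto simp: p_def)
      show "x \<in> k" "k \<subseteq> cbox c d" "\<exists>a b. k = cbox a b"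
        using CK(1,2)[OF i(1)] i by auto
    next
      fix x k y m assume "(x, k) \<in> p \<and> (y, m) \<in> p \<and> (x, k) \<noteq> (y, m)"
      then have xk: "(x, k) \<in> p" "(y, m) \<in> p" and ne: "(x, k) \<noteq> (y, m)" by blast+
      from xk(1) obtain i where i: "i \<in> C" "x = fst i" "k = {L i..R i}" unfolding p_def by blast
      from xk(2) obtain j where j: "j \<in> C" "y = fst j" "m = {L j..R j}" unfolding p_def by blast
      have "i \<noteq> j" using i j ne by metis
      then have "k \<inter> m = {}" using C(3)[OF i(1) j(1)] i j by simp
      then show "interior k \<inter> interior m = {}" using interior_subset[of k] interior_subset[of m] by blast
    qed
    moreover have "\<gamma> fine p" using CK(3) by (auto simp: fine_def p_def)
    ultimately have "sum (\<lambda>(x,k). norm (measure lborel k *\<^sub>R g x - integral k g)) p < \<epsilon> / (2 * Suc n)"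
      by (rule \<gamma>(2))
    also have "sum (\<lambda>(x,k). norm (measure lborel k *\<^sub>R g x - integral k g)) p
       = (\<Sum>i\<in>C. norm (F (R i) - F (L i) - (R i - L i) *\<^sub>R g (fst i)))"
      unfolding p_def sum.reindex[OF inj]
    proof (rule sum.cong)
      fix i assume i: "i \<in> C"
      have *: "measure lborel {L i..R i} = R i - L i" "F (R i) - F (L i) = integral {L i..R i} g"
        using CK(1)[OF i] by (auto intro: Fdiff)
      show "((\<lambda>(x, k). norm (measure lborel k *\<^sub>R g x - integral k g)) \<circ> (\<lambda>i. (fst i, {L i..R i}))) i
         = norm (F (R i) - F (L i) - (R i - L i) *\<^sub>R g (fst i))"
        unfolding o_def case_prod_conv * by (rule norm_minus_commute)
    qed simp
    finally have "(\<Sum>i\<in>C. norm (F (R i) - F (L i) - (R i - L i) *\<^sub>R g (fst i))) < \<epsilon> / (2 * Suc n)" .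
    moreover have "1 / Suc n * X \<le> (\<Sum>i\<in>C. norm (F (R i) - F (L i) - (R i - L i) *\<^sub>R g (fst i)))"
      unfolding X_def sum_distrib_left using CK(4)
      by (intro sum_mono) (auto simp: bad_def intro: less_imp_le)
    ultimately have "1 / Suc n * X < \<epsilon> / (2 * Suc n)" by linarith
    also have "\<epsilon> / (2 * Suc n) = 1 / Suc n * (\<epsilon> / 2)" by simp
    finally have X: "X < \<epsilon> / 2" by (rule mult_left_less_imp_less) simp
    show "\<exists>T. E n \<subseteq> T \<and> T \<in> lmeasurable \<and> measure lebesgue T < \<epsilon>"
    proof (intro exI conjI)
      show "E n \<subseteq> T \<union> (\<Union>i\<in>C. {L i..R i})" by (rule C)
      show "T \<union> (\<Union>i\<in>C. {L i..R i}) \<in> lmeasurable" using C(4) UC by auto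
      have "measure lebesgue (T \<union> (\<Union>i\<in>C. {L i..R i})) \<le> measure lebesgue T + X"
        unfolding X_def I(4)[symmetric] using C(4) UC
        by (intro measure_Un_le) (auto simp: fmeasurableD)
      then show "measure lebesgue (T \<union> (\<Union>i\<in>C. {L i..R i})) < \<epsilon>"
        using C(5) X by simp
    qed
  qed
  show "negligible (\<Union>n. E n)" using neg by (intro negligible_countable_Union) auto
  fix x assume x: "x \<in> {c<..<d} - (\<Union>n. E n)"
  have "(F has_vector_derivative g x) (at x)"
  proof (rule has_vector_derivative_intervalI)
    fix \<epsilon> :: real assume \<epsilon>: "\<epsilon> > 0"
    obtain n :: nat where n: "1 / Suc n < \<epsilon>" using \<epsilon> nat_approx_posE by blast
    have "x \<notin> E n" "x \<in> {c<..<d}" using x by auto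
    then obtain \<delta> where \<delta>: "\<delta> > 0" "\<And>l r. (l = x \<or> r = x) \<Longrightarrow> l < r \<Longrightarrow> r - l < \<delta> \<Longrightarrow> \<not> bad (1 / Suc n) x l r"
      unfolding E_def by blast
    show "\<exists>\<delta>>0. \<forall>l r. (l = x \<or> r = x) \<longrightarrow> l < r \<longrightarrow> r - l < \<delta> \<longrightarrow>
     norm (F r - F l - (r - l) *\<^sub>R g x) \<le> \<epsilon> * (r - l)"
    proof (intro exI conjI allI impI)
      fix l r assume lr: "l = x \<or> r = x" "l < r" "r - l < \<delta>"
      have "norm (F r - F l - (r - l) *\<^sub>R g x) \<le> 1 / Suc n * (r - l)"
        using \<delta>(2)[OF lr] by (simp add: bad_def not_less)
      also have "\<dots> \<le> \<epsilon> * (r - l)" using n lr by (intro mult_right_mono) auto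
      finally show "norm (F r - F l - (r - l) *\<^sub>R g x) \<le> \<epsilon> * (r - l)" .
    qed (rule \<delta>)
  qed
  then show "((\<lambda>x. integral {c..x} g) has_vector_derivative g x) (at x)" by (simp add: F_def)
qed

lemma sum_integral_disjoint_le:
  fixes \<phi> :: "real \<Rightarrow> real"
  assumes \<phi>: "\<phi> integrable_on {c..d}" "\<And>x. \<phi> x \<ge> 0"
    and st: "\<And>i. i < (n::nat) \<Longrightarrow> c \<le> s i \<and> t i \<le> d"
    and dis: "disjoint_family_on (\<lambda>i. {s i<..<t i}) {..<n}"
  shows "(\<Sum>i<n. integral {s i..t i} \<phi>) \<le> integral {c..d} \<phi>"
proof -
  have int: "(\<lambda>x. if x \<in> {s i<..<t i} then \<phi> x else 0) integrable_on {c..d}"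
    "integral {c..d} (\<lambda>x. if x \<in> {s i<..<t i} then \<phi> x else 0) = integral {s i..t i} \<phi>" if i: "i < n" for i
  proof -
    have sub: "{s i<..<t i} \<inter> {c..d} = {s i<..<t i}" using st[OF i] by auto
    have "\<phi> integrable_on {s i..t i}" using \<phi>(1) st[OF i] by (intro integrable_on_subinterval[OF \<phi>(1)]) auto
    then have "\<phi> integrable_on {s i<..<t i}" by (simp add: integrable_on_Icc_iff_Ioo)
    then show "(\<lambda>x. if x \<in> {s i<..<t i} then \<phi> x else 0) integrable_on {c..d}"
      unfolding Henstock_Kurzweil_Integration.integrable_restrict_Int sub .
    show "integral {c..d} (\<lambda>x. if x \<in> {s i<..<t i} then \<phi> x else 0) = integral {s i..t i} \<phi>"
      unfolding Henstock_Kurzweil_Integration.integral_restrict_Int sub integral_open_interval_real ..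
  qed
  have "(\<Sum>i<n. integral {s i..t i} \<phi>) = (\<Sum>i<n. integral {c..d} (\<lambda>x. if x \<in> {s i<..<t i} then \<phi> x else 0))"
    using int by simp
  also have "\<dots> = integral {c..d} (\<lambda>x. \<Sum>i<n. if x \<in> {s i<..<t i} then \<phi> x else 0)"
    using int by (intro integral_sum[symmetric]) auto
  also have "\<dots> \<le> integral {c..d} \<phi>"
  proof (rule integral_le)
    show "(\<lambda>x. \<Sum>i<n. if x \<in> {s i<..<t i} then \<phi> x else 0) integrable_on {c..d}"
      using int by (intro integrable_sum) auto
    fix x
    show "(\<Sum>i<n. if x \<in> {s i<..<t i} then \<phi> x else 0) \<le> \<phi> x"
    proof (cases "\<exists>j<n. x \<in> {s j<..<t j}")
      case True
      then obtain j where j: "j < n" "x \<in> {s j<..<t j}" by blast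
      have "(\<Sum>i<n. if x \<in> {s i<..<t i} then \<phi> x else 0) = (\<Sum>i<n. if i = j then \<phi> x else 0)"
      proof (rule sum.cong)
        fix i assume "i \<in> {..<n}"
        then have "i \<noteq> j \<Longrightarrow> x \<notin> {s i<..<t i}"
          using dis j unfolding disjoint_family_on_def by blast
        then show "(if x \<in> {s i<..<t i} then \<phi> x else 0) = (if i = j then \<phi> x else 0)" using j by auto
      qed simp
      then show ?thesis using j(1) by simp
    next
      case False
      then have "(\<Sum>i<n. if x \<in> {s i<..<t i} then \<phi> x else 0) = 0" by (intro sum.neutral) auto
      then show ?thesis using \<phi>(2) by simp
    qed
  qed (rule \<phi>(1))
  finally show ?thesis .
qed

text \<open>
  The part of the integral where \<open>norm g\<close> exceeds a large constant \<open>k\<close> is small; on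
  the rest the increments are at most \<open>k\<close> times the lengths.
\<close>

lemma AC_on_indefinite_integral:
  fixes g :: cfun
  assumes g: "g absolutely_integrable_on {c..d}"
    and F: "\<And>x y. c \<le> x \<Longrightarrow> x \<le> y \<Longrightarrow> y \<le> d \<Longrightarrow> F y - F x = integral {x..y} g"
  shows "AC_on c d F"
  unfolding AC_on_def
proof (intro allI impI)
  fix \<epsilon> :: real assume \<epsilon>: "\<epsilon> > 0"
  define h where "h = (\<lambda>x. norm (g x))"
  have h: "h absolutely_integrable_on {c..d}" unfolding h_def using g by (rule set_integrable_norm)
  have hk: "(\<lambda>x. min (h x) (real k)) absolutely_integrable_on {c..d}" for k
    using absolutely_integrable_min_1[OF h, of "\<lambda>x. real k"] by simp
  have "(\<lambda>k. integral {c..d} (\<lambda>x. min (h x) (real k))) \<longlonglongrightarrow> integral {c..d} h"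
  proof (rule dominated_convergence(2)[where h = h])
    show "(\<lambda>x. min (h x) (real k)) integrable_on {c..d}" for k
      using hk set_lebesgue_integral_eq_integral(1) by blast
    show "h integrable_on {c..d}" using h set_lebesgue_integral_eq_integral(1) by blast
    show "norm (min (h x) (real k)) \<le> h x" if "x \<in> {c..d}" for k x by (simp add: h_def)
    show "(\<lambda>k. min (h x) (real k)) \<longlonglongrightarrow> h x" if "x \<in> {c..d}" for x
    proof (rule tendsto_eventually)
      obtain k0 :: nat where "h x \<le> k0" using real_arch_simple by blast
      then show "\<forall>\<^sub>F k in sequentially. min (h x) (real k) = h x"
        by (intro eventually_sequentiallyI[of k0]) (auto simp: min_def)
    qed
  qed
  then have "\<forall>\<^sub>F k in sequentially. dist (integral {c..d} (\<lambda>x. min (h x) (real k))) (integral {c..d} h) < \<epsilon> / 2"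
    using half_gt_zero[OF \<epsilon>] by (rule tendstoD)
  then obtain k where k: "\<bar>integral {c..d} (\<lambda>x. min (h x) (real k)) - integral {c..d} h\<bar> < \<epsilon> / 2"
    unfolding eventually_sequentially dist_real_def by blast
  define \<phi> where "\<phi> = (\<lambda>x. h x - min (h x) (real k))"
  have io: "h integrable_on {c..d}" "(\<lambda>x. min (h x) (real k)) integrable_on {c..d}"
    using h hk set_lebesgue_integral_eq_integral(1) by blast+
  have \<phi>: "\<phi> integrable_on {c..d}" "integral {c..d} \<phi> < \<epsilon> / 2" "\<And>x. \<phi> x \<ge> 0"
    using io abs_less_iff[THEN iffD1, OF k]
    by (auto simp: \<phi>_def integrable_diff Henstock_Kurzweil_Integration.integral_diff)
  show "\<exists>\<delta>>0. \<forall>(n::nat) s t.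
        (\<forall>i<n. c \<le> s i \<and> s i \<le> t i \<and> t i \<le> d) \<and>
        disjoint_family_on (\<lambda>i. {s i<..<t i}) {..<n} \<and>
        (\<Sum>i<n. t i - s i) < \<delta> \<longrightarrow> (\<Sum>i<n. cmod (F (t i) - F (s i))) < \<epsilon>"
  proof (intro exI conjI allI impI)
    show "\<epsilon> / (2 * Suc k) > 0" using \<epsilon> by simp
    fix n :: nat and s t :: "nat \<Rightarrow> real"
    assume a: "(\<forall>i<n. c \<le> s i \<and> s i \<le> t i \<and> t i \<le> d) \<and>
        disjoint_family_on (\<lambda>i. {s i<..<t i}) {..<n} \<and> (\<Sum>i<n. t i - s i) < \<epsilon> / (2 * Suc k)"
    have "(\<Sum>i<n. cmod (F (t i) - F (s i))) \<le> (\<Sum>i<n. integral {s i..t i} \<phi> + real k * (t i - s i))"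
    proof (rule sum_mono)
      fix i assume "i \<in> {..<n}"
      then have i: "c \<le> s i" "s i \<le> t i" "t i \<le> d" using a by auto
      have sub: "{s i..t i} \<subseteq> {c..d}" using i by auto
      have gi: "g absolutely_integrable_on {s i..t i}" using g by (rule absolutely_integrable_on_subinterval) (rule sub)
      have \<phi>i: "\<phi> integrable_on {s i..t i}" using \<phi>(1) sub by (rule integrable_on_subinterval)
      have "cmod (F (t i) - F (s i)) = norm (integral {s i..t i} g)" using F[OF i] by simp
      also have "\<dots> \<le> integral {s i..t i} (\<lambda>x. \<phi> x + real k)"
      proof (rule integral_norm_bound_integral)
        show "g integrable_on {s i..t i}" using gi set_lebesgue_integral_eq_integral(1) by blast
        show "(\<lambda>x. \<phi> x + real k) integrable_on {s i..t i}" using \<phi>i by (intro integrable_add) auto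
        show "norm (g x) \<le> \<phi> x + real k" for x by (simp add: \<phi>_def h_def)
      qed
      also have "\<dots> = integral {s i..t i} \<phi> + real k * (t i - s i)"
        using \<phi>i i by (subst integral_add) auto
      finally show "cmod (F (t i) - F (s i)) \<le> integral {s i..t i} \<phi> + real k * (t i - s i)" .
    qed
    also have "\<dots> = (\<Sum>i<n. integral {s i..t i} \<phi>) + real k * (\<Sum>i<n. t i - s i)"
      by (simp add: sum.distrib sum_distrib_left)
    also have "(\<Sum>i<n. integral {s i..t i} \<phi>) \<le> integral {c..d} \<phi>"
      using a \<phi> by (intro sum_integral_disjoint_le) auto
    also have "real k * (\<Sum>i<n. t i - s i) \<le> real k * (\<epsilon> / (2 * Suc k))"
      using a by (intro mult_left_mono) auto
    also have "real k * (\<epsilon> / (2 * Suc k)) \<le> \<epsilon> / 2" using \<epsilon> by (simp add: field_simps)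
    finally show "(\<Sum>i<n. cmod (F (t i) - F (s i))) < \<epsilon>" using \<phi>(2) by simp
  qed
qed

lemma AC_on_continuous_on:
  assumes "AC_on c d f"
  shows "continuous_on {c..d} f"
  unfolding continuous_on_iff
proof (intro ballI allI impI)
  fix x \<epsilon> assume x: "x \<in> {c..d}" and \<epsilon>: "0 < (\<epsilon>::real)"
  obtain \<delta> where \<delta>: "\<delta> > 0" and ac: "\<And>(n::nat) s t.
        (\<forall>i<n. c \<le> s i \<and> s i \<le> t i \<and> t i \<le> d) \<Longrightarrow>
        disjoint_family_on (\<lambda>i. {s i<..<t i}) {..<n} \<Longrightarrow>
        (\<Sum>i<n. t i - s i) < \<delta> \<Longrightarrow> (\<Sum>i<n. cmod (f (t i) - f (s i))) < \<epsilon>"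
    using assms \<epsilon> unfolding AC_on_def by meson
  show "\<exists>\<delta>>0. \<forall>y\<in>{c..d}. dist y x < \<delta> \<longrightarrow> dist (f y) (f x) < \<epsilon>"
  proof (intro exI conjI ballI impI)
    fix y assume y: "y \<in> {c..d}" "dist y x < \<delta>"
    have "(\<Sum>i<(1::nat). cmod (f (max x y) - f (min x y))) < \<epsilon>"
      by (rule ac) (use x y in \<open>auto simp: disjoint_family_on_def dist_real_def max_def min_def\<close>)
    then show "dist (f y) (f x) < \<epsilon>"
      by (auto simp: dist_norm max_def min_def norm_minus_commute split: if_splits)
  qed (rule \<delta>)
qed

lemma AC_on_diff:
  assumes "AC_on c d f" "AC_on c d g"
  shows "AC_on c d (\<lambda>x. f x - g x)"
proof (rule AC_on_lincomb[OF assms zero_less_one])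
  fix x y
  have "cmod ((f y - f x) - (g y - g x)) \<le> cmod (f y - f x) + cmod (g y - g x)"
    by (rule norm_triangle_ineq4)
  then show "cmod (f y - g y - (f x - g x)) \<le> 1 * cmod (f y - f x) + 1 * cmod (g y - g x)"
    by (simp add: algebra_simps)
qed

lemma AC_on_mult:
  assumes f: "AC_on c d f" and g: "AC_on c d g"
  shows "AC_on c d (\<lambda>x. f x * g x)"
proof -
  have "bounded (f ` {c..d})" "bounded (g ` {c..d})"
    using AC_on_continuous_on[OF f] AC_on_continuous_on[OF g]
    by (auto intro!: compact_imp_bounded compact_continuous_image)
  then obtain A B where A: "\<And>x. x \<in> {c..d} \<Longrightarrow> cmod (f x) \<le> A" and B: "\<And>x. x \<in> {c..d} \<Longrightarrow> cmod (g x) \<le> B"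
    unfolding bounded_iff by blast
  define M where "M = max 1 (max A B)"
  show ?thesis
  proof (rule AC_on_lincomb[OF f g])
    show "M > 0" by (simp add: M_def)
    fix x y assume xy: "c \<le> x" "x \<le> y" "y \<le> d"
    have "f y * g y - f x * g x = (f y - f x) * g y + f x * (g y - g x)" by (simp add: algebra_simps)
    then have "cmod (f y * g y - f x * g x) \<le> cmod (f y - f x) * cmod (g y) + cmod (f x) * cmod (g y - g x)"
      by (metis norm_mult norm_triangle_ineq)
    also have "\<dots> \<le> cmod (f y - f x) * M + M * cmod (g y - g x)"
      using A[of x] B[of y] xy by (intro add_mono mult_mono) (auto simp: M_def)
    finally show "cmod (f y * g y - f x * g x) \<le> M * cmod (f y - f x) + M * cmod (g y - g x)"
      by (simp add: mult.commute)
  qed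
qed

section \<open>Indefinite integrals on an open interval\<close>

lemma AE_lebesgue_on_iff:
  assumes "S \<in> sets lebesgue"
  shows "(AE x in lebesgue_on S. P x) \<longleftrightarrow> (\<exists>N. negligible N \<and> (\<forall>x\<in>S - N. P x))"
proof -
  have "(AE x in lebesgue_on S. P x) \<longleftrightarrow> (AE x in lebesgue. x \<in> S \<longrightarrow> P x)"
    using assms by (simp add: AE_restrict_space_iff)
  also have "\<dots> \<longleftrightarrow> (\<exists>N. negligible N \<and> {x. \<not> (x \<in> S \<longrightarrow> P x)} \<subseteq> N)"
    by (simp add: eventually_ae_filter_negligible)
  also have "\<dots> \<longleftrightarrow> (\<exists>N. negligible N \<and> (\<forall>x\<in>S - N. P x))" by blast
  finally show ?thesis .
qed

lemma einterval_lebesgue [simp]: "einterval a b \<in> sets lebesgue"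
  by (simp add: borel_open)

lemmas AE_einterval_iff = AE_lebesgue_on_iff[OF einterval_lebesgue]

lemma Icc_subset_einterval: "a < ereal x \<Longrightarrow> ereal y < b \<Longrightarrow> {x..y} \<subseteq> einterval a b"
  by (auto simp: einterval_iff) (meson ereal_less_eq(3) less_le_trans, meson ereal_less_eq(3) le_less_trans)

text \<open>
  Local integrability on the open interval \<open>(a, b)\<close>.
\<close>

definition loc_int :: "ereal \<Rightarrow> ereal \<Rightarrow> (real \<Rightarrow> 'a::euclidean_space) \<Rightarrow> bool" where
  "loc_int a b g \<longleftrightarrow> (\<forall>x y. x \<in> einterval a b \<longrightarrow> y \<in> einterval a b \<longrightarrow> x \<le> y \<longrightarrow>
     g absolutely_integrable_on {x..y})"

text \<open>
  \<open>F\<close> is an indefinite integral of the locally integrable function \<open>g\<close> on \<open>(a,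
  b)\<close>. By \<open>ind_int_AC\<close>, \<open>ind_int_deriv\<close> and \<open>ind_int_of_AC\<close> this
  means that \<open>F\<close> is locally absolutely continuous with \<open>F' = g\<close> almost everywhere.
\<close>

definition ind_int :: "ereal \<Rightarrow> ereal \<Rightarrow> cfun \<Rightarrow> cfun \<Rightarrow> bool" where
  "ind_int a b F g \<longleftrightarrow> loc_int a b g \<and>
     (\<forall>x y. x \<in> einterval a b \<longrightarrow> y \<in> einterval a b \<longrightarrow> x \<le> y \<longrightarrow> F y - F x = integral {x..y} g)"

lemma loc_intD:
  "loc_int a b g \<Longrightarrow> x \<in> einterval a b \<Longrightarrow> y \<in> einterval a b \<Longrightarrow> x \<le> y \<Longrightarrow> g absolutely_integrable_on {x..y}"
  "loc_int a b g \<Longrightarrow> x \<in> einterval a b \<Longrightarrow> y \<in> einterval a b \<Longrightarrow> g integrable_on {x..y}"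
  unfolding loc_int_def
  by blast (metis absolutely_integrable_on_def atLeastatMost_empty integrable_on_empty linorder_not_le)

lemma ind_intD:
  "ind_int a b F g \<Longrightarrow> loc_int a b g"
  "ind_int a b F g \<Longrightarrow> x \<in> einterval a b \<Longrightarrow> y \<in> einterval a b \<Longrightarrow> x \<le> y \<Longrightarrow> F y - F x = integral {x..y} g"
  by (auto simp: ind_int_def)

lemma L1_loc_imp_loc_int: "g \<in> L1_loc a b \<Longrightarrow> loc_int a b g"
  unfolding L1_loc_def loc_int_def
  by (auto simp: einterval_iff Icc_subset_einterval)

lemma mem_einterval_between:
  "x \<in> einterval a b \<Longrightarrow> y \<in> einterval a b \<Longrightarrow> x \<le> t \<Longrightarrow> t \<le> y \<Longrightarrow> t \<in> einterval a b"
  using Icc_subset_einterval[of a x y b] by (auto simp: einterval_iff)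

lemma einterval_neighbourhood:
  assumes "x \<in> einterval a b"
  obtains s t where "s \<in> \<rat>" "t \<in> \<rat>" "s \<in> einterval a b" "t \<in> einterval a b" "s < x" "x < t"
proof -
  obtain \<epsilon> where \<epsilon>: "\<epsilon> > 0" "ball x \<epsilon> \<subseteq> einterval a b"
    using assms open_einterval openE by blast
  obtain s where "s \<in> \<rat>" "x - \<epsilon> < s" "s < x" using Rats_dense_in_real[of "x - \<epsilon>" x] \<epsilon> by auto
  moreover obtain t where "t \<in> \<rat>" "x < t" "t < x + \<epsilon>" using Rats_dense_in_real[of x "x + \<epsilon>"] \<epsilon> by auto
  moreover have "s \<in> ball x \<epsilon>" "t \<in> ball x \<epsilon>" using calculation by (auto simp: dist_real_def)
  ultimately show thesis using \<epsilon>(2) that by blast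
qed

lemma AC_locD: "f \<in> AC_loc a b \<Longrightarrow> x \<in> einterval a b \<Longrightarrow> y \<in> einterval a b \<Longrightarrow> x \<le> y \<Longrightarrow> AC_on x y f"
  by (simp add: AC_loc_def einterval_iff)

lemma AC_locI: "(\<And>x y. x \<in> einterval a b \<Longrightarrow> y \<in> einterval a b \<Longrightarrow> x \<le> y \<Longrightarrow> AC_on x y f) \<Longrightarrow> f \<in> AC_loc a b"
  unfolding AC_loc_def einterval_iff mem_Collect_eq
  by (metis ereal_less_eq(3) le_less_trans less_le_trans)

lemma AC_loc_continuous_on:
  assumes "f \<in> AC_loc a b"
  shows "continuous_on (einterval a b) f"
  unfolding continuous_on_eq_continuous_at[OF open_einterval]
proof
  fix x assume "x \<in> einterval a b"
  then obtain s t where st: "s \<in> einterval a b" "t \<in> einterval a b" "s < x" "x < t"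
    by (rule einterval_neighbourhood)
  then have "continuous_on {s..t} f" using AC_locD[OF assms] by (intro AC_on_continuous_on) auto
  then have "continuous_on {s<..<t} f" by (rule continuous_on_subset) auto
  then show "isCont f x" using st by (simp add: continuous_on_eq_continuous_at)
qed

lemma continuous_on_einterval_Icc:
  "continuous_on (einterval a b) f \<Longrightarrow> x \<in> einterval a b \<Longrightarrow> y \<in> einterval a b \<Longrightarrow> continuous_on {x..y} f"
  by (erule continuous_on_subset) (auto simp: einterval_iff dest: Icc_subset_einterval[THEN subsetD])

lemma continuous_eq_ae_imp_eq:
  fixes f g :: "real \<Rightarrow> 'a::t2_space"
  assumes f: "continuous_on (einterval a b) f" and g: "continuous_on (einterval a b) g"
    and N: "negligible N" "\<And>x. x \<in> einterval a b - N \<Longrightarrow> f x = g x" and x: "x \<in> einterval a b"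
  shows "f x = g x"
proof (rule ccontr)
  assume ne: "f x \<noteq> g x"
  obtain U V where UV: "open U" "open V" "f x \<in> U" "g x \<in> V" "U \<inter> V = {}"
    using hausdorff[OF ne] by blast
  define W where "W = (einterval a b \<inter> f -` U) \<inter> (einterval a b \<inter> g -` V)"
  have "open W" unfolding W_def
    by (intro open_Int continuous_open_preimage f g UV) auto
  moreover have "W \<subseteq> N" using N(2) UV(5) unfolding W_def by fastforce
  moreover have "x \<in> W" using UV x by (simp add: W_def)
  ultimately show False using N(1) negligible_subset open_not_negligible by blast
qed

lemma loc_int_of_real: "loc_int a b g \<Longrightarrow> loc_int a b (\<lambda>x. complex_of_real (g x))"
  unfolding loc_int_def by (auto intro: absolutely_integrable_linear[OF _ bounded_linear_of_real, unfolded o_def])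

lemma loc_int_norm: "loc_int a b g \<Longrightarrow> loc_int a b (\<lambda>x. norm (g x))"
  unfolding loc_int_def by (auto intro: set_integrable_norm)

lemma loc_int_add: "loc_int a b f \<Longrightarrow> loc_int a b g \<Longrightarrow> loc_int a b (\<lambda>x. f x + g x)"
  unfolding loc_int_def by (auto intro: set_integral_add(1))

lemma loc_int_diff: "loc_int a b f \<Longrightarrow> loc_int a b g \<Longrightarrow> loc_int a b (\<lambda>x. f x - g x)"
  unfolding loc_int_def by (auto intro: set_integral_diff(1))

lemma loc_int_cmult: "loc_int a b f \<Longrightarrow> loc_int a b (\<lambda>x. (z::complex) * f x)"
  unfolding loc_int_def by (auto intro: set_integrable_mult_right)

lemma loc_int_cong_AE:
  assumes "loc_int a b f" "negligible N" "\<And>x. x \<in> einterval a b - N \<Longrightarrow> g x = f x"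
  shows "loc_int a b g"
  unfolding loc_int_def
proof (intro allI impI)
  fix x y assume xy: "x \<in> einterval a b" "y \<in> einterval a b" "x \<le> y"
  show "g absolutely_integrable_on {x..y}"
  proof (rule absolutely_integrable_spike[OF loc_intD(1)[OF assms(1) xy] assms(2)])
    fix t assume "t \<in> {x..y} - N"
    then show "g t = f t" using assms(3)[of t] mem_einterval_between[OF xy(1,2), of t] by auto
  qed
qed

lemma loc_int_mult_continuous:
  fixes f g :: "real \<Rightarrow> 'a::{euclidean_space, real_normed_algebra}"
  assumes f: "loc_int a b f" and g: "continuous_on (einterval a b) g"
  shows "loc_int a b (\<lambda>x. f x * g x)"
  unfolding loc_int_def
proof (intro allI impI)
  fix x y assume xy: "x \<in> einterval a b" "y \<in> einterval a b" "x \<le> y"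
  have c: "continuous_on {x..y} g" using continuous_on_einterval_Icc[OF g xy(1,2)] .
  have b: "bilinear (\<lambda>x y::'a. y * x)"
    unfolding bilinear_def by (auto intro!: linearI simp: algebra_simps)
  have "g \<in> borel_measurable (lebesgue_on {x..y})"
    using c by (rule continuous_imp_measurable_on_sets_lebesgue) simp
  moreover have "bounded (g ` {x..y})"
    using c by (intro compact_imp_bounded compact_continuous_image) auto
  ultimately show "(\<lambda>x. f x * g x) absolutely_integrable_on {x..y}"
    using absolutely_integrable_bounded_measurable_product[OF b, of g "{x..y}" f] loc_intD(1)[OF f xy]
    by simp
qed

lemma ind_int_AC:
  assumes "ind_int a b F g"
  shows "F \<in> AC_loc a b"
proof (rule AC_locI)
  fix x y assume xy: "x \<in> einterval a b" "y \<in> einterval a b" "x \<le> y"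
  show "AC_on x y F"
  proof (rule AC_on_indefinite_integral)
    show "g absolutely_integrable_on {x..y}" using loc_intD(1)[OF ind_intD(1)[OF assms] xy] .
    fix s t assume "x \<le> s" "s \<le> t" "t \<le> y"
    then show "F t - F s = integral {s..t} g"
      using ind_intD(2)[OF assms mem_einterval_between[OF xy(1,2)] mem_einterval_between[OF xy(1,2)]] by auto
  qed
qed

lemma ind_int_continuous: "ind_int a b F g \<Longrightarrow> continuous_on (einterval a b) F"
  using ind_int_AC AC_loc_continuous_on by blast

lemma ind_int_deriv:
  assumes I: "ind_int a b F g"
  obtains N where "negligible N" "\<And>x. x \<in> einterval a b - N \<Longrightarrow> (F has_vector_derivative g x) (at x)"
proof -
  define Q where "Q = {z \<in> \<rat> \<times> \<rat>. fst z \<in> einterval a b \<and> snd z \<in> einterval a b \<and> fst z \<le> snd z}"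
  have "\<exists>N. negligible N \<and> (\<forall>x\<in>{s<..<t} - N. (F has_vector_derivative g x) (at x))"
    if st: "s \<in> einterval a b" "t \<in> einterval a b" "s \<le> t" for s t
  proof -
    have "g integrable_on {s..t}" using loc_intD(2)[OF ind_intD(1)[OF I] st(1,2)] .
    then obtain N where N: "negligible N"
      "\<And>x. x \<in> {s<..<t} - N \<Longrightarrow> ((\<lambda>x. integral {s..x} g) has_vector_derivative g x) (at x)"
      using lebesgue_differentiation by blast
    have "(F has_vector_derivative g x) (at x)" if x: "x \<in> {s<..<t} - N" for x
    proof (rule has_vector_derivative_transform_within_open)
      show "((\<lambda>x. F s + integral {s..x} g) has_vector_derivative g x) (at x)"
        using has_vector_derivative_add[OF has_vector_derivative_const[of "F s"] N(2)[OF x]] by simp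
      show "open {s<..<t}" "x \<in> {s<..<t}" using x by auto
      fix y assume "y \<in> {s<..<t}"
      then have y: "s \<le> y" "y \<le> t" by auto
      show "F s + integral {s..y} g = F y"
        using ind_intD(2)[OF I st(1) mem_einterval_between[OF st(1,2) y] y(1)] by (simp add: algebra_simps)
    qed
    then show ?thesis using N(1) by blast
  qed
  then have "\<forall>z\<in>Q. \<exists>N. negligible N \<and> (\<forall>x\<in>{fst z<..<snd z} - N. (F has_vector_derivative g x) (at x))"
    by (auto simp: Q_def)
  then obtain N where N: "\<And>z. z \<in> Q \<Longrightarrow> negligible (N z)"
    "\<And>z x. z \<in> Q \<Longrightarrow> x \<in> {fst z<..<snd z} - N z \<Longrightarrow> (F has_vector_derivative g x) (at x)"
    by metis
  show thesis
  proof (rule that[of "\<Union>z\<in>Q. N z"])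
    have "countable ((\<rat>::real set) \<times> (\<rat>::real set))" by (intro countable_SIGMA countable_rat)
    then have "countable Q" by (rule countable_subset[rotated]) (auto simp: Q_def)
    then show "negligible (\<Union>z\<in>Q. N z)" using N(1) by (intro negligible_countable_Union) auto
    fix x assume x: "x \<in> einterval a b - (\<Union>z\<in>Q. N z)"
    then obtain s t where st: "s \<in> \<rat>" "t \<in> \<rat>" "s \<in> einterval a b" "t \<in> einterval a b" "s < x" "x < t"
      using einterval_neighbourhood by blast
    then have "(s, t) \<in> Q" by (auto simp: Q_def)
    then show "(F has_vector_derivative g x) (at x)" using N(2)[of "(s, t)" x] x st by auto
  qed
qed

text \<open>
  The hypothesis on \<open>vector_derivative F\<close> carries information only where \<open>F\<close> is
  differentiable; that this is so almost everywhere is where \<open>AC_differentiable_ae\<close> enters.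
\<close>

lemma ind_int_of_AC:
  assumes F: "F \<in> AC_loc a b" and g: "loc_int a b g" and N: "negligible N"
    and d: "\<And>x. x \<in> einterval a b - N \<Longrightarrow> vector_derivative F (at x) = g x"
  shows "ind_int a b F g"
  unfolding ind_int_def
proof (intro conjI allI impI)
  fix x y assume xy: "x \<in> einterval a b" "y \<in> einterval a b" "x \<le> y"
  show "F y - F x = integral {x..y} g"
  proof (cases "x = y")
    case False
    then have "x < y" using xy(3) by simp
    define G where "G = (\<lambda>t. integral {x..t} g)"
    have gi: "g absolutely_integrable_on {x..y}" using loc_intD(1)[OF g xy] .
    then have gi': "g integrable_on {x..y}" using set_lebesgue_integral_eq_integral(1) by blast
    have Gdiff: "G t - G s = integral {s..t} g" if "x \<le> s" "s \<le> t" "t \<le> y" for s t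
    proof -
      have "g integrable_on {x..t}" using gi' by (rule integrable_on_subinterval) (use that in auto)
      then show ?thesis using Henstock_Kurzweil_Integration.integral_combine[of x s t g] that
        unfolding G_def by (metis add_diff_cancel_left')
    qed
    have "AC_on x y G" using gi Gdiff by (rule AC_on_indefinite_integral)
    then have ac: "AC_on x y (\<lambda>t. F t - G t)" using AC_locD[OF F xy] by (intro AC_on_diff)
    obtain N1 where N1: "negligible N1" "\<And>t. t \<in> {x<..<y} - N1 \<Longrightarrow> (G has_vector_derivative g t) (at t)"
      using lebesgue_differentiation[OF gi'] unfolding G_def by blast
    obtain N2 where N2: "negligible N2" "\<And>t. t \<in> {x<..<y} - N2 \<Longrightarrow> \<exists>D. (F has_vector_derivative D) (at t)"
      using AC_differentiable_ae[OF AC_locD[OF F xy]] by blast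
    have "F y - G y = F x - G x"
    proof (rule AC_zero_derivative_imp_const[OF ac \<open>x < y\<close>])
      show "negligible (N \<union> (N1 \<union> N2))" using N N1 N2 by simp
      fix t assume t: "t \<in> {x<..<y} - (N \<union> (N1 \<union> N2))"
      obtain D where D: "(F has_vector_derivative D) (at t)" using N2(2)[of t] t by auto
      have "t \<in> einterval a b" using mem_einterval_between[OF xy(1,2), of t] t by auto
      then have "D = g t" using d[of t] vector_derivative_at[OF D] t by auto
      moreover have "(G has_vector_derivative g t) (at t)" using N1(2)[of t] t by auto
      ultimately show "((\<lambda>t. F t - G t) has_vector_derivative 0) (at t)"
        using has_vector_derivative_diff[OF D, of G "g t"] by simp
    qed
    moreover have "G x = 0" by (simp add: G_def)
    ultimately show ?thesis by (simp add: G_def algebra_simps)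
  qed simp
qed (rule g)

lemma ind_int_cong_AE:
  assumes I: "ind_int a b F g" and N: "negligible N" "\<And>x. x \<in> einterval a b - N \<Longrightarrow> h x = g x"
  shows "ind_int a b F h"
  unfolding ind_int_def
proof (intro conjI allI impI)
  show "loc_int a b h" using loc_int_cong_AE[OF ind_intD(1)[OF I] N] .
  fix x y assume xy: "x \<in> einterval a b" "y \<in> einterval a b" "x \<le> y"
  have "integral {x..y} g = integral {x..y} h"
  proof (rule integral_spike[OF N(1)])
    fix t assume "t \<in> {x..y} - N"
    then show "h t = g t" using N(2)[of t] mem_einterval_between[OF xy(1,2), of t] by auto
  qed
  then show "F y - F x = integral {x..y} h" using ind_intD(2)[OF I xy] by simp
qed

lemma ind_int_cong:
  assumes I: "ind_int a b F g" and "\<And>x. x \<in> einterval a b \<Longrightarrow> G x = F x"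
    and "\<And>x. x \<in> einterval a b \<Longrightarrow> h x = g x"
  shows "ind_int a b G h"
  using ind_int_cong_AE[OF I negligible_empty, of h] assms unfolding ind_int_def by auto

lemma ind_int_mult:
  assumes F: "ind_int a b F f" and G: "ind_int a b G g"
  shows "ind_int a b (\<lambda>x. F x * G x) (\<lambda>x. f x * G x + g x * F x)"
proof -
  obtain N1 where N1: "negligible N1" "\<And>x. x \<in> einterval a b - N1 \<Longrightarrow> (F has_vector_derivative f x) (at x)"
    using ind_int_deriv[OF F] by blast
  obtain N2 where N2: "negligible N2" "\<And>x. x \<in> einterval a b - N2 \<Longrightarrow> (G has_vector_derivative g x) (at x)"
    using ind_int_deriv[OF G] by blast
  show ?thesis
  proof (rule ind_int_of_AC)
    show "(\<lambda>x. F x * G x) \<in> AC_loc a b"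
      using AC_locD[OF ind_int_AC[OF F]] AC_locD[OF ind_int_AC[OF G]] by (intro AC_locI AC_on_mult) auto
    show "loc_int a b (\<lambda>x. f x * G x + g x * F x)"
      using F G by (intro loc_int_add loc_int_mult_continuous ind_intD(1) ind_int_continuous)
    show "negligible (N1 \<union> N2)" using N1 N2 by simp
    fix x assume x: "x \<in> einterval a b - (N1 \<union> N2)"
    have "((\<lambda>x. F x * G x) has_vector_derivative (F x * g x + f x * G x)) (at x)"
      using N1(2)[of x] N2(2)[of x] x by (intro has_vector_derivative_mult) auto
    then show "vector_derivative (\<lambda>x. F x * G x) (at x) = f x * G x + g x * F x"
      by (simp add: vector_derivative_at algebra_simps)
  qed
qed

lemma ind_int_add:
  assumes F: "ind_int a b F f" and G: "ind_int a b G g"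
  shows "ind_int a b (\<lambda>x. F x + G x) (\<lambda>x. f x + g x)"
  unfolding ind_int_def
proof (intro conjI allI impI)
  show "loc_int a b (\<lambda>x. f x + g x)" using F G by (intro loc_int_add ind_intD(1))
  fix x y assume xy: "x \<in> einterval a b" "y \<in> einterval a b" "x \<le> y"
  have "F y + G y - (F x + G x) = (F y - F x) + (G y - G x)" by simp
  then show "F y + G y - (F x + G x) = integral {x..y} (\<lambda>x. f x + g x)"
    using loc_intD(2)[OF ind_intD(1)[OF F] xy(1,2)] loc_intD(2)[OF ind_intD(1)[OF G] xy(1,2)]
      ind_intD(2)[OF F xy] ind_intD(2)[OF G xy] by (subst integral_add) auto
qed

lemma ind_int_cmult:
  assumes F: "ind_int a b F f"
  shows "ind_int a b (\<lambda>x. z * F x) (\<lambda>x. z * f x)"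
  using assms unfolding ind_int_def
  by (auto intro: loc_int_cmult simp flip: right_diff_distrib)

lemma ind_int_diff:
  assumes F: "ind_int a b F f" and G: "ind_int a b G g"
  shows "ind_int a b (\<lambda>x. F x - G x) (\<lambda>x. f x - g x)"
  using ind_int_add[OF F ind_int_cmult[OF G, of "-1"]] by simp

lemma ind_int_cnj:
  assumes F: "ind_int a b F f"
  shows "ind_int a b (\<lambda>x. cnj (F x)) (\<lambda>x. cnj (f x))"
  unfolding ind_int_def
proof (intro conjI allI impI)
  show "loc_int a b (\<lambda>x. cnj (f x))"
    using ind_intD(1)[OF F] unfolding loc_int_def
    by (auto intro: absolutely_integrable_linear[OF _ bounded_linear_cnj, unfolded o_def])
  fix x y assume xy: "x \<in> einterval a b" "y \<in> einterval a b" "x \<le> y"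
  show "cnj (F y) - cnj (F x) = integral {x..y} (\<lambda>x. cnj (f x))"
    using ind_intD(2)[OF F xy] by (metis complex_cnj_diff integral_cnj)
qed

text \<open>
  The indefinite integral of \<open>g\<close> that vanishes at \<open>c\<close>, with the usual sign convention
  to the left of \<open>c\<close>.
\<close>

definition prim :: "real \<Rightarrow> cfun \<Rightarrow> cfun" where
  "prim c g x = (if c \<le> x then integral {c..x} g else - integral {x..c} g)"

lemma prim_base [simp]: "prim c g c = 0"
  by (simp add: prim_def)

lemma ind_int_prim:
  assumes g: "loc_int a b g" and c: "c \<in> einterval a b"
  shows "ind_int a b (prim c g) g"
  unfolding ind_int_def
proof (intro conjI allI impI g)
  fix x y assume xy: "x \<in> einterval a b" "y \<in> einterval a b" "x \<le> y"
  have comb: "integral {s..u} g = integral {s..t} g + integral {t..u} g"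
    if "s \<in> einterval a b" "u \<in> einterval a b" "s \<le> t" "t \<le> u" for s t u
    using Henstock_Kurzweil_Integration.integral_combine[of s t u g] loc_intD(2)[OF g] that by metis
  consider "c \<le> x" | "x < c" "c \<le> y" | "y < c" by linarith
  then show "prim c g y - prim c g x = integral {x..y} g"
  proof cases
    case 1 then show ?thesis using comb[of c y x] c xy by (simp add: prim_def)
  next
    case 2 then show ?thesis using comb[of x y c] c xy by (simp add: prim_def)
  next
    case 3 then show ?thesis using comb[of x c y] c xy by (simp add: prim_def)
  qed
qed

section \<open>First-order linear systems with locally integrable coefficients\<close>

lemma ind_int_power:
  assumes F: "ind_int a b F f"
  shows "ind_int a b (\<lambda>x. F x ^ Suc n) (\<lambda>x. of_nat (Suc n) * F x ^ n * f x)"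
proof (induction n)
  case 0
  show ?case using F by simp
next
  case (Suc n)
  show ?case
    by (rule ind_int_cong[OF ind_int_mult[OF F Suc]]) (simp_all add: algebra_simps)
qed

context
  fixes a b :: ereal and c :: real and w :: "real \<Rightarrow> real" and W :: "real \<Rightarrow> real"
  assumes w: "loc_int a b w" "\<And>x. w x \<ge> 0" and c: "c \<in> einterval a b"
    and W: "\<And>x. complex_of_real (W x) = prim c (\<lambda>x. complex_of_real (w x)) x"
begin

lemma prim_weight_ind_int: "ind_int a b (\<lambda>x. complex_of_real (W x)) (\<lambda>x. complex_of_real (w x))"
  using ind_int_prim[OF loc_int_of_real[OF w(1)] c] by (simp add: W)

lemma prim_weight_power:
  assumes xy: "x \<in> einterval a b" "y \<in> einterval a b" "x \<le> y"
  shows "((\<lambda>t. W t ^ n * w t) has_integral (W y ^ Suc n - W x ^ Suc n) / Suc n) {x..y}"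
proof -
  have I: "ind_int a b (\<lambda>x. of_real (W x) ^ Suc n) (\<lambda>x. of_nat (Suc n) * of_real (W x) ^ n * complex_of_real (w x))"
    by (rule ind_int_power[OF prim_weight_ind_int])
  have "((\<lambda>x. of_nat (Suc n) * of_real (W x) ^ n * complex_of_real (w x)) has_integral
      (complex_of_real (W y) ^ Suc n - of_real (W x) ^ Suc n)) {x..y}"
    using ind_intD(2)[OF I xy] loc_intD(2)[OF ind_intD(1)[OF I] xy(1,2)] by (metis integrable_integral)
  moreover have "of_nat (Suc n) * of_real (W t) ^ n * complex_of_real (w t)
      = complex_of_real (real (Suc n) * (W t ^ n * w t))" for t by (simp add: mult.assoc)
  moreover have "complex_of_real (W y) ^ Suc n - of_real (W x) ^ Suc n = complex_of_real (W y ^ Suc n - W x ^ Suc n)"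
    by simp
  ultimately have "((\<lambda>t. complex_of_real (real (Suc n) * (W t ^ n * w t))) has_integral
      complex_of_real (W y ^ Suc n - W x ^ Suc n)) {x..y}" by (simp only:)
  from has_integral_linear[OF this bounded_linear_Re]
  have "((\<lambda>t. real (Suc n) * (W t ^ n * w t)) has_integral (W y ^ Suc n - W x ^ Suc n)) {x..y}"
    by (simp only: o_def Re_complex_of_real)
  from has_integral_divide[OF this, of "real (Suc n)"] show ?thesis
    by (simp only: nonzero_mult_div_cancel_left of_nat_eq_0_iff nat.distinct not_False_eq_True)
qed

lemma prim_weight_sign:
  assumes "x \<in> einterval a b"
  shows "c \<le> x \<Longrightarrow> W x \<ge> 0" "x \<le> c \<Longrightarrow> W x \<le> 0"
proof -
  have "W c = 0" using W[of c] by simp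
  show "W x \<ge> 0" if "c \<le> x"
    using has_integral_nonneg[OF prim_weight_power[OF c assms that, of 0]] w(2) \<open>W c = 0\<close> by simp
  show "W x \<le> 0" if "x \<le> c"
    using has_integral_nonneg[OF prim_weight_power[OF assms c that, of 0]] w(2) \<open>W c = 0\<close> by simp
qed

text \<open>
  The induction step for the Picard iterates: integrating a function bounded by \<open>w M \<bar>W\<bar>^n /
  n!\<close>, where \<open>W' = w\<close>, gives the next term of the exponential series.
\<close>

lemma prim_bound:
  assumes g: "loc_int a b g" and le: "\<And>x. x \<in> einterval a b \<Longrightarrow> cmod (g x) \<le> w x * (M * \<bar>W x\<bar> ^ n / fact n)"
    and x: "x \<in> einterval a b"
  shows "cmod (prim c g x) \<le> M * \<bar>W x\<bar> ^ Suc n / fact (Suc n)"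
proof -
  have Wc: "W c = 0" using W[of c] by simp
  have fs: "fact (Suc n) = real (Suc n) * fact n" by simp
  show ?thesis
  proof (cases "c \<le> x")
    case True
    have I: "((\<lambda>t. M / fact n * (W t ^ n * w t)) has_integral M / fact n * ((W x ^ Suc n - W c ^ Suc n) / Suc n)) {c..x}"
      by (intro has_integral_mult_right prim_weight_power c x True)
    have "norm (integral {c..x} g) \<le> integral {c..x} (\<lambda>t. M / fact n * (W t ^ n * w t))"
    proof (rule integral_norm_bound_integral)
      show "g integrable_on {c..x}" using loc_intD(2)[OF g c x] .
      show "(\<lambda>t. M / fact n * (W t ^ n * w t)) integrable_on {c..x}" using I by blast
      fix t assume t: "t \<in> {c..x}"
      then have "t \<in> einterval a b" using mem_einterval_between[OF c x] by auto
      then show "cmod (g t) \<le> M / fact n * (W t ^ n * w t)"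
        using le[of t] prim_weight_sign(1)[of t] t by (simp add: mult_ac)
    qed
    also have "\<dots> = M / fact n * ((W x ^ Suc n - W c ^ Suc n) / Suc n)" using I by (rule integral_unique)
    also have "\<dots> = M * \<bar>W x\<bar> ^ Suc n / fact (Suc n)"
      using prim_weight_sign(1)[OF x True] unfolding fs Wc by (simp del: of_nat_Suc add: mult_ac)
    finally show ?thesis using True by (simp add: prim_def)
  next
    case False
    then have xc: "x \<le> c" by simp
    have I: "((\<lambda>t. (-1) ^ n * M / fact n * (W t ^ n * w t)) has_integral (-1) ^ n * M / fact n * ((W c ^ Suc n - W x ^ Suc n) / Suc n)) {x..c}"
      by (intro has_integral_mult_right prim_weight_power c x xc)
    have "norm (integral {x..c} g) \<le> integral {x..c} (\<lambda>t. (-1) ^ n * M / fact n * (W t ^ n * w t))"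
    proof (rule integral_norm_bound_integral)
      show "g integrable_on {x..c}" using loc_intD(2)[OF g x c] .
      show "(\<lambda>t. (-1) ^ n * M / fact n * (W t ^ n * w t)) integrable_on {x..c}" using I by blast
      fix t assume t: "t \<in> {x..c}"
      then have t': "t \<in> einterval a b" using mem_einterval_between[OF x c] by auto
      have "\<bar>W t\<bar> ^ n = (-1) ^ n * W t ^ n"
        using prim_weight_sign(2)[OF t'] t by (simp add: abs_of_nonpos flip: power_mult_distrib)
      then show "cmod (g t) \<le> (-1) ^ n * M / fact n * (W t ^ n * w t)"
        using le[OF t'] by (simp add: mult_ac)
    qed
    also have "\<dots> = (-1) ^ n * M / fact n * ((W c ^ Suc n - W x ^ Suc n) / Suc n)" using I by (rule integral_unique)
    also have "\<dots> = M * ((-1) ^ Suc n * W x ^ Suc n) / fact (Suc n)"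
      unfolding fs Wc by (simp del: of_nat_Suc add: mult_ac)
    also have "(-1) ^ Suc n * W x ^ Suc n = \<bar>W x\<bar> ^ Suc n"
      using prim_weight_sign(2)[OF x xc] by (simp add: abs_of_nonpos flip: power_mult_distrib del: power_Suc)
    finally show ?thesis using False by (simp add: prim_def)
  qed
qed

end

text \<open>
  The successive differences of the Picard iteration for \<open>u' = A v\<close>, \<open>v' = B u\<close> with
  initial values \<open>\<alpha>\<close>, \<open>\<beta>\<close> at \<open>c\<close>. The solution is the sum of
  the series.
\<close>

primrec picard :: "real \<Rightarrow> cfun \<Rightarrow> cfun \<Rightarrow> complex \<Rightarrow> complex \<Rightarrow> nat \<Rightarrow> cfun \<times> cfun" where
  "picard c A B \<alpha> \<beta> 0 = (\<lambda>x. \<alpha>, \<lambda>x. \<beta>)"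
| "picard c A B \<alpha> \<beta> (Suc n) =
     (prim c (\<lambda>x. A x * snd (picard c A B \<alpha> \<beta> n) x), prim c (\<lambda>x. B x * fst (picard c A B \<alpha> \<beta> n) x))"

lemma ind_int_series_limit:
  assumes c: "c \<in> einterval a b" and A: "loc_int a b A"
    and cont: "\<And>n. continuous_on (einterval a b) (V n)"
    and Uc: "\<And>n. U (Suc n) = prim c (\<lambda>x. A x * V n x)" and U0: "U 0 = (\<lambda>x. \<alpha>)"
    and R: "continuous_on (einterval a b) R" "\<And>x. R x \<ge> (0::real)"
    and bU: "\<And>n x. x \<in> einterval a b \<Longrightarrow> cmod (U n x) \<le> M * R x ^ n / fact n"
    and bV: "\<And>n x. x \<in> einterval a b \<Longrightarrow> cmod (V n x) \<le> M * R x ^ n / fact n"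
    and "M \<ge> 0"
  shows "ind_int a b (\<lambda>x. \<Sum>n. U n x) (\<lambda>x. A x * (\<Sum>n. V n x))"
    "(\<Sum>n. U n c) = \<alpha>"
proof -
  have sm: "summable (\<lambda>n. M * \<rho> ^ n / fact n)" for \<rho>
    using summable_mult[OF summable_exp[of \<rho>], of M] by (simp add: field_simps)
  have sU: "summable (\<lambda>n. U n x)" and sV: "summable (\<lambda>n. V n x)" if "x \<in> einterval a b" for x
    using that bU bV by (auto intro: summable_comparison_test'[OF sm[of "R x"]])
  have gi: "loc_int a b (\<lambda>x. A x * V n x)" for n by (rule loc_int_mult_continuous[OF A cont])
  have main: "(\<lambda>x. A x * (\<Sum>n. V n x)) absolutely_integrable_on {x..y} \<and>
     (\<Sum>n. U n y) - (\<Sum>n. U n x) = integral {x..y} (\<lambda>x. A x * (\<Sum>n. V n x))"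
    if xy: "x \<in> einterval a b" "y \<in> einterval a b" "x \<le> y" for x y
  proof -
    have "bounded (R ` {x..y})"
      using continuous_on_einterval_Icc[OF R(1) xy(1,2)] by (intro compact_imp_bounded compact_continuous_image) auto
    then obtain \<rho> where "\<forall>t\<in>{x..y}. norm (R t) \<le> \<rho>"
      unfolding bounded_iff by blast
    then have \<rho>: "R t \<le> \<rho>" if "t \<in> {x..y}" for t using that by (auto simp: abs_le_iff)
    define C where "C = (\<Sum>n. M * \<rho> ^ n / fact n)"
    have "\<rho> \<ge> 0" using \<rho>[of x] R(2)[of x] xy by (meson atLeastAtMost_iff order_refl order_trans)
    define f where "f = (\<lambda>N t. A t * (\<Sum>n<N. V n t))"
    have fint: "f N absolutely_integrable_on {x..y}" for N
    proof -
      have "loc_int a b (f N)" unfolding f_def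
        by (rule loc_int_mult_continuous[OF A]) (intro continuous_intros cont)
      then show ?thesis using xy by (rule loc_intD)
    qed
    have mem: "t \<in> einterval a b" if "t \<in> {x..y}" for t using mem_einterval_between[OF xy(1,2)] that by auto
    have bd: "norm (f N t) \<le> norm (A t) * C" if t: "t \<in> {x..y}" for N t
    proof -
      have "norm (\<Sum>n<N. V n t) \<le> (\<Sum>n<N. M * \<rho> ^ n / fact n)"
      proof (rule sum_norm_le)
        fix n
        have "cmod (V n t) \<le> M * R t ^ n / fact n" using bV mem[OF t] by blast
        also have "\<dots> \<le> M * \<rho> ^ n / fact n"
          using \<rho>[OF t] R(2)[of t] \<open>M \<ge> 0\<close> by (intro divide_right_mono mult_left_mono power_mono) auto
        finally show "cmod (V n t) \<le> M * \<rho> ^ n / fact n" .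
      qed
      also have "\<dots> \<le> C" unfolding C_def using \<open>M \<ge> 0\<close> \<open>\<rho> \<ge> 0\<close> by (intro sum_le_suminf sm) auto
      finally show ?thesis unfolding f_def norm_mult by (rule mult_left_mono) simp
    qed
    have bint: "(\<lambda>t. norm (A t) * C) integrable_on {x..y}"
      using loc_intD(2)[OF loc_int_norm[OF A] xy(1,2)] by (rule integrable_on_mult_left)
    have lim: "(\<lambda>N. f N t) \<longlonglongrightarrow> A t * (\<Sum>n. V n t)" if t: "t \<in> {x..y}" for t
      unfolding f_def using summable_LIMSEQ[OF sV[OF mem[OF t]]] by (intro tendsto_intros)
    have fio: "f N integrable_on {x..y}" for N using fint set_lebesgue_integral_eq_integral(1) by blast
    have "norm (A t * (\<Sum>n. V n t)) \<le> norm (A t) * C" if t: "t \<in> {x..y}" for t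
      using lim[OF t] bd[OF t] by (intro Lim_norm_ubound[OF sequentially_bot]) auto
    then have ai: "(\<lambda>x. A x * (\<Sum>n. V n x)) absolutely_integrable_on {x..y}"
      by (intro dominated_convergence_absolutely_integrable[OF fint bint _ lim])
    have l1: "(\<lambda>N. integral {x..y} (f N)) \<longlonglongrightarrow> integral {x..y} (\<lambda>x. A x * (\<Sum>n. V n x))"
      by (rule dominated_convergence(2)[OF fio bint bd lim])
    have eq: "(\<Sum>n<Suc N. U n y) - (\<Sum>n<Suc N. U n x) = integral {x..y} (f N)" for N
    proof -
      have "(\<Sum>n<Suc N. U n y) - (\<Sum>n<Suc N. U n x) = (\<Sum>n<N. U (Suc n) y - U (Suc n) x)"
        unfolding sum.lessThan_Suc_shift U0 by (simp add: sum_subtractf)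
      also have "\<dots> = (\<Sum>n<N. integral {x..y} (\<lambda>t. A t * V n t))"
        unfolding Uc by (intro sum.cong refl ind_intD(2)[OF ind_int_prim[OF gi c] xy])
      also have "\<dots> = integral {x..y} (\<lambda>t. \<Sum>n<N. A t * V n t)"
        using loc_intD(2)[OF gi xy(1,2)] by (intro integral_sum[symmetric]) auto
      finally show ?thesis by (simp add: f_def sum_distrib_left)
    qed
    have "(\<lambda>N. (\<Sum>n<Suc N. U n y) - (\<Sum>n<Suc N. U n x)) \<longlonglongrightarrow> (\<Sum>n. U n y) - (\<Sum>n. U n x)"
      using summable_LIMSEQ[OF sU[OF xy(1)]] summable_LIMSEQ[OF sU[OF xy(2)]]
      by (intro tendsto_diff LIMSEQ_Suc)
    then have "(\<Sum>n. U n y) - (\<Sum>n. U n x) = integral {x..y} (\<lambda>x. A x * (\<Sum>n. V n x))"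
      using l1 LIMSEQ_unique unfolding eq by blast
    then show ?thesis using ai by blast
  qed
  show "ind_int a b (\<lambda>x. \<Sum>n. U n x) (\<lambda>x. A x * (\<Sum>n. V n x))"
    unfolding ind_int_def loc_int_def using main by blast
  have "U n c = (if n = 0 then \<alpha> else 0)" for n
    using U0 Uc by (cases n) auto
  then have "(\<lambda>n. U n c) sums \<alpha>" using sums_single[of 0 "\<lambda>_. \<alpha>"] by (simp add: eq_commute)
  then show "(\<Sum>n. U n c) = \<alpha>" by (rule sums_unique[symmetric])
qed

proposition linear_system_exists:
  assumes A: "loc_int a b A" and B: "loc_int a b B" and c: "c \<in> einterval a b"
  obtains u v where "ind_int a b u (\<lambda>x. A x * v x)" "ind_int a b v (\<lambda>x. B x * u x)"
    "u c = (\<alpha>::complex)" "v c = \<beta>"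
proof -
  define w where "w = (\<lambda>x. cmod (A x) + cmod (B x))"
  define W where "W = (\<lambda>x. Re (prim c (\<lambda>x. complex_of_real (w x)) x))"
  define U where "U = (\<lambda>n. fst (picard c A B \<alpha> \<beta> n))"
  define V where "V = (\<lambda>n. snd (picard c A B \<alpha> \<beta> n))"
  define M where "M = max (cmod \<alpha>) (cmod \<beta>)"
  have w: "loc_int a b w" "\<And>x. w x \<ge> 0"
    unfolding w_def using loc_int_add[OF loc_int_norm[OF A] loc_int_norm[OF B]] by auto
  have W: "complex_of_real (W x) = prim c (\<lambda>x. complex_of_real (w x)) x" for x
  proof -
    have "Im (integral S (\<lambda>x. complex_of_real (w x))) = 0" for S
    proof (cases "(\<lambda>x. complex_of_real (w x)) integrable_on S")
      case True
      from has_integral_linear[OF integrable_integral[OF this] bounded_linear_Im]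
      show ?thesis by (simp add: o_def has_integral_0_eq)
    qed (simp add: not_integrable_integral)
    then show ?thesis unfolding W_def prim_def by (auto simp: complex_eq_iff)
  qed
  have U: "U 0 = (\<lambda>x. \<alpha>)" "U (Suc n) = prim c (\<lambda>x. A x * V n x)"
    and V: "V 0 = (\<lambda>x. \<beta>)" "V (Suc n) = prim c (\<lambda>x. B x * U n x)" for n
    by (simp_all add: U_def V_def)
  have cont: "continuous_on (einterval a b) (U n) \<and> continuous_on (einterval a b) (V n)" for n
  proof (induction n)
    case (Suc n)
    then show ?case unfolding U V
      by (auto intro!: ind_int_continuous ind_int_prim loc_int_mult_continuous A B c)
  qed (auto simp: U V)
  have bound: "\<forall>x\<in>einterval a b. cmod (U n x) \<le> M * \<bar>W x\<bar> ^ n / fact n \<and> cmod (V n x) \<le> M * \<bar>W x\<bar> ^ n / fact n" for n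
  proof (induction n)
    case (Suc n)
    show ?case
    proof (intro ballI conjI)
      fix x assume x: "x \<in> einterval a b"
      show "cmod (U (Suc n) x) \<le> M * \<bar>W x\<bar> ^ Suc n / fact (Suc n)"
        unfolding U
      proof (rule prim_bound[OF w c W _ _ x])
        show "loc_int a b (\<lambda>x. A x * V n x)" using cont by (intro loc_int_mult_continuous A) auto
        fix t assume "t \<in> einterval a b"
        then have "cmod (A t * V n t) \<le> cmod (A t) * (M * \<bar>W t\<bar> ^ n / fact n)"
          using Suc unfolding norm_mult by (intro mult_left_mono) auto
        also have "\<dots> \<le> w t * (M * \<bar>W t\<bar> ^ n / fact n)"
          unfolding w_def by (intro mult_right_mono) (auto simp: M_def le_max_iff_disj)
        finally show "cmod (A t * V n t) \<le> w t * (M * \<bar>W t\<bar> ^ n / fact n)" .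
      qed
      show "cmod (V (Suc n) x) \<le> M * \<bar>W x\<bar> ^ Suc n / fact (Suc n)"
        unfolding V
      proof (rule prim_bound[OF w c W _ _ x])
        show "loc_int a b (\<lambda>x. B x * U n x)" using cont by (intro loc_int_mult_continuous B) auto
        fix t assume "t \<in> einterval a b"
        then have "cmod (B t * U n t) \<le> cmod (B t) * (M * \<bar>W t\<bar> ^ n / fact n)"
          using Suc unfolding norm_mult by (intro mult_left_mono) auto
        also have "\<dots> \<le> w t * (M * \<bar>W t\<bar> ^ n / fact n)"
          unfolding w_def by (intro mult_right_mono) (auto simp: M_def le_max_iff_disj)
        finally show "cmod (B t * U n t) \<le> w t * (M * \<bar>W t\<bar> ^ n / fact n)" .
      qed
    qed
  qed (auto simp: U V M_def)
  have Wc: "continuous_on (einterval a b) (\<lambda>x. \<bar>W x\<bar>)"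
  proof -
    have "continuous_on (einterval a b) (prim c (\<lambda>x. complex_of_real (w x)))"
      by (rule ind_int_continuous[OF ind_int_prim[OF loc_int_of_real[OF w(1)] c]])
    then show ?thesis unfolding W_def by (intro continuous_intros)
  qed
  have M: "M \<ge> 0" by (simp add: M_def le_max_iff_disj)
  have 1: "ind_int a b (\<lambda>x. \<Sum>n. U n x) (\<lambda>x. A x * (\<Sum>n. V n x))" "(\<Sum>n. U n c) = \<alpha>"
    using ind_int_series_limit[where U=U and V=V and A=A and M=M and R="\<lambda>x. \<bar>W x\<bar>", OF c A _ U(2,1) Wc]
      cont bound M by auto
  have 2: "ind_int a b (\<lambda>x. \<Sum>n. V n x) (\<lambda>x. B x * (\<Sum>n. U n x))" "(\<Sum>n. V n c) = \<beta>"
    using ind_int_series_limit[where U=V and V=U and A=B and M=M and R="\<lambda>x. \<bar>W x\<bar>", OF c B _ V(2,1) Wc]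
      cont bound M by auto
  show thesis using that[OF 1(1) 2(1) 1(2) 2(2)] .
qed

section \<open>Sturm--Liouville expressions as first-order systems\<close>

lemma loc_int_max0:
  fixes g :: "real \<Rightarrow> real"
  assumes "loc_int a b g"
  shows "loc_int a b (\<lambda>x. max 0 (g x))"
  unfolding loc_int_def
proof (intro allI impI)
  fix x y assume xy: "x \<in> einterval a b" "y \<in> einterval a b" "x \<le> y"
  have "(\<lambda>t. 0::real) absolutely_integrable_on {x..y}" by simp
  from absolutely_integrable_max_1[OF this loc_intD(1)[OF assms xy]]
  show "(\<lambda>t. max 0 (g t)) absolutely_integrable_on {x..y}" .
qed

lemma quadratic_form_nonneg_imp:
  fixes A B X :: real
  assumes "A \<ge> 0" and nn: "\<And>t. A * t\<^sup>2 - 2 * X * t + B \<ge> 0"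
  shows "X\<^sup>2 \<le> A * B"
proof (cases "A = 0")
  case True
  have "X = 0"
  proof (rule ccontr)
    assume "X \<noteq> 0"
    then show False using nn[of "(B + 1) / (2 * X)"] True by simp
  qed
  then show ?thesis using True by simp
next
  case False
  then have "A > 0" using \<open>A \<ge> 0\<close> by simp
  then show ?thesis using nn[of "X / A"] by (simp add: power2_eq_square field_simps)
qed

text \<open>
  The standing assumptions on the coefficients. The constants introduced in this locale refer to a fixed
  Sturm--Liouville expression on \<open>(a, b)\<close>.
\<close>

locale sturm_liouville =
  fixes a b :: ereal and p q r :: "real \<Rightarrow> real"
  assumes coeffs: "sl_coefficients a b p q r"
begin

text \<open>
  The weight, modified on a null set so that it is non-negative everywhere.
\<close>

definition \<rho> :: "real \<Rightarrow> real" where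
  "\<rho> x = max 0 (r x)"

lemma ab: "a < b" and p_loc: "loc_int a b (\<lambda>x. 1 / p x)" and q_loc: "loc_int a b q" and r_loc: "loc_int a b r"
  using coeffs by (auto simp: sl_coefficients_def L1_loc_imp_loc_int)

lemma rho_loc: "loc_int a b \<rho>"
  using loc_int_max0[OF r_loc] by (simp add: \<rho>_def[abs_def])

lemma rho_nonneg: "\<rho> x \<ge> 0"
  by (simp add: \<rho>_def)

lemma positive_ae:
  obtains N where "negligible N" "\<And>x. x \<in> einterval a b - N \<Longrightarrow> r x > 0 \<and> p x > 0 \<and> \<rho> x = r x"
proof -
  obtain N1 where N1: "negligible N1" "\<forall>x\<in>einterval a b - N1. r x > 0"
    using coeffs unfolding sl_coefficients_def AE_einterval_iff by blast
  obtain N2 where N2: "negligible N2" "\<forall>x\<in>einterval a b - N2. p x > 0"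
    using coeffs unfolding sl_coefficients_def AE_einterval_iff by blast
  show thesis
    by (rule that[of "N1 \<union> N2"]) (use N1 N2 in \<open>auto simp: \<rho>_def max_def intro: less_imp_le\<close>)
qed

text \<open>
  The equation \<open>\<tau>f = h\<close> with quasi-derivative \<open>f1\<close>, in integrated form: \<open>f'
  = f1 / p\<close> and \<open>f1' = q f - r h\<close>.
\<close>

definition sys :: "cfun \<Rightarrow> cfun \<Rightarrow> cfun \<Rightarrow> bool" where
  "sys f f1 h \<longleftrightarrow> ind_int a b f (\<lambda>x. complex_of_real (1 / p x) * f1 x) \<and>
     ind_int a b f1 (\<lambda>x. complex_of_real (q x) * f x - complex_of_real (\<rho> x) * h x)"

lemma sys_continuous:
  "sys f f1 h \<Longrightarrow> continuous_on (einterval a b) f" "sys f f1 h \<Longrightarrow> continuous_on (einterval a b) f1"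
  unfolding sys_def using ind_int_continuous by blast+

text \<open>
  This lemma and \<open>sysD\<close> translate between the integrated form and the pointwise definition of
  \<open>\<tau>\<close>.
\<close>

lemma sys_quasi_deriv:
  assumes f: "f \<in> D_tau a b p" and h: "loc_int a b (\<lambda>x. complex_of_real (\<rho> x) * h x)"
    and N: "negligible N" "\<And>x. x \<in> einterval a b - N \<Longrightarrow> tau a b p q r f x = h x"
  shows "sys f (quasi_deriv a b p f) h"
  unfolding sys_def
proof
  define f1 where "f1 = quasi_deriv a b p f"
  have qd: "is_quasi_deriv a b p f f1"
    using f unfolding f1_def quasi_deriv_def D_tau_def by (auto simp: some_eq_ex)
  then obtain N1 where N1: "negligible N1"
    "\<And>x. x \<in> einterval a b - N1 \<Longrightarrow> f1 x = complex_of_real (p x) * vector_derivative f (at x)"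
    unfolding is_quasi_deriv_def AE_einterval_iff by blast
  have fAC: "f \<in> AC_loc a b" "f1 \<in> AC_loc a b" using f qd by (auto simp: D_tau_def is_quasi_deriv_def)
  obtain N0 where N0: "negligible N0" "\<And>x. x \<in> einterval a b - N0 \<Longrightarrow> r x > 0 \<and> p x > 0 \<and> \<rho> x = r x"
    using positive_ae by metis
  show "ind_int a b f (\<lambda>x. complex_of_real (1 / p x) * f1 x)"
  proof (rule ind_int_of_AC[OF fAC(1)])
    show "loc_int a b (\<lambda>x. complex_of_real (1 / p x) * f1 x)"
      by (intro loc_int_mult_continuous loc_int_of_real p_loc AC_loc_continuous_on fAC)
    show "negligible (N0 \<union> N1)" using N0 N1 by simp
    fix x assume "x \<in> einterval a b - (N0 \<union> N1)"
    then show "vector_derivative f (at x) = complex_of_real (1 / p x) * f1 x"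
      using N0(2)[of x] N1(2)[of x] by auto
  qed
  show "ind_int a b f1 (\<lambda>x. complex_of_real (q x) * f x - complex_of_real (\<rho> x) * h x)"
  proof (rule ind_int_of_AC[OF fAC(2)])
    show "loc_int a b (\<lambda>x. complex_of_real (q x) * f x - complex_of_real (\<rho> x) * h x)"
      by (intro loc_int_diff loc_int_mult_continuous loc_int_of_real q_loc AC_loc_continuous_on fAC h)
    show "negligible (N0 \<union> N)" using N0 N by simp
    fix x assume x: "x \<in> einterval a b - (N0 \<union> N)"
    then have "complex_of_real (r x) * tau a b p q r f x
       = - vector_derivative f1 (at x) + complex_of_real (q x) * f x"
      using N0(2)[of x] by (auto simp: tau_def f1_def)
    then show "vector_derivative f1 (at x) = complex_of_real (q x) * f x - complex_of_real (\<rho> x) * h x"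
      using x N0(2)[of x] N(2)[of x] by (auto simp: algebra_simps)
  qed
qed

lemma sysD:
  assumes s: "sys f f1 h"
  shows "f \<in> D_tau a b p"
    "\<And>x. x \<in> einterval a b \<Longrightarrow> quasi_deriv a b p f x = f1 x"
    "AE x in lebesgue_on (einterval a b). tau a b p q r f x = h x"
proof -
  have I: "ind_int a b f (\<lambda>x. complex_of_real (1 / p x) * f1 x)"
    "ind_int a b f1 (\<lambda>x. complex_of_real (q x) * f x - complex_of_real (\<rho> x) * h x)"
    using s by (auto simp: sys_def)
  obtain N0 where N0: "negligible N0" "\<And>x. x \<in> einterval a b - N0 \<Longrightarrow> r x > 0 \<and> p x > 0 \<and> \<rho> x = r x"
    using positive_ae by metis
  obtain N1 where N1: "negligible N1" "\<And>x. x \<in> einterval a b - N1 \<Longrightarrow>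
      (f has_vector_derivative (complex_of_real (1 / p x) * f1 x)) (at x)"
    using ind_int_deriv[OF I(1)] by blast
  obtain N2 where N2: "negligible N2" "\<And>x. x \<in> einterval a b - N2 \<Longrightarrow>
      (f1 has_vector_derivative (complex_of_real (q x) * f x - complex_of_real (\<rho> x) * h x)) (at x)"
    using ind_int_deriv[OF I(2)] by blast
  have eq: "f1 x = complex_of_real (p x) * vector_derivative f (at x)"
    if "x \<in> einterval a b - (N0 \<union> N1)" for x
    using N0(2)[of x] vector_derivative_at[OF N1(2), of x] that by auto
  have qd: "is_quasi_deriv a b p f f1"
    unfolding is_quasi_deriv_def AE_einterval_iff using ind_int_AC[OF I(2)] eq N0(1) N1(1)
    by (intro conjI exI[of _ "N0 \<union> N1"]) auto
  then show "f \<in> D_tau a b p" using ind_int_AC[OF I(1)] by (auto simp: D_tau_def)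
  have qd': "is_quasi_deriv a b p f (quasi_deriv a b p f)"
    unfolding quasi_deriv_def by (rule someI[of "is_quasi_deriv a b p f", OF qd])
  then obtain N3 where N3: "negligible N3" "\<And>x. x \<in> einterval a b - N3 \<Longrightarrow>
      quasi_deriv a b p f x = complex_of_real (p x) * vector_derivative f (at x)"
    unfolding is_quasi_deriv_def AE_einterval_iff by blast
  show qeq: "quasi_deriv a b p f x = f1 x" if "x \<in> einterval a b" for x
  proof (rule continuous_eq_ae_imp_eq[OF _ _ _ _ that])
    show "continuous_on (einterval a b) (quasi_deriv a b p f)"
      using qd' by (intro AC_loc_continuous_on) (simp add: is_quasi_deriv_def)
    show "continuous_on (einterval a b) f1" using I(2) by (rule ind_int_continuous)
    show "negligible (N3 \<union> (N0 \<union> N1))" using N0 N1 N3 by simp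
    show "quasi_deriv a b p f x = f1 x" if "x \<in> einterval a b - (N3 \<union> (N0 \<union> N1))" for x
      using that N3(2)[of x] eq[of x] by auto
  qed
  show "AE x in lebesgue_on (einterval a b). tau a b p q r f x = h x"
    unfolding AE_einterval_iff
  proof (intro exI conjI ballI)
    show "negligible (N0 \<union> N2)" using N0 N2 by simp
    fix x assume x: "x \<in> einterval a b - (N0 \<union> N2)"
    have "(quasi_deriv a b p f has_vector_derivative (complex_of_real (q x) * f x - complex_of_real (\<rho> x) * h x)) (at x)"
      by (rule has_vector_derivative_transform_within_open[OF N2(2) open_einterval])
        (use x qeq in auto)
    then show "tau a b p q r f x = h x"
      using N0(2)[of x] x by (simp add: tau_def vector_derivative_at)
  qed
qed

lemma sys_cong:
  assumes "sys f f1 h" "\<And>x. x \<in> einterval a b \<Longrightarrow> g x = f x" "\<And>x. x \<in> einterval a b \<Longrightarrow> g1 x = f1 x"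
    "\<And>x. x \<in> einterval a b \<Longrightarrow> k x = h x"
  shows "sys g g1 k"
  using assms(1) unfolding sys_def
  by (auto simp: assms(2-4) intro: ind_int_cong[of _ _ f "\<lambda>x. complex_of_real (1 / p x) * f1 x"]
      ind_int_cong[of _ _ f1 "\<lambda>x. complex_of_real (q x) * f x - complex_of_real (\<rho> x) * h x"])

text \<open>
  Lagrange's identity: the derivative of the Wronskian of \<open>f\<close> and \<open>g\<close> is \<open>r
  (\<tau>f g - f \<tau>g)\<close>.
\<close>

lemma lagrange:
  assumes f: "sys f f1 h" and g: "sys g g1 k"
  shows "ind_int a b (\<lambda>x. f x * g1 x - f1 x * g x)
     (\<lambda>x. complex_of_real (\<rho> x) * (h x * g x - f x * k x))"
proof -
  note F = f[unfolded sys_def, THEN conjunct1] f[unfolded sys_def, THEN conjunct2]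
  note G = g[unfolded sys_def, THEN conjunct1] g[unfolded sys_def, THEN conjunct2]
  show ?thesis
    by (rule ind_int_cong[OF ind_int_diff[OF ind_int_mult[OF F(1) G(2)] ind_int_mult[OF F(2) G(1)]]])
      (simp_all add: algebra_simps)
qed

text \<open>
  \<open>u\<close> is a solution of \<open>\<tau>u = zu\<close> with quasi-derivative \<open>u1\<close>.
\<close>

definition sol :: "complex \<Rightarrow> cfun \<Rightarrow> cfun \<Rightarrow> bool" where
  "sol z u u1 \<longleftrightarrow> sys u u1 (\<lambda>x. z * u x)"

lemma sol_continuous:
  "sol z u u1 \<Longrightarrow> continuous_on (einterval a b) u" "sol z u u1 \<Longrightarrow> continuous_on (einterval a b) u1"
  unfolding sol_def using sys_continuous by blast+

lemma is_solution_iff: "is_solution a b p q r z u \<longleftrightarrow> (\<exists>u1. sol z u u1)"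
proof
  assume "is_solution a b p q r z u"
  then obtain N where N: "negligible N" "\<And>x. x \<in> einterval a b - N \<Longrightarrow> tau a b p q r u x = z * u x"
    and u: "u \<in> D_tau a b p"
    unfolding is_solution_def AE_einterval_iff by blast
  have "loc_int a b (\<lambda>x. complex_of_real (\<rho> x) * (z * u x))"
    using u by (intro loc_int_mult_continuous loc_int_of_real rho_loc continuous_intros AC_loc_continuous_on)
      (simp add: D_tau_def)
  from sys_quasi_deriv[OF u this N] show "\<exists>u1. sol z u u1" by (auto simp: sol_def)
next
  assume "\<exists>u1. sol z u u1"
  then show "is_solution a b p q r z u"
    unfolding is_solution_def sol_def using sysD by blast
qed

lemma sol_exists:
  assumes c: "c \<in> einterval a b"
  obtains u u1 where "sol z u u1" "u c = \<alpha>" "u1 c = \<beta>"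
proof -
  have B: "loc_int a b (\<lambda>x. complex_of_real (q x) - z * complex_of_real (\<rho> x))"
    by (intro loc_int_diff loc_int_cmult loc_int_of_real q_loc rho_loc)
  obtain u u1 where u: "ind_int a b u (\<lambda>x. complex_of_real (1 / p x) * u1 x)"
    "ind_int a b u1 (\<lambda>x. (complex_of_real (q x) - z * complex_of_real (\<rho> x)) * u x)" "u c = \<alpha>" "u1 c = \<beta>"
    using linear_system_exists[OF loc_int_of_real[OF p_loc] B c] by blast
  have "sol z u u1"
    unfolding sol_def sys_def using u(1) by (auto intro!: ind_int_cong[OF u(2)] simp: algebra_simps)
  then show thesis using that u by blast
qed

lemma sol_lincomb:
  assumes u: "sol z u u1" and v: "sol z v v1"
  shows "sol z (\<lambda>x. \<alpha> * u x + \<beta> * v x) (\<lambda>x. \<alpha> * u1 x + \<beta> * v1 x)"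
  unfolding sol_def sys_def
proof
  show "ind_int a b (\<lambda>x. \<alpha> * u x + \<beta> * v x) (\<lambda>x. complex_of_real (1 / p x) * (\<alpha> * u1 x + \<beta> * v1 x))"
    by (rule ind_int_cong[OF ind_int_add[OF ind_int_cmult[where z=\<alpha>] ind_int_cmult[where z=\<beta>]]])
      (use u v in \<open>auto simp: sol_def sys_def algebra_simps\<close>)
  show "ind_int a b (\<lambda>x. \<alpha> * u1 x + \<beta> * v1 x) (\<lambda>x. complex_of_real (q x) * (\<alpha> * u x + \<beta> * v x)
      - complex_of_real (\<rho> x) * (z * (\<alpha> * u x + \<beta> * v x)))"
    by (rule ind_int_cong[OF ind_int_add[OF ind_int_cmult[where z=\<alpha>] ind_int_cmult[where z=\<beta>]]])
      (use u v in \<open>auto simp: sol_def sys_def algebra_simps\<close>)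
qed

lemma sys_cnj:
  assumes u: "sys f f1 h"
  shows "sys (\<lambda>x. cnj (f x)) (\<lambda>x. cnj (f1 x)) (\<lambda>x. cnj (h x))"
  unfolding sys_def
proof
  show "ind_int a b (\<lambda>x. cnj (f x)) (\<lambda>x. complex_of_real (1 / p x) * cnj (f1 x))"
    by (rule ind_int_cong[OF ind_int_cnj]) (use u in \<open>auto simp: sys_def\<close>)
  show "ind_int a b (\<lambda>x. cnj (f1 x)) (\<lambda>x. complex_of_real (q x) * cnj (f x) - complex_of_real (\<rho> x) * cnj (h x))"
    by (rule ind_int_cong[OF ind_int_cnj]) (use u in \<open>auto simp: sys_def\<close>)
qed

lemma sol_cnj: "sol z u u1 \<Longrightarrow> sol (cnj z) (\<lambda>x. cnj (u x)) (\<lambda>x. cnj (u1 x))"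
  unfolding sol_def using sys_cnj[of u u1 "\<lambda>x. z * u x"] by simp

lemma sol_lagrange:
  assumes u: "sol z u u1" and v: "sol w v v1"
    and x: "x \<in> einterval a b" "y \<in> einterval a b" "x \<le> y"
  shows "(u y * v1 y - u1 y * v y) - (u x * v1 x - u1 x * v x)
     = (z - w) * integral {x..y} (\<lambda>t. complex_of_real (\<rho> t) * (u t * v t))"
proof -
  have "(u y * v1 y - u1 y * v y) - (u x * v1 x - u1 x * v x)
     = integral {x..y} (\<lambda>t. complex_of_real (\<rho> t) * (z * u t * v t - u t * (w * v t)))"
    using ind_intD(2)[OF lagrange[OF u[unfolded sol_def] v[unfolded sol_def]] x] .
  also have "(\<lambda>t. complex_of_real (\<rho> t) * (z * u t * v t - u t * (w * v t)))
      = (\<lambda>t. (z - w) * (complex_of_real (\<rho> t) * (u t * v t)))"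
    by (auto simp: algebra_simps)
  finally show ?thesis by simp
qed

lemma sol_wronskian_const:
  assumes u: "sol z u u1" and v: "sol z v v1" and x: "x \<in> einterval a b" "y \<in> einterval a b"
  shows "u y * v1 y - u1 y * v y = u x * v1 x - u1 x * v x"
  using sol_lagrange[OF u v x] sol_lagrange[OF u v x(2,1)] by (cases "x \<le> y") auto

lemma sol_representation:
  assumes u: "sol z u u1" and \<theta>: "sol z \<theta> \<theta>1" and \<phi>: "sol z \<phi> \<phi>1"
    and c: "c \<in> einterval a b" and w: "\<theta> c * \<phi>1 c - \<theta>1 c * \<phi> c = 1"
    and x: "x \<in> einterval a b"
  shows "u x = (u c * \<phi>1 c - u1 c * \<phi> c) * \<theta> x - (u c * \<theta>1 c - u1 c * \<theta> c) * \<phi> x"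
proof -
  have W: "\<theta> x * \<phi>1 x - \<theta>1 x * \<phi> x = 1" using sol_wronskian_const[OF \<theta> \<phi> c x] w by simp
  have "u x = u x * (\<theta> x * \<phi>1 x - \<theta>1 x * \<phi> x)" using W by simp
  also have "\<dots> = (u x * \<phi>1 x - u1 x * \<phi> x) * \<theta> x - (u x * \<theta>1 x - u1 x * \<theta> x) * \<phi> x"
    by (simp add: algebra_simps)
  also have "u x * \<phi>1 x - u1 x * \<phi> x = u c * \<phi>1 c - u1 c * \<phi> c"
    by (rule sol_wronskian_const[OF u \<phi> c x])
  also have "u x * \<theta>1 x - u1 x * \<theta> x = u c * \<theta>1 c - u1 c * \<theta> c"
    by (rule sol_wronskian_const[OF u \<theta> c x])
  finally show ?thesis .
qed

lemma sys_zero_imp_quasi_deriv_zero: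
  assumes s: "sys f f1 h" and xy: "x \<in> einterval a b" "y \<in> einterval a b"
    and z: "\<And>t. t \<in> {x<..<y} \<Longrightarrow> f t = 0" and t: "t \<in> {x<..<y}"
  shows "f1 t = 0"
proof -
  have sub: "{x<..<y} \<subseteq> einterval a b" using mem_einterval_between[OF xy] by auto
  have I: "ind_int a b f (\<lambda>x. complex_of_real (1 / p x) * f1 x)" using s by (auto simp: sys_def)
  obtain N0 where N0: "negligible N0" "\<And>x. x \<in> einterval a b - N0 \<Longrightarrow> r x > 0 \<and> p x > 0 \<and> \<rho> x = r x"
    using positive_ae by metis
  obtain N1 where N1: "negligible N1" "\<And>x. x \<in> einterval a b - N1 \<Longrightarrow>
      (f has_vector_derivative (complex_of_real (1 / p x) * f1 x)) (at x)"
    using ind_int_deriv[OF I] by blast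
  have "t \<in> einterval (ereal x) (ereal y)" using t by simp
  then show ?thesis
  proof (rule continuous_eq_ae_imp_eq[rotated -1])
    show "continuous_on (einterval (ereal x) (ereal y)) f1"
      using continuous_on_subset[OF sys_continuous(2)[OF s] sub] by simp
    show "negligible (N0 \<union> N1)" using N0 N1 by simp
    fix s assume s: "s \<in> einterval (ereal x) (ereal y) - (N0 \<union> N1)"
    then have s': "s \<in> einterval a b - (N0 \<union> N1)" "s \<in> {x<..<y}" using sub by auto
    have "(f has_vector_derivative 0) (at s)"
      by (rule has_vector_derivative_transform_within_open[OF has_vector_derivative_const[of 0] _ s'(2)])
        (use z in auto)
    with N1(2)[of s] s' have "complex_of_real (1 / p s) * f1 s = 0"
      by (auto dest: vector_derivative_unique_at)
    then show "f1 s = 0" using N0(2)[of s] s' by auto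
  qed simp
qed

text \<open>
  The squared norm of \<open>f\<close> in \<open>L\<^sup>2\<close> of \<open>[x, y]\<close> with weight
  \<open>r\<close>.
\<close>

definition energy :: "cfun \<Rightarrow> real \<Rightarrow> real \<Rightarrow> real" where
  "energy f x y = integral {x..y} (\<lambda>t. \<rho> t * (cmod (f t))\<^sup>2)"

lemma loc_int_energy: "continuous_on (einterval a b) f \<Longrightarrow> loc_int a b (\<lambda>t. \<rho> t * (cmod (f t))\<^sup>2)"
  by (intro loc_int_mult_continuous rho_loc continuous_intros)

lemma loc_int_rho_mult: "continuous_on (einterval a b) f \<Longrightarrow> loc_int a b (\<lambda>t. complex_of_real (\<rho> t) * f t)"
  by (intro loc_int_mult_continuous loc_int_of_real rho_loc)

lemma energy_nonneg: "energy f x y \<ge> 0"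
  unfolding energy_def by (cases "(\<lambda>t. \<rho> t * (cmod (f t))\<^sup>2) integrable_on {x..y}") (auto intro!: integral_nonneg simp: rho_nonneg not_integrable_integral)

end

section \<open>Weighted energy and the limit circle case\<close>

lemma integral_complex_of_real:
  assumes "f integrable_on S"
  shows "integral S (\<lambda>x. complex_of_real (f x)) = complex_of_real (integral S f)"
  using has_integral_linear[OF integrable_integral[OF assms] bounded_linear_of_real]
  by (auto simp: o_def intro: integral_unique)

context sturm_liouville
begin

abbreviation ein :: "real set" where "ein \<equiv> einterval a b"

lemma energy_integrable:
  "continuous_on ein f \<Longrightarrow> x \<in> ein \<Longrightarrow> y \<in> ein \<Longrightarrow> (\<lambda>t. \<rho> t * (cmod (f t))\<^sup>2) integrable_on {x..y}"
  by (rule loc_intD(2)[OF loc_int_energy])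

lemma energy_combine:
  assumes "continuous_on ein f" "x \<in> ein" "z \<in> ein" "x \<le> y" "y \<le> z"
  shows "energy f x z = energy f x y + energy f y z"
  unfolding energy_def
  using Henstock_Kurzweil_Integration.integral_combine[OF assms(4,5) energy_integrable[OF assms(1-3)]] by simp

lemma energy_mono:
  assumes "continuous_on ein f" "x \<in> ein" "z \<in> ein" "x \<le> y" "y \<le> z"
  shows "energy f x y \<le> energy f x z" "energy f y z \<le> energy f x z"
  using energy_combine[OF assms] energy_nonneg[of f x y] energy_nonneg[of f y z] by auto

lemma energy_le_lincomb:
  assumes c: "continuous_on ein f" "continuous_on ein g" "continuous_on ein h" and xy: "x \<in> ein" "y \<in> ein"
    and le: "\<And>t. t \<in> {x..y} \<Longrightarrow> (cmod (h t))\<^sup>2 \<le> A * (cmod (f t))\<^sup>2 + B * (cmod (g t))\<^sup>2"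
  shows "energy h x y \<le> A * energy f x y + B * energy g x y"
proof -
  have 1: "((\<lambda>t. A * (\<rho> t * (cmod (f t))\<^sup>2) + B * (\<rho> t * (cmod (g t))\<^sup>2)) has_integral
     (A * energy f x y + B * energy g x y)) {x..y}"
    unfolding energy_def
    by (intro has_integral_add has_integral_mult_right integrable_integral energy_integrable c xy)
  have 2: "((\<lambda>t. \<rho> t * (cmod (h t))\<^sup>2) has_integral energy h x y) {x..y}"
    unfolding energy_def by (intro integrable_integral energy_integrable c xy)
  show ?thesis
  proof (rule has_integral_le[OF 2 1])
    fix t assume "t \<in> {x..y}"
    from mult_left_mono[OF le[OF this] rho_nonneg[of t]]
    show "\<rho> t * (cmod (h t))\<^sup>2 \<le> A * (\<rho> t * (cmod (f t))\<^sup>2) + B * (\<rho> t * (cmod (g t))\<^sup>2)"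
      by (simp add: algebra_simps)
  qed
qed

lemma energy_cmult: "energy (\<lambda>t. k * f t) x y = (cmod k)\<^sup>2 * energy f x y"
proof -
  have "(\<lambda>t. \<rho> t * (cmod (k * f t))\<^sup>2) = (\<lambda>t. (cmod k)\<^sup>2 * (\<rho> t * (cmod (f t))\<^sup>2))"
    by (auto simp: norm_mult power_mult_distrib)
  then show ?thesis by (simp add: energy_def)
qed

text \<open>
  The weight is only positive almost everywhere, so vanishing of the integral gives \<open>f = 0\<close> almost
  everywhere by differentiation; continuity does the rest.
\<close>

lemma energy_zero_imp_zero:
  assumes c: "continuous_on ein f" and xy: "x \<in> ein" "y \<in> ein" "x < y" and e: "energy f x y = 0"
    and t: "t \<in> {x<..<y}"
  shows "f t = 0"
proof -
  define g where "g = (\<lambda>t. complex_of_real (\<rho> t * (cmod (f t))\<^sup>2))"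
  have sub: "{x<..<y} \<subseteq> ein" using mem_einterval_between[OF xy(1,2)] by auto
  have lg: "loc_int a b g" unfolding g_def by (rule loc_int_of_real[OF loc_int_energy[OF c]])
  have P0: "prim x g s = 0" if s: "s \<in> {x<..<y}" for s
  proof -
    have "s \<in> ein" using s sub by auto
    have "energy f x s \<le> 0" using energy_mono(1)[OF c xy(1,2), of s] s e by simp
    then have "energy f x s = 0" using energy_nonneg[of f x s] by simp
    then show ?thesis using s integral_complex_of_real[OF energy_integrable[OF c xy(1) \<open>s \<in> ein\<close>]]
      by (simp add: prim_def g_def energy_def)
  qed
  obtain N0 where N0: "negligible N0" "\<And>x. x \<in> ein - N0 \<Longrightarrow> r x > 0 \<and> p x > 0 \<and> \<rho> x = r x"
    using positive_ae by metis
  obtain N1 where N1: "negligible N1" "\<And>s. s \<in> ein - N1 \<Longrightarrow> (prim x g has_vector_derivative g s) (at s)"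
    using ind_int_deriv[OF ind_int_prim[OF lg xy(1)]] by blast
  have "t \<in> einterval (ereal x) (ereal y)" using t by simp
  then show ?thesis
  proof (rule continuous_eq_ae_imp_eq[rotated -1])
    show "continuous_on (einterval (ereal x) (ereal y)) f"
      using continuous_on_subset[OF c sub] by simp
    show "negligible (N0 \<union> N1)" using N0 N1 by simp
    fix s assume s: "s \<in> einterval (ereal x) (ereal y) - (N0 \<union> N1)"
    then have s': "s \<in> ein - (N0 \<union> N1)" "s \<in> {x<..<y}" using sub by auto
    have "(prim x g has_vector_derivative 0) (at s)"
      by (rule has_vector_derivative_transform_within_open[OF has_vector_derivative_const[of 0] _ s'(2)])
        (use P0 in auto)
    with N1(2)[of s] s' have "g s = 0" by (auto dest: vector_derivative_unique_at)
    then show "f s = 0" using N0(2)[of s] s' by (auto simp: g_def)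
  qed simp
qed

text \<open>
  The bilinear pairing of \<open>f\<close> and \<open>g\<close> on \<open>[x, y]\<close> with weight
  \<open>r\<close>; there is no conjugation.
\<close>

definition wip :: "cfun \<Rightarrow> cfun \<Rightarrow> real \<Rightarrow> real \<Rightarrow> complex" where
  "wip f g x y = integral {x..y} (\<lambda>t. complex_of_real (\<rho> t) * (f t * g t))"

lemma wip_has_integral:
  assumes c: "continuous_on ein f" "continuous_on ein g" and xy: "x \<in> ein" "y \<in> ein"
  shows "((\<lambda>t. complex_of_real (\<rho> t) * (f t * g t)) has_integral wip f g x y) {x..y}"
  unfolding wip_def
  by (intro integrable_integral loc_intD(2)[OF loc_int_rho_mult xy] continuous_intros c)

lemma wip_Cauchy_Schwarz:
  assumes c: "continuous_on ein f" "continuous_on ein g" and xy: "x \<in> ein" "y \<in> ein"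
  shows "(cmod (wip f g x y))\<^sup>2 \<le> energy f x y * energy g x y"
proof -
  define X where "X = integral {x..y} (\<lambda>t. \<rho> t * (cmod (f t) * cmod (g t)))"
  have int: "(\<lambda>t. \<rho> t * (cmod (f t) * cmod (g t))) integrable_on {x..y}"
    by (intro loc_intD(2)[OF loc_int_mult_continuous[OF rho_loc] xy] continuous_intros c)
  have "cmod (wip f g x y) \<le> X"
    unfolding wip_def X_def
  proof (rule integral_norm_bound_integral[OF _ int])
    show "(\<lambda>t. complex_of_real (\<rho> t) * (f t * g t)) integrable_on {x..y}"
      using wip_has_integral[OF c xy] by blast
  qed (simp add: norm_mult rho_nonneg)
  then have "(cmod (wip f g x y))\<^sup>2 \<le> X\<^sup>2" by (intro power_mono) auto
  also have "X\<^sup>2 \<le> energy f x y * energy g x y"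
  proof (rule quadratic_form_nonneg_imp[OF energy_nonneg])
    fix s :: real
    have "((\<lambda>t. s\<^sup>2 * (\<rho> t * (cmod (f t))\<^sup>2) - (2 * s) * (\<rho> t * (cmod (f t) * cmod (g t))) + \<rho> t * (cmod (g t))\<^sup>2) has_integral
      (s\<^sup>2 * energy f x y - (2 * s) * X + energy g x y)) {x..y}"
      unfolding energy_def X_def
      by (intro has_integral_add has_integral_diff has_integral_mult_right integrable_integral energy_integrable int c xy)
    then have "s\<^sup>2 * energy f x y - (2 * s) * X + energy g x y \<ge> 0"
    proof (rule has_integral_nonneg)
      fix t
      have "\<rho> t * (s * cmod (f t) - cmod (g t))\<^sup>2 \<ge> 0" by (simp add: rho_nonneg)
      then show "0 \<le> s\<^sup>2 * (\<rho> t * (cmod (f t))\<^sup>2) - (2 * s) * (\<rho> t * (cmod (f t) * cmod (g t))) + \<rho> t * (cmod (g t))\<^sup>2"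
        by (simp add: power2_eq_square algebra_simps)
    qed
    then show "energy f x y * s\<^sup>2 - 2 * X * s + energy g x y \<ge> 0" by (simp add: mult_ac)
  qed
  finally show ?thesis .
qed

lemma sol_lagrange_wip:
  assumes u: "sol z u u1" and v: "sol w v v1" and x: "x \<in> ein" "y \<in> ein" "x \<le> y"
  shows "u y * v1 y - u1 y * v y = (u x * v1 x - u1 x * v x) + (z - w) * wip u v x y"
  using sol_lagrange[OF u v x] unfolding wip_def by (simp add: algebra_simps)

text \<open>
  Lagrange's identity for \<open>cnj w\<close> and \<open>w\<close>.
\<close>

lemma sol_green:
  assumes w: "sol z w w1" and x: "x \<in> ein" "y \<in> ein" "x \<le> y"
  shows "Im (cnj (w y) * w1 y) = Im (cnj (w x) * w1 x) - Im z * energy w x y"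
proof -
  have "wip (\<lambda>t. cnj (w t)) w x y = integral {x..y} (\<lambda>t. complex_of_real (\<rho> t * (cmod (w t))\<^sup>2))"
    unfolding wip_def by (simp add: complex_norm_square mult.commute del: of_real_power)
  also have "\<dots> = complex_of_real (energy w x y)"
    unfolding energy_def by (intro integral_complex_of_real energy_integrable sol_continuous[OF w] x)
  finally have e: "wip (\<lambda>t. cnj (w t)) w x y = complex_of_real (energy w x y)" .
  have s: "cnj (w t) * w1 t - cnj (w1 t) * w t = 2 * \<i> * complex_of_real (Im (cnj (w t) * w1 t))" for t
    by (simp add: complex_eq_iff algebra_simps)
  have "cnj z - z = - 2 * \<i> * complex_of_real (Im z)" by (simp add: complex_eq_iff)
  with sol_lagrange_wip[OF sol_cnj[OF w] w x]
  have "2 * \<i> * complex_of_real (Im (cnj (w y) * w1 y)) =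
     2 * \<i> * complex_of_real (Im (cnj (w x) * w1 x) - Im z * energy w x y)"
    unfolding e s by (simp add: algebra_simps)
  then show ?thesis by (simp only: mult_cancel_left of_real_eq_iff) simp
qed

text \<open>
  Square integrability near \<open>b\<close>, expressed by bounded norms on compact intervals.
\<close>

definition sq_int_right :: "cfun \<Rightarrow> bool" where
  "sq_int_right f \<longleftrightarrow> (\<forall>c\<in>ein. \<exists>K. \<forall>B\<in>ein. c \<le> B \<longrightarrow> energy f c B \<le> K)"

lemma sq_int_rightI:
  assumes f: "continuous_on ein f" and c: "c \<in> ein" and K: "\<And>B. B \<in> ein \<Longrightarrow> c \<le> B \<Longrightarrow> energy f c B \<le> K"
  shows "sq_int_right f"
  unfolding sq_int_right_def
proof
  fix d assume d: "d \<in> ein"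
  have "energy f d B \<le> energy f d (max c d) + max 0 K" if B: "B \<in> ein" "d \<le> B" for B
  proof (cases "max c d \<le> B")
    case True
    have "energy f d B = energy f d (max c d) + energy f (max c d) B"
      using True by (intro energy_combine f d B) auto
    moreover have "energy f (max c d) B \<le> energy f c B" using True by (intro energy_mono(2) f c B) auto
    ultimately show ?thesis using K[OF B(1)] True by simp
  next
    case False
    have "energy f d B \<le> energy f d (max c d)"
      using False B d c by (intro energy_mono(1) f) (auto simp: max_def)
    then show ?thesis by simp
  qed
  then show "\<exists>K. \<forall>B\<in>ein. d \<le> B \<longrightarrow> energy f d B \<le> K" by blast
qed

lemma sq_int_rightD:
  assumes "sq_int_right f" "c \<in> ein"
  obtains K where "K \<ge> 0" "\<And>B. B \<in> ein \<Longrightarrow> c \<le> B \<Longrightarrow> energy f c B \<le> K"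
proof -
  obtain K where "\<forall>B\<in>ein. c \<le> B \<longrightarrow> energy f c B \<le> K" using assms unfolding sq_int_right_def by blast
  then show thesis using that[of "max 0 K"] by fastforce
qed

lemma norm_lincomb_square_le:
  fixes u v :: complex
  shows "(cmod (\<alpha> * u + \<beta> * v))\<^sup>2 \<le> (2 * (cmod \<alpha>)\<^sup>2) * (cmod u)\<^sup>2 + (2 * (cmod \<beta>)\<^sup>2) * (cmod v)\<^sup>2"
proof -
  have "(cmod (\<alpha> * u + \<beta> * v))\<^sup>2 \<le> (cmod (\<alpha> * u) + cmod (\<beta> * v))\<^sup>2"
    by (intro power_mono norm_triangle_ineq) simp
  also have "\<dots> \<le> 2 * (cmod (\<alpha> * u))\<^sup>2 + 2 * (cmod (\<beta> * v))\<^sup>2"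
    using sum_squares_bound[of "cmod (\<alpha> * u)" "cmod (\<beta> * v)"] by (simp add: power2_sum)
  finally show ?thesis by (simp add: norm_mult power_mult_distrib mult_ac)
qed

lemma sq_int_right_lincomb:
  assumes c: "continuous_on ein f" "continuous_on ein g" and i: "sq_int_right f" "sq_int_right g"
  shows "sq_int_right (\<lambda>t. \<alpha> * f t + \<beta> * g t)"
  unfolding sq_int_right_def
proof
  fix d assume d: "d \<in> ein"
  obtain K1 K2 where K: "\<And>B. B \<in> ein \<Longrightarrow> d \<le> B \<Longrightarrow> energy f d B \<le> K1" "\<And>B. B \<in> ein \<Longrightarrow> d \<le> B \<Longrightarrow> energy g d B \<le> K2"
    using sq_int_rightD[OF i(1) d] sq_int_rightD[OF i(2) d] by metis
  have "energy (\<lambda>t. \<alpha> * f t + \<beta> * g t) d B \<le> (2 * (cmod \<alpha>)\<^sup>2) * K1 + (2 * (cmod \<beta>)\<^sup>2) * K2"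
    if B: "B \<in> ein" "d \<le> B" for B
  proof -
    have "energy (\<lambda>t. \<alpha> * f t + \<beta> * g t) d B \<le> (2 * (cmod \<alpha>)\<^sup>2) * energy f d B + (2 * (cmod \<beta>)\<^sup>2) * energy g d B"
      by (intro energy_le_lincomb c d B continuous_intros norm_lincomb_square_le)
    also have "\<dots> \<le> (2 * (cmod \<alpha>)\<^sup>2) * K1 + (2 * (cmod \<beta>)\<^sup>2) * K2"
      using K B by (intro add_mono mult_left_mono) auto
    finally show ?thesis .
  qed
  then show "\<exists>K. \<forall>B\<in>ein. d \<le> B \<longrightarrow> energy (\<lambda>t. \<alpha> * f t + \<beta> * g t) d B \<le> K" by blast
qed

lemma sq_int_right_tail:
  assumes f: "continuous_on ein f" "sq_int_right f" and c: "c \<in> ein" and "\<epsilon> > 0"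
  obtains d where "d \<in> ein" "c \<le> d" "\<And>x B. x \<in> ein \<Longrightarrow> d \<le> x \<Longrightarrow> B \<in> ein \<Longrightarrow> x \<le> B \<Longrightarrow> energy f x B \<le> \<epsilon>"
proof -
  define S where "S = energy f c ` {B\<in>ein. c \<le> B}"
  obtain K where K: "\<And>B. B \<in> ein \<Longrightarrow> c \<le> B \<Longrightarrow> energy f c B \<le> K"
    using sq_int_rightD[OF f(2) c] by blast
  have S: "S \<noteq> {}" "bdd_above S" using c K by (auto simp: S_def intro!: bdd_aboveI2[of _ _ K])
  have "Sup S - \<epsilon> < Sup S" using \<open>\<epsilon> > 0\<close> by simp
  then obtain d where d: "d \<in> ein" "c \<le> d" "Sup S - \<epsilon> < energy f c d"
    using less_cSup_iff[OF S, of "Sup S - \<epsilon>"] by (auto simp: S_def)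
  show thesis
  proof (rule that[OF d(1,2)])
    fix x B assume x: "x \<in> ein" "d \<le> x" "B \<in> ein" "x \<le> B"
    have "energy f c B \<le> Sup S" using S(2) x d by (intro cSup_upper) (auto simp: S_def)
    moreover have "energy f c B = energy f c d + energy f d B" using x d by (intro energy_combine f c) auto
    moreover have "energy f x B \<le> energy f d B" using x d by (intro energy_mono(2) f) auto
    ultimately show "energy f x B \<le> \<epsilon>" using d(3) by linarith
  qed
qed

text \<open>
  If all solutions at \<open>z\<close> are square integrable near \<open>b\<close>, then so are all solutions
  \<open>u\<close> at any other parameter \<open>z0\<close>. Variation of constants takes the form \<open>u =
  W(u, \<phi>) \<theta> - W(u, \<theta>) \<phi>\<close>, where by Lagrange's identity and the Cauchy--Schwarz
  inequality the Wronskians grow at most like the norm of \<open>u\<close> times the small norms of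
  \<open>\<theta>\<close>, \<open>\<phi>\<close> on a tail \<open>(d, b)\<close>. The norm \<open>U\<close> of
  \<open>u\<close> on the tail therefore satisfies \<open>U \<le> C + U / 2\<close>.
\<close>

lemma all_sq_int_right:
  assumes \<theta>: "sol z \<theta> \<theta>1" and \<phi>: "sol z \<phi> \<phi>1" and c: "c \<in> ein" and w: "\<theta> c * \<phi>1 c - \<theta>1 c * \<phi> c = 1"
    and i: "sq_int_right \<theta>" "sq_int_right \<phi>" and u: "sol z0 u u1"
  shows "sq_int_right u"
proof -
  note cont = sol_continuous(1)[OF \<theta>] sol_continuous(1)[OF \<phi>] sol_continuous(1)[OF u]
  define \<kappa> where "\<kappa> = cmod (z0 - z)"
  \<comment> \<open>This choice makes the coefficient \<open>8 (\<kappa> \<epsilon>)\<^sup>2\<close> of \<open>U\<close> below at most \<open>1 / 2\<close>.\<close>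
  define \<epsilon> where "\<epsilon> = 1 / (4 * (\<kappa> + 1))"
  have \<kappa>: "\<kappa> \<ge> 0" by (simp add: \<kappa>_def)
  have \<epsilon>: "\<epsilon> > 0" "\<kappa> * \<epsilon> \<le> 1 / 4" using \<kappa> by (auto simp: \<epsilon>_def field_simps)
  obtain d1 where d1: "d1 \<in> ein" "c \<le> d1" "\<And>x B. x \<in> ein \<Longrightarrow> d1 \<le> x \<Longrightarrow> B \<in> ein \<Longrightarrow> x \<le> B \<Longrightarrow> energy \<theta> x B \<le> \<epsilon>"
    using sq_int_right_tail[OF cont(1) i(1) c \<epsilon>(1)] by metis
  obtain d2 where d2: "d2 \<in> ein" "c \<le> d2" "\<And>x B. x \<in> ein \<Longrightarrow> d2 \<le> x \<Longrightarrow> B \<in> ein \<Longrightarrow> x \<le> B \<Longrightarrow> energy \<phi> x B \<le> \<epsilon>"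
    using sq_int_right_tail[OF cont(2) i(2) c \<epsilon>(1)] by metis
  define d where "d = max d1 d2"
  have d: "d \<in> ein" "d1 \<le> d" "d2 \<le> d" using d1 d2 by (auto simp: d_def max_def)
  define D where "D = max (cmod (u d * \<phi>1 d - u1 d * \<phi> d)) (cmod (u d * \<theta>1 d - u1 d * \<theta> d))"
  show ?thesis
  proof (rule sq_int_rightI[OF cont(3) d(1)])
    fix B assume B: "B \<in> ein" "d \<le> B"
    define U where "U = energy u d B"
    define Q where "Q = 2 * D\<^sup>2 + 2 * (\<kappa>\<^sup>2 * (U * \<epsilon>))"
    have U0: "U \<ge> 0" by (simp add: U_def energy_nonneg)
    have wron: "(cmod (u x * v1 x - u1 x * v x))\<^sup>2 \<le> Q"
      if v: "sol z v v1" "cmod (u d * v1 d - u1 d * v d) \<le> D" "energy v d x \<le> \<epsilon>" and x: "x \<in> ein" "d \<le> x" "x \<le> B"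
      for v v1 x
    proof -
      have "u x * v1 x - u1 x * v x = 1 * (u d * v1 d - u1 d * v d) + (z0 - z) * wip u v d x"
        using sol_lagrange_wip[OF u v(1) d(1) x(1,2)] by simp
      then have "(cmod (u x * v1 x - u1 x * v x))\<^sup>2 \<le> (2 * (cmod 1)\<^sup>2) * (cmod (u d * v1 d - u1 d * v d))\<^sup>2
           + (2 * (cmod (z0 - z))\<^sup>2) * (cmod (wip u v d x))\<^sup>2"
        by (simp only:) (rule norm_lincomb_square_le)
      moreover have "(cmod (wip u v d x))\<^sup>2 \<le> U * \<epsilon>"
      proof -
        have "(cmod (wip u v d x))\<^sup>2 \<le> energy u d x * energy v d x"
          by (intro wip_Cauchy_Schwarz sol_continuous(1)[OF u] sol_continuous(1)[OF v(1)] d(1) x(1))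
        also have "\<dots> \<le> U * \<epsilon>"
          unfolding U_def using v(3) x B d(1) energy_nonneg by (intro mult_mono energy_mono(1) cont) auto
        finally show ?thesis .
      qed
      then have "\<kappa>\<^sup>2 * (cmod (wip u v d x))\<^sup>2 \<le> \<kappa>\<^sup>2 * (U * \<epsilon>)" by (rule mult_left_mono) simp
      moreover have "(cmod (u d * v1 d - u1 d * v d))\<^sup>2 \<le> D\<^sup>2" using v(2) by (intro power_mono) auto
      ultimately show ?thesis by (simp add: Q_def \<kappa>_def)
    qed
    have Q0: "Q \<ge> 0" unfolding Q_def using U0 \<epsilon> by simp
    have "U \<le> (2 * Q) * energy \<theta> d B + (2 * Q) * energy \<phi> d B"
      unfolding U_def
    proof (rule energy_le_lincomb[OF cont d(1) B(1)])
      fix x assume x: "x \<in> {d..B}"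
      have xe: "x \<in> ein" using mem_einterval_between[OF d(1) B(1)] x by auto
      have W: "\<theta> x * \<phi>1 x - \<theta>1 x * \<phi> x = 1" using sol_wronskian_const[OF \<theta> \<phi> c xe] w by simp
      have e: "energy \<theta> d x \<le> \<epsilon>" "energy \<phi> d x \<le> \<epsilon>" using d1(3)[OF d(1,2) xe] d2(3)[OF d(1,3) xe] x by auto
      have q: "(cmod (u x * \<phi>1 x - u1 x * \<phi> x))\<^sup>2 \<le> Q" "(cmod (u x * \<theta>1 x - u1 x * \<theta> x))\<^sup>2 \<le> Q"
        using wron[OF \<phi> _ e(2) xe] wron[OF \<theta> _ e(1) xe] x by (auto simp: D_def)
      have "u x = u x * (\<theta> x * \<phi>1 x - \<theta>1 x * \<phi> x)" using W by simp
      also have "\<dots> = (u x * \<phi>1 x - u1 x * \<phi> x) * \<theta> x + (- (u x * \<theta>1 x - u1 x * \<theta> x)) * \<phi> x"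
        by (simp add: algebra_simps)
      finally have "u x = (u x * \<phi>1 x - u1 x * \<phi> x) * \<theta> x + (- (u x * \<theta>1 x - u1 x * \<theta> x)) * \<phi> x" .
      then have "(cmod (u x))\<^sup>2 \<le> (2 * (cmod (u x * \<phi>1 x - u1 x * \<phi> x))\<^sup>2) * (cmod (\<theta> x))\<^sup>2
          + (2 * (cmod (- (u x * \<theta>1 x - u1 x * \<theta> x)))\<^sup>2) * (cmod (\<phi> x))\<^sup>2"
        by (metis norm_lincomb_square_le)
      also have "\<dots> \<le> (2 * Q) * (cmod (\<theta> x))\<^sup>2 + (2 * Q) * (cmod (\<phi> x))\<^sup>2"
        unfolding norm_minus_cancel using q by (intro add_mono mult_right_mono) auto
      finally show "(cmod (u x))\<^sup>2 \<le> (2 * Q) * (cmod (\<theta> x))\<^sup>2 + (2 * Q) * (cmod (\<phi> x))\<^sup>2" .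
    qed
    also have "\<dots> \<le> (2 * Q) * \<epsilon> + (2 * Q) * \<epsilon>"
      using d1(3)[OF d(1,2) B] d2(3)[OF d(1,3) B] Q0 by (intro add_mono mult_left_mono) auto
    also have "\<dots> = 8 * D\<^sup>2 * \<epsilon> + 8 * (\<kappa> * \<epsilon>)\<^sup>2 * U" by (simp add: Q_def power2_eq_square algebra_simps)
    also have "\<dots> \<le> 8 * D\<^sup>2 * \<epsilon> + 8 * (1 / 4)\<^sup>2 * U"
      using \<epsilon> \<kappa> U0 by (intro add_left_mono mult_right_mono mult_left_mono power_mono) auto
    finally show "energy u d B \<le> 16 * D\<^sup>2 * \<epsilon>" unfolding U_def[symmetric] by (simp add: power2_eq_square)
  qed
qed

end

section \<open>Weyl disks\<close>

context sturm_liouville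
begin

text \<open>
  A fundamental system of \<open>\<tau>u = zu\<close>, normalised at \<open>c\<close> by real initial values.
\<close>

definition fundamental :: "real \<Rightarrow> complex \<Rightarrow> cfun \<Rightarrow> cfun \<Rightarrow> cfun \<Rightarrow> cfun \<Rightarrow> bool" where
  "fundamental c z \<theta> \<theta>1 \<phi> \<phi>1 \<longleftrightarrow> c \<in> ein \<and> sol z \<theta> \<theta>1 \<and> sol z \<phi> \<phi>1 \<and>
     \<theta> c = 1 \<and> \<theta>1 c = 0 \<and> \<phi> c = 0 \<and> \<phi>1 c = 1"

lemma fundamental_exists:
  assumes "c \<in> ein"
  obtains \<theta> \<theta>1 \<phi> \<phi>1 where "fundamental c z \<theta> \<theta>1 \<phi> \<phi>1"
  using sol_exists[OF assms, of z 1 0] sol_exists[OF assms, of z 0 1] assms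
  unfolding fundamental_def by metis

lemma einterval_above:
  assumes "c \<in> ein"
  obtains d where "d \<in> ein" "c < d"
  using einterval_neighbourhood[OF assms] by metis

context
  fixes c z \<theta> \<theta>1 \<phi> \<phi>1
  assumes F: "fundamental c z \<theta> \<theta>1 \<phi> \<phi>1" and z: "Im z \<noteq> 0"
begin

lemma fund: "c \<in> ein" "sol z \<theta> \<theta>1" "sol z \<phi> \<phi>1" "\<theta> c = 1" "\<theta>1 c = 0" "\<phi> c = 0" "\<phi>1 c = 1"
  using F by (auto simp: fundamental_def)

lemma fund_wronskian: "x \<in> ein \<Longrightarrow> \<theta> x * \<phi>1 x - \<theta>1 x * \<phi> x = 1"
  using sol_wronskian_const[OF fund(2,3,1)] fund by simp

text \<open>
  The solution with initial values \<open>1\<close>, \<open>m\<close> at \<open>c\<close>, and its quasi-derivative.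
\<close>

definition "psi_m m = (\<lambda>x. \<theta> x + m * \<phi> x)"
definition "psi_m1 m = (\<lambda>x. \<theta>1 x + m * \<phi>1 x)"

lemma psi_m_sol: "sol z (psi_m m) (psi_m1 m)"
  using sol_lincomb[OF fund(2,3), of 1 m] by (simp add: psi_m_def[abs_def] psi_m1_def[abs_def])

lemma phi_energy_pos:
  assumes B: "B \<in> ein" "c < B"
  shows "energy \<phi> c B > 0"
proof -
  have "energy \<phi> c B \<noteq> 0"
  proof
    assume e: "energy \<phi> c B = 0"
    have z: "\<phi> t = 0" if "t \<in> {c<..<B}" for t
      using energy_zero_imp_zero[OF sol_continuous(1)[OF fund(3)] fund(1) B e that] .
    define t where "t = (c + B) / 2"
    have t: "t \<in> {c<..<B}" using B(2) by (simp add: t_def)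
    have "\<phi>1 t = 0" using sys_zero_imp_quasi_deriv_zero[OF fund(3)[unfolded sol_def] fund(1) B(1) z t] .
    moreover have "t \<in> ein" using mem_einterval_between[OF fund(1) B(1), of t] t by auto
    ultimately show False using fund_wronskian[of t] z[OF t] by simp
  qed
  then show ?thesis using energy_nonneg[of \<phi> c B] by simp
qed

lemma phi_nonzero:
  assumes B: "B \<in> ein" "c < B"
  shows "\<phi> B \<noteq> 0"
  using sol_green[OF fund(3,1) B(1)] phi_energy_pos[OF B] B(2) fund(6) z by auto

text \<open>
  The parameter for which \<open>psi_m\<close> vanishes at \<open>B\<close>.
\<close>

definition "m_dirichlet B = - \<theta> B / \<phi> B"

lemma psi_m_dirichlet: "B \<in> ein \<Longrightarrow> c < B \<Longrightarrow> psi_m (m_dirichlet B) B = 0"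
  using phi_nonzero[of B] by (simp add: psi_m_def m_dirichlet_def)

text \<open>
  Weyl's disk of the point \<open>B\<close>. By Green's formula it consists of the \<open>m\<close> for which
  the squared norm of \<open>\<theta> + m\<phi>\<close> on \<open>[c, B]\<close> is at most \<open>Im m / Im
  z\<close> (\<open>weyl_disk_iff\<close>), so the disks decrease with \<open>B\<close>. The product with
  \<open>Im z\<close> covers both half planes.
\<close>

definition weyl_disk :: "real \<Rightarrow> complex set" where
  "weyl_disk B = {m. Im z * Im (cnj (psi_m m B) * psi_m1 m B) \<ge> 0}"

lemma weyl_disk_iff:
  assumes B: "B \<in> ein" "c \<le> B"
  shows "m \<in> weyl_disk B \<longleftrightarrow> (Im z)\<^sup>2 * energy (psi_m m) c B \<le> Im z * Im m"
proof -
  have "Im (cnj (psi_m m c) * psi_m1 m c) = Im m"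
    by (simp add: psi_m_def psi_m1_def fund)
  then have "Im (cnj (psi_m m B) * psi_m1 m B) = Im m - Im z * energy (psi_m m) c B"
    using sol_green[OF psi_m_sol[of m] fund(1) B] by (simp only:)
  then show ?thesis
    unfolding weyl_disk_def mem_Collect_eq by (simp only: power2_eq_square right_diff_distrib mult.assoc) simp
qed

lemma weyl_disk_mono:
  assumes B: "B \<in> ein" "c \<le> B" "B' \<in> ein" "B \<le> B'" and m: "m \<in> weyl_disk B'"
  shows "m \<in> weyl_disk B"
proof -
  have "(Im z)\<^sup>2 * energy (psi_m m) c B \<le> (Im z)\<^sup>2 * energy (psi_m m) c B'"
    by (intro mult_left_mono energy_mono(1) sol_continuous[OF psi_m_sol] fund(1) B) auto
  then show ?thesis using m B by (simp add: weyl_disk_iff)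
qed

lemma m_dirichlet_in_disk: "B \<in> ein \<Longrightarrow> c < B \<Longrightarrow> m_dirichlet B \<in> weyl_disk B"
  by (simp add: weyl_disk_def psi_m_dirichlet)

text \<open>
  Expanding Green's formula around the Dirichlet parameter, where \<open>\<theta> + m\<phi>\<close> vanishes at
  \<open>B\<close>, leaves a linear term in the difference \<open>k\<close> of the parameters, of modulus at
  most \<open>cmod k\<close> because the Wronskian is \<open>1\<close>, and a quadratic term with the norm of
  \<open>\<phi>\<close>; the quadratic term has the unfavourable sign.
\<close>

lemma weyl_disk_diameter:
  assumes B: "B \<in> ein" "c < B" and m: "m \<in> weyl_disk B"
  shows "cmod (m - m_dirichlet B) * (\<bar>Im z\<bar> * energy \<phi> c B) \<le> 1"
proof -
  define k where "k = m - m_dirichlet B"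
  define v v1 where "v = psi_m (m_dirichlet B)" and "v1 = psi_m1 (m_dirichlet B)"
  have w: "psi_m m B = k * \<phi> B" "psi_m1 m B = v1 B + k * \<phi>1 B"
    using psi_m_dirichlet[OF B] by (auto simp: k_def v1_def psi_m_def psi_m1_def algebra_simps)
  have "v B * \<phi>1 B - v1 B * \<phi> B = 1"
    using fund_wronskian[OF B(1)] by (simp add: v_def v1_def psi_m_def psi_m1_def algebra_simps)
  then have vB: "v1 B * \<phi> B = -1" using psi_m_dirichlet[OF B] by (simp add: v_def minus_equation_iff)
  have "cmod (cnj (\<phi> B) * v1 B) = cmod (v1 B * \<phi> B)" by (simp add: norm_mult)
  then have n1: "cmod (cnj (\<phi> B) * v1 B) = 1" by (simp add: vB)
  have G: "Im (cnj (\<phi> B) * \<phi>1 B) = - Im z * energy \<phi> c B"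
    using sol_green[OF fund(3,1) B(1)] B(2) fund by simp
  have "cnj (psi_m m B) * psi_m1 m B
     = cnj k * (cnj (\<phi> B) * v1 B) + complex_of_real ((cmod k)\<^sup>2) * (cnj (\<phi> B) * \<phi>1 B)"
    unfolding w complex_norm_square by (simp add: algebra_simps)
  then have "Im (cnj (psi_m m B) * psi_m1 m B)
     = Im (cnj k * (cnj (\<phi> B) * v1 B)) + (cmod k)\<^sup>2 * Im (cnj (\<phi> B) * \<phi>1 B)"
    by (simp only: plus_complex.sel Im_complex_of_real times_complex.sel Re_complex_of_real)
  then have "0 \<le> Im z * Im (cnj k * (cnj (\<phi> B) * v1 B)) - (cmod k)\<^sup>2 * ((Im z)\<^sup>2 * energy \<phi> c B)"
  proof -
    have alg: "0 \<le> y * I - K * (y\<^sup>2 * E)" if "S = I + K * (- y * E)" "0 \<le> y * S" for S I K y E :: real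
      using that(2) unfolding that(1) by (simp add: power2_eq_square algebra_simps)
    show ?thesis
      by (rule alg[OF \<open>Im (cnj (psi_m m B) * psi_m1 m B) = _\<close>[unfolded G]])
        (use m in \<open>simp only: weyl_disk_def mem_Collect_eq\<close>)
  qed
  also have "Im z * Im (cnj k * (cnj (\<phi> B) * v1 B)) \<le> \<bar>Im z\<bar> * cmod k"
  proof -
    have "\<bar>Im (cnj k * (cnj (\<phi> B) * v1 B))\<bar> \<le> cmod k * 1"
      using abs_Im_le_cmod[of "cnj k * (cnj (\<phi> B) * v1 B)"] unfolding norm_mult[of "cnj k"] n1 by simp
    then have "\<bar>Im z\<bar> * \<bar>Im (cnj k * (cnj (\<phi> B) * v1 B))\<bar> \<le> \<bar>Im z\<bar> * cmod k"
      by (intro mult_left_mono) auto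
    then show ?thesis unfolding abs_mult[symmetric] by linarith
  qed
  finally have "(cmod k)\<^sup>2 * (\<bar>Im z\<bar>\<^sup>2 * energy \<phi> c B) \<le> \<bar>Im z\<bar> * cmod k" by simp
  then have "(\<bar>Im z\<bar> * cmod k) * (cmod k * (\<bar>Im z\<bar> * energy \<phi> c B)) \<le> (\<bar>Im z\<bar> * cmod k) * 1"
    unfolding power2_eq_square by (simp only: mult_ac mult_1_right)
  then show ?thesis
    unfolding k_def[symmetric] using z by (cases "k = 0") (auto simp: mult_le_cancel_left_pos)
qed

text \<open>
  A limit of Dirichlet parameters along a sequence tending to \<open>b\<close> lies in all disks.
\<close>

lemma weyl_point_exists:
  obtains m where "\<And>B. B \<in> ein \<Longrightarrow> c < B \<Longrightarrow> m \<in> weyl_disk B"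
proof -
  have cb: "ereal c < b" using fund(1) by (simp add: einterval_iff)
  obtain X where X: "incseq X" "\<And>i. ereal c < ereal (X i)" "\<And>i. ereal (X i) < b" "(\<lambda>i. ereal (X i)) \<longlonglongrightarrow> b"
    using ereal_incseq_approx[OF cb] by metis
  have Xe: "X i \<in> ein" "c < X i" for i
    using X(2,3)[of i] fund(1) by (auto simp: einterval_iff elim: less_trans)
  define M where "M = (\<lambda>n. m_dirichlet (X n))"
  have Min: "M n \<in> weyl_disk (X k)" if "k \<le> n" for k n
    unfolding M_def using Xe incseqD[OF X(1) that] less_imp_le[OF Xe(2)]
    by (intro weyl_disk_mono[OF _ _ _ _ m_dirichlet_in_disk]) auto
  define R where "R = 1 / (\<bar>Im z\<bar> * energy \<phi> c (X 0))"
  have pos: "\<bar>Im z\<bar> * energy \<phi> c (X 0) > 0" using z phi_energy_pos[OF Xe] by simp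
  have "M n \<in> cball (M 0) R" for n
    using weyl_disk_diameter[OF Xe Min[of 0 n]] pos
    by (simp add: M_def R_def dist_norm norm_minus_commute field_simps)
  then have "bounded (range M)" by (intro bounded_subset[OF bounded_cball]) auto
  then obtain m s where ms: "strict_mono (s::nat \<Rightarrow> nat)" "(M \<circ> s) \<longlonglongrightarrow> m"
    using bounded_imp_convergent_subsequence by blast
  show thesis
  proof (rule that)
    fix B assume B: "B \<in> ein" "c < B"
    have "\<forall>\<^sub>F i in sequentially. ereal B < ereal (X i)"
      using X(4) B(1) by (intro order_tendstoD) (auto simp: einterval_iff)
    then obtain k where k: "B < X k" by (auto simp: eventually_sequentially)
    have "m \<in> weyl_disk (X k)"
    proof -
      have "(\<lambda>n. Im z * Im (cnj (psi_m ((M \<circ> s) n) (X k)) * psi_m1 ((M \<circ> s) n) (X k)))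
        \<longlonglongrightarrow> Im z * Im (cnj (psi_m m (X k)) * psi_m1 m (X k))"
        unfolding psi_m_def psi_m1_def by (intro tendsto_intros ms(2))
      moreover have "\<forall>\<^sub>F n in sequentially. 0 \<le> Im z * Im (cnj (psi_m ((M \<circ> s) n) (X k)) * psi_m1 ((M \<circ> s) n) (X k))"
      proof (rule eventually_sequentiallyI[of k])
        fix n assume "k \<le> n"
        then have "k \<le> s n" using seq_suble[OF ms(1), of n] by simp
        then show "0 \<le> Im z * Im (cnj (psi_m ((M \<circ> s) n) (X k)) * psi_m1 ((M \<circ> s) n) (X k))"
          using Min[of k "s n"] by (simp add: weyl_disk_def)
      qed
      ultimately show ?thesis unfolding weyl_disk_def
        using tendsto_lowerbound[OF _ _ sequentially_bot] by blast
    qed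
    then show "m \<in> weyl_disk B" using B k Xe by (intro weyl_disk_mono[of B "X k" m]) auto
  qed
qed

lemma weyl_point_energy:
  assumes m: "\<And>B. B \<in> ein \<Longrightarrow> c < B \<Longrightarrow> m \<in> weyl_disk B" and B: "B \<in> ein" "c \<le> B"
  shows "energy (psi_m m) c B \<le> Im m / Im z"
proof -
  obtain d where d: "d \<in> ein" "c < d" using einterval_above[OF fund(1)] by blast
  define e where "e = max B d"
  have e: "e \<in> ein" "c < e" "B \<le> e" using B d by (auto simp: e_def max_def)
  have "(Im z)\<^sup>2 * energy (psi_m m) c e \<le> Im z * Im m"
    using m[OF e(1,2)] weyl_disk_iff[OF e(1)] e(2) by auto
  also have "Im z * Im m = (Im z)\<^sup>2 * (Im m / Im z)" using z by (simp add: power2_eq_square)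
  finally have "energy (psi_m m) c e \<le> Im m / Im z" by (rule mult_left_le_imp_le) (use z in simp)
  moreover have "energy (psi_m m) c B \<le> energy (psi_m m) c e"
    by (intro energy_mono(1) sol_continuous[OF psi_m_sol] fund(1) e B)
  ultimately show ?thesis by simp
qed

context
  assumes lp: "\<exists>z0 u0 u1. sol z0 u0 u1 \<and> \<not> sq_int_right u0"
begin

lemma weyl_phi_not_sq_int:
  assumes i: "sq_int_right (psi_m m)"
  shows "\<not> sq_int_right \<phi>"
proof
  assume p: "sq_int_right \<phi>"
  have "sq_int_right (\<lambda>t. 1 * psi_m m t + (- m) * \<phi> t)"
    by (rule sq_int_right_lincomb[OF sol_continuous(1)[OF psi_m_sol] sol_continuous(1)[OF fund(3)] i p])
  then have t: "sq_int_right \<theta>" by (simp add: psi_m_def[abs_def])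
  have "\<theta> c * \<phi>1 c - \<theta>1 c * \<phi> c = 1" using fund by simp
  then show False using all_sq_int_right[OF fund(2,3,1) _ t p] lp by blast
qed

lemma weyl_phi_energy_unbounded:
  assumes i: "sq_int_right (psi_m m)"
  obtains B0 where "B0 \<in> ein" "c < B0" "\<And>B. B \<in> ein \<Longrightarrow> B0 \<le> B \<Longrightarrow> energy \<phi> c B \<ge> R"
proof -
  note cont = sol_continuous(1)[OF fund(3)]
  have "\<not> (\<forall>B\<in>ein. c \<le> B \<longrightarrow> energy \<phi> c B \<le> R)"
    using weyl_phi_not_sq_int[OF i] sq_int_rightI[OF cont fund(1), of R] by blast
  then obtain B1 where B1: "B1 \<in> ein" "c \<le> B1" "energy \<phi> c B1 > R" by (auto simp: not_le)
  obtain d where d: "d \<in> ein" "c < d" using einterval_above[OF fund(1)] by blast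
  show thesis
  proof (rule that[of "max B1 d"])
    show "max B1 d \<in> ein" "c < max B1 d" using B1 d by (auto simp: max_def)
    fix B assume B: "B \<in> ein" "max B1 d \<le> B"
    have "energy \<phi> c B1 \<le> energy \<phi> c B" using B B1 by (intro energy_mono(1) cont fund(1)) auto
    then show "energy \<phi> c B \<ge> R" using B1(3) by simp
  qed
qed

text \<open>
  In the limit point case the distance of the limit point to the Dirichlet parameter tends to \<open>0\<close>,
  even after multiplication with the norm of \<open>\<phi>\<close> on \<open>[c, B]\<close>.
\<close>

lemma weyl_point_approx:
  assumes m: "\<And>B. B \<in> ein \<Longrightarrow> c < B \<Longrightarrow> m \<in> weyl_disk B" and "\<delta> > 0"
  obtains B0 where "B0 \<in> ein" "c < B0"
    "\<And>B. B \<in> ein \<Longrightarrow> B0 \<le> B \<Longrightarrow> cmod (m - m_dirichlet B) \<le> \<delta> \<and> (cmod (m - m_dirichlet B))\<^sup>2 * energy \<phi> c B \<le> \<delta>\<^sup>2"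
proof -
  have i: "sq_int_right (psi_m m)"
    by (rule sq_int_rightI[OF sol_continuous(1)[OF psi_m_sol] fund(1) weyl_point_energy[OF m]])
  define R where "R = max (1 / (\<bar>Im z\<bar> * \<delta>)) (1 / (\<bar>Im z\<bar> * \<delta>)\<^sup>2)"
  obtain B0 where B0: "B0 \<in> ein" "c < B0" "\<And>B. B \<in> ein \<Longrightarrow> B0 \<le> B \<Longrightarrow> energy \<phi> c B \<ge> R"
    using weyl_phi_energy_unbounded[OF i] by metis
  show thesis
  proof (rule that[OF B0(1,2)])
    fix B assume B: "B \<in> ein" "B0 \<le> B"
    define E where "E = energy \<phi> c B"
    define k where "k = cmod (m - m_dirichlet B)"
    define y where "y = \<bar>Im z\<bar>"
    have cB: "c < B" using B B0 by simp
    have kE: "k * (y * E) \<le> 1" using weyl_disk_diameter[OF B(1) cB m[OF B(1) cB]] by (simp add: k_def y_def E_def)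
    have y: "y > 0" using z by (simp add: y_def)
    have E: "E > 0" "1 / (y * \<delta>) \<le> E" "1 / (y * \<delta>)\<^sup>2 \<le> E"
      using phi_energy_pos[OF B(1) cB] B0(3)[OF B] by (auto simp: E_def R_def y_def)
    have k0: "k \<ge> 0" by (simp add: k_def)
    have "k * (y * (1 / (y * \<delta>))) \<le> k * (y * E)" using E y k0 by (intro mult_left_mono) auto
    also have "k * (y * (1 / (y * \<delta>))) = k / \<delta>" using y by simp
    finally have "k / \<delta> \<le> 1" using kE by simp
    then have "k \<le> \<delta>" using \<open>\<delta> > 0\<close> by simp
    moreover have "k\<^sup>2 * E \<le> \<delta>\<^sup>2"
    proof -
      have "(k * (y * E))\<^sup>2 \<le> 1" using kE k0 y E(1) by (intro power_le_one) auto
      moreover have "k\<^sup>2 * E * y\<^sup>2 * (1 / (y * \<delta>)\<^sup>2) \<le> k\<^sup>2 * E * y\<^sup>2 * E"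
        using E by (intro mult_left_mono) auto
      ultimately have "k\<^sup>2 * E * y\<^sup>2 * (1 / (y * \<delta>)\<^sup>2) \<le> 1" by (simp add: power2_eq_square mult_ac)
      then show ?thesis using y \<open>\<delta> > 0\<close> by (simp add: power_mult_distrib field_simps)
    qed
    ultimately show "cmod (m - m_dirichlet B) \<le> \<delta> \<and> (cmod (m - m_dirichlet B))\<^sup>2 * energy \<phi> c B \<le> \<delta>\<^sup>2"
      by (simp add: k_def E_def)
  qed
qed

lemma sq_int_sol_multiple:
  assumes i: "sq_int_right (psi_m m)" and u: "sol z u u1" "sq_int_right u" and x: "x \<in> ein"
  shows "u x = u c * psi_m m x" "u1 x = u c * psi_m1 m x"
proof -
  define \<beta> where "\<beta> = u1 c - m * u c"
  have rep: "u x = u c * \<theta> x + u1 c * \<phi> x" if "x \<in> ein" for x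
    using sol_representation[OF u(1) fund(2,3,1) _ that] fund by simp
  have \<phi>: "\<beta> * \<phi> x = 1 * u x + (- u c) * psi_m m x" if "x \<in> ein" for x
    using rep[OF that] by (simp add: \<beta>_def psi_m_def algebra_simps)
  have "\<beta> = 0"
  proof (rule ccontr)
    assume nz: "\<beta> \<noteq> 0"
    have *: "sq_int_right (\<lambda>t. 1 * u t + (- u c) * psi_m m t)"
      by (rule sq_int_right_lincomb[OF sol_continuous(1)[OF u(1)] sol_continuous(1)[OF psi_m_sol] u(2) i])
    obtain K where K: "\<And>B. B \<in> ein \<Longrightarrow> c \<le> B \<Longrightarrow> energy (\<lambda>t. 1 * u t + (- u c) * psi_m m t) c B \<le> K"
      using sq_int_rightD[OF * fund(1)] by metis
    have "energy \<phi> c B \<le> K / (cmod \<beta>)\<^sup>2" if B: "B \<in> ein" "c \<le> B" for B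
    proof -
      have "energy (\<lambda>t. 1 * u t + (- u c) * psi_m m t) c B = energy (\<lambda>t. \<beta> * \<phi> t) c B"
        unfolding energy_def
      proof (rule Henstock_Kurzweil_Integration.integral_cong)
        fix t assume "t \<in> {c..B}"
        then have "t \<in> ein" using mem_einterval_between[OF fund(1) B(1)] by auto
        then show "\<rho> t * (cmod (1 * u t + (- u c) * psi_m m t))\<^sup>2 = \<rho> t * (cmod (\<beta> * \<phi> t))\<^sup>2"
          by (simp only: \<phi>)
      qed
      then have "(cmod \<beta>)\<^sup>2 * energy \<phi> c B \<le> K" using K[OF B] energy_cmult[of \<beta> \<phi> c B] by simp
      then show ?thesis using nz by (simp add: field_simps)
    qed
    then have "sq_int_right \<phi>" using sq_int_rightI[OF sol_continuous(1)[OF fund(3)] fund(1)] by blast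
    then show False using weyl_phi_not_sq_int[OF i] by blast
  qed
  have eq: "u t = u c * psi_m m t" if "t \<in> ein" for t using \<phi>[OF that] \<open>\<beta> = 0\<close> by simp
  show "u x = u c * psi_m m x" by (rule eq[OF x])
  have s: "sol z (\<lambda>t. 1 * u t + (- u c) * psi_m m t) (\<lambda>t. 1 * u1 t + (- u c) * psi_m1 m t)"
    by (rule sol_lincomb[OF u(1) psi_m_sol])
  obtain l h where lh: "l \<in> ein" "h \<in> ein" "l < x" "x < h" using einterval_neighbourhood[OF x] by metis
  have "1 * u1 x + (- u c) * psi_m1 m x = 0"
  proof (rule sys_zero_imp_quasi_deriv_zero[OF s[unfolded sol_def] lh(1,2)])
    fix t assume "t \<in> {l<..<h}"
    then have "t \<in> ein" using mem_einterval_between[OF lh(1,2)] by auto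
    then show "1 * u t + (- u c) * psi_m m t = 0" using eq by simp
  qed (use lh in auto)
  then show "u1 x = u c * psi_m1 m x" by simp
qed

end

end

text \<open>
  The Wronskian of two Weyl solutions tends to \<open>0\<close> at \<open>b\<close>. Evaluate Lagrange's
  identity on \<open>[c, B]\<close> for them and for the solutions that vanish at \<open>B\<close>, whose
  Wronskian at \<open>B\<close> is \<open>0\<close>; the difference of the two is controlled by
  \<open>weyl_point_approx\<close>.
\<close>

lemma weyl_wronskian_limit:
  assumes lp: "\<exists>z0 u0 u1. sol z0 u0 u1 \<and> \<not> sq_int_right u0"
    and z: "Im z1 \<noteq> 0" "Im z2 \<noteq> 0" and F1: "fundamental c z1 \<theta>1 \<theta>1' \<phi>1 \<phi>1'"
    and F2: "fundamental c z2 \<theta>2 \<theta>2' \<phi>2 \<phi>2'"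
    and m1: "\<And>B. B \<in> ein \<Longrightarrow> c < B \<Longrightarrow> m1 \<in> weyl_disk z1 \<theta>1 \<theta>1' \<phi>1 \<phi>1' B"
    and m2: "\<And>B. B \<in> ein \<Longrightarrow> c < B \<Longrightarrow> m2 \<in> weyl_disk z2 \<theta>2 \<theta>2' \<phi>2 \<phi>2' B"
    and "\<epsilon> > 0"
  obtains B0 where "B0 \<in> ein" "\<And>B. B \<in> ein \<Longrightarrow> B0 \<le> B \<Longrightarrow>
     cmod (psi_m \<theta>1 \<phi>1 m1 B * psi_m1 \<theta>2' \<phi>2' m2 B - psi_m1 \<theta>1' \<phi>1' m1 B * psi_m \<theta>2 \<phi>2 m2 B) \<le> \<epsilon>"
proof -
  note f1 = fund[OF F1 z(1)] and f2 = fund[OF F2 z(2)]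
  note s1 = psi_m_sol[OF F1 z(1)] and s2 = psi_m_sol[OF F2 z(2)]
  define \<psi>1 \<psi>1' \<psi>2 \<psi>2' where "\<psi>1 = psi_m \<theta>1 \<phi>1 m1" and "\<psi>1' = psi_m1 \<theta>1' \<phi>1' m1"
    and "\<psi>2 = psi_m \<theta>2 \<phi>2 m2" and "\<psi>2' = psi_m1 \<theta>2' \<phi>2' m2"
  note \<psi>s = \<psi>1_def \<psi>1'_def \<psi>2_def \<psi>2'_def
  have i1: "sq_int_right \<psi>1" unfolding \<psi>s
    by (rule sq_int_rightI[OF sol_continuous(1)[OF s1] f1(1) weyl_point_energy[OF F1 z(1) m1]])
  have i2: "sq_int_right \<psi>2" unfolding \<psi>s
    by (rule sq_int_rightI[OF sol_continuous(1)[OF s2] f2(1) weyl_point_energy[OF F2 z(2) m2]])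
  note c\<psi> = sol_continuous(1)[OF s1[of m1], folded \<psi>s] sol_continuous(1)[OF s2[of m2], folded \<psi>s]
  note c\<phi> = sol_continuous(1)[OF f1(3)] sol_continuous(1)[OF f2(3)]
  obtain K1 where K1: "K1 \<ge> 0" "\<And>B. B \<in> ein \<Longrightarrow> c \<le> B \<Longrightarrow> energy \<psi>1 c B \<le> K1"
    using sq_int_rightD[OF i1 f1(1)] by metis
  obtain K2 where K2: "K2 \<ge> 0" "\<And>B. B \<in> ein \<Longrightarrow> c \<le> B \<Longrightarrow> energy \<psi>2 c B \<le> K2"
    using sq_int_rightD[OF i2 f2(1)] by metis
  define L where "L = 2 + cmod (z1 - z2) * (sqrt K1 + sqrt K2 + 1)"
  have L: "L > 0" unfolding L_def using K1(1) K2(1) by (intro add_pos_nonneg) auto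
  define \<delta> where "\<delta> = min 1 (\<epsilon> / L)"
  have \<delta>: "\<delta> > 0" "\<delta> \<le> 1" "\<delta> * L \<le> \<epsilon>" using L \<open>\<epsilon> > 0\<close> by (auto simp: \<delta>_def min_def field_simps)
  obtain B1 where B1: "B1 \<in> ein" "c < B1" "\<And>B. B \<in> ein \<Longrightarrow> B1 \<le> B \<Longrightarrow> cmod (m1 - m_dirichlet \<theta>1 \<phi>1 B) \<le> \<delta> \<and>
     (cmod (m1 - m_dirichlet \<theta>1 \<phi>1 B))\<^sup>2 * energy \<phi>1 c B \<le> \<delta>\<^sup>2"
    using weyl_point_approx[OF F1 z(1) lp m1 \<delta>(1)] by metis
  obtain B2 where B2: "B2 \<in> ein" "c < B2" "\<And>B. B \<in> ein \<Longrightarrow> B2 \<le> B \<Longrightarrow> cmod (m2 - m_dirichlet \<theta>2 \<phi>2 B) \<le> \<delta> \<and>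
     (cmod (m2 - m_dirichlet \<theta>2 \<phi>2 B))\<^sup>2 * energy \<phi>2 c B \<le> \<delta>\<^sup>2"
    using weyl_point_approx[OF F2 z(2) lp m2 \<delta>(1)] by metis
  show thesis
  proof (rule that[of "max B1 B2"])
    show "max B1 B2 \<in> ein" using B1 B2 by (auto simp: max_def)
    fix B assume B: "B \<in> ein" "max B1 B2 \<le> B"
    have cB: "c < B" "c \<le> B" using B B1 by auto
    define n1 n2 where "n1 = m_dirichlet \<theta>1 \<phi>1 B" and "n2 = m_dirichlet \<theta>2 \<phi>2 B"
    define k1 k2 where "k1 = m1 - n1" and "k2 = m2 - n2"
    have k: "cmod k1 \<le> \<delta>" "(cmod k1)\<^sup>2 * energy \<phi>1 c B \<le> \<delta>\<^sup>2" "cmod k2 \<le> \<delta>" "(cmod k2)\<^sup>2 * energy \<phi>2 c B \<le> \<delta>\<^sup>2"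
      using B1(3)[OF B(1)] B2(3)[OF B(1)] B(2) by (auto simp: k1_def k2_def n1_def n2_def)
    have bound: "cmod (\<kappa> * wip f g c B) \<le> sqrt K * \<delta>"
      if c: "continuous_on ein f" "continuous_on ein g" and "K \<ge> 0" and e: "energy f c B \<le> K"
        and g: "(cmod \<kappa>)\<^sup>2 * energy g c B \<le> \<delta>\<^sup>2" for f g \<kappa> K
    proof -
      have "(cmod (\<kappa> * wip f g c B))\<^sup>2 \<le> (cmod \<kappa>)\<^sup>2 * (energy f c B * energy g c B)"
        unfolding norm_mult power_mult_distrib by (intro mult_left_mono wip_Cauchy_Schwarz c f1(1) B(1)) auto
      also have "\<dots> = energy f c B * ((cmod \<kappa>)\<^sup>2 * energy g c B)" by simp
      also have "\<dots> \<le> K * \<delta>\<^sup>2" using e g \<open>K \<ge> 0\<close> energy_nonneg by (intro mult_mono) auto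
      also have "\<dots> = (sqrt K * \<delta>)\<^sup>2" using \<open>K \<ge> 0\<close> by (simp add: power_mult_distrib)
      finally have sq: "(cmod (\<kappa> * wip f g c B))\<^sup>2 \<le> (sqrt K * \<delta>)\<^sup>2" .
      have "0 \<le> sqrt K * \<delta>" using \<open>K \<ge> 0\<close> \<delta>(1) by simp
      with sq show ?thesis by (rule power2_le_imp_le)
    qed
    have b1: "cmod (k2 * wip \<psi>1 \<phi>2 c B) \<le> sqrt K1 * \<delta>"
      using K1 B(1) cB k by (intro bound c\<psi> c\<phi>) auto
    have b2: "cmod (k1 * wip \<psi>2 \<phi>1 c B) \<le> sqrt K2 * \<delta>"
      using K2 B(1) cB k by (intro bound c\<psi> c\<phi>) auto
    have b3: "cmod (k1 * k2 * wip \<phi>1 \<phi>2 c B) \<le> \<delta>"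
    proof -
      have e: "energy (\<lambda>t. k1 * \<phi>1 t) c B \<le> 1"
        using k(2) power_le_one[of \<delta> 2] \<delta> unfolding energy_cmult by linarith
      have "cmod (k2 * wip (\<lambda>t. k1 * \<phi>1 t) \<phi>2 c B) \<le> sqrt 1 * \<delta>"
        using e k by (intro bound continuous_intros c\<phi>) auto
      moreover have "wip (\<lambda>t. k1 * \<phi>1 t) \<phi>2 c B = k1 * wip \<phi>1 \<phi>2 c B"
      proof -
        have "((\<lambda>t. k1 * (complex_of_real (\<rho> t) * (\<phi>1 t * \<phi>2 t))) has_integral k1 * wip \<phi>1 \<phi>2 c B) {c..B}"
          by (intro has_integral_mult_right wip_has_integral c\<phi> f1(1) B(1))
        moreover have "(\<lambda>t. complex_of_real (\<rho> t) * (k1 * \<phi>1 t * \<phi>2 t)) = (\<lambda>t. k1 * (complex_of_real (\<rho> t) * (\<phi>1 t * \<phi>2 t)))"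
          by (auto simp: mult_ac)
        ultimately show ?thesis unfolding wip_def[of "\<lambda>t. k1 * \<phi>1 t"] by (simp only: integral_unique)
      qed
      ultimately show ?thesis by (simp add: mult_ac)
    qed
    have z0: "0 = (n2 - n1) + (z1 - z2) * wip (psi_m \<theta>1 \<phi>1 n1) (psi_m \<theta>2 \<phi>2 n2) c B"
      using sol_lagrange_wip[OF s1 s2 f1(1) B(1) cB(2), of n1 n2]
        psi_m_dirichlet[OF F1 z(1) B(1) cB(1)] psi_m_dirichlet[OF F2 z(2) B(1) cB(1)]
      by (simp add: n1_def[symmetric] n2_def[symmetric])
        (simp add: psi_m_def[OF F1 z(1)] psi_m_def[OF F2 z(2)] psi_m1_def[OF F1 z(1)] psi_m1_def[OF F2 z(2)] f1 f2)
    have z1': "\<psi>1 B * \<psi>2' B - \<psi>1' B * \<psi>2 B = (m2 - m1) + (z1 - z2) * wip \<psi>1 \<psi>2 c B"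
      using sol_lagrange_wip[OF s1 s2 f1(1) B(1) cB(2), of m1 m2]
      by (simp add: \<psi>s) (simp add: psi_m_def[OF F1 z(1)] psi_m_def[OF F2 z(2)] psi_m1_def[OF F1 z(1)] psi_m1_def[OF F2 z(2)] f1 f2)
    have z2': "wip (psi_m \<theta>1 \<phi>1 n1) (psi_m \<theta>2 \<phi>2 n2) c B
       = wip \<psi>1 \<psi>2 c B - k2 * wip \<psi>1 \<phi>2 c B - k1 * wip \<psi>2 \<phi>1 c B + k1 * k2 * wip \<phi>1 \<phi>2 c B"
    proof -
      have "((\<lambda>t. complex_of_real (\<rho> t) * (\<psi>1 t * \<psi>2 t) - k2 * (complex_of_real (\<rho> t) * (\<psi>1 t * \<phi>2 t))
          - k1 * (complex_of_real (\<rho> t) * (\<psi>2 t * \<phi>1 t)) + k1 * k2 * (complex_of_real (\<rho> t) * (\<phi>1 t * \<phi>2 t)))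
        has_integral (wip \<psi>1 \<psi>2 c B - k2 * wip \<psi>1 \<phi>2 c B - k1 * wip \<psi>2 \<phi>1 c B + k1 * k2 * wip \<phi>1 \<phi>2 c B)) {c..B}"
        by (intro has_integral_add has_integral_diff has_integral_mult_right wip_has_integral c\<psi> c\<phi> f1(1) B(1))
      moreover have "complex_of_real (\<rho> t) * (\<psi>1 t * \<psi>2 t) - k2 * (complex_of_real (\<rho> t) * (\<psi>1 t * \<phi>2 t))
          - k1 * (complex_of_real (\<rho> t) * (\<psi>2 t * \<phi>1 t)) + k1 * k2 * (complex_of_real (\<rho> t) * (\<phi>1 t * \<phi>2 t))
        = complex_of_real (\<rho> t) * (psi_m \<theta>1 \<phi>1 n1 t * psi_m \<theta>2 \<phi>2 n2 t)" for t
        by (simp add: \<psi>s psi_m_def[OF F1 z(1)] psi_m_def[OF F2 z(2)] k1_def k2_def algebra_simps)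
      ultimately show ?thesis unfolding wip_def[of "psi_m \<theta>1 \<phi>1 n1"] by (simp add: integral_unique)
    qed
    have eq: "\<psi>1 B * \<psi>2' B - \<psi>1' B * \<psi>2 B = (k2 - k1) + (z1 - z2) *
       (k2 * wip \<psi>1 \<phi>2 c B + k1 * wip \<psi>2 \<phi>1 c B - k1 * k2 * wip \<phi>1 \<phi>2 c B)"
    proof -
      have "\<psi>1 B * \<psi>2' B - \<psi>1' B * \<psi>2 B = (m2 - m1) + (z1 - z2) * wip \<psi>1 \<psi>2 c B
         - ((n2 - n1) + (z1 - z2) * wip (psi_m \<theta>1 \<phi>1 n1) (psi_m \<theta>2 \<phi>2 n2) c B)"
        unfolding z0[symmetric] z1' by simp
      also have "\<dots> = (k2 - k1) + (z1 - z2) *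
         (k2 * wip \<psi>1 \<phi>2 c B + k1 * wip \<psi>2 \<phi>1 c B - k1 * k2 * wip \<phi>1 \<phi>2 c B)"
        unfolding z2' unfolding k1_def k2_def by (simp add: algebra_simps)
      finally show ?thesis .
    qed
    have "cmod (k2 * wip \<psi>1 \<phi>2 c B + k1 * wip \<psi>2 \<phi>1 c B - k1 * k2 * wip \<phi>1 \<phi>2 c B) \<le> sqrt K1 * \<delta> + sqrt K2 * \<delta> + \<delta>"
      using b1 b2 b3 by (intro norm_triangle_le_diff order_trans[OF norm_triangle_ineq4] order_trans[OF norm_triangle_ineq] add_mono)
    then have "cmod (\<psi>1 B * \<psi>2' B - \<psi>1' B * \<psi>2 B) \<le> (\<delta> + \<delta>) + cmod (z1 - z2) * (sqrt K1 * \<delta> + sqrt K2 * \<delta> + \<delta>)"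
      unfolding eq
      by (intro order_trans[OF norm_triangle_ineq] add_mono order_trans[OF norm_triangle_ineq4] k)
        (auto simp: norm_mult intro: mult_left_mono)
    also have "\<dots> = \<delta> * L" by (simp add: L_def algebra_simps)
    also have "\<dots> \<le> \<epsilon>" by (rule \<delta>)
    finally show "cmod (psi_m \<theta>1 \<phi>1 m1 B * psi_m1 \<theta>2' \<phi>2' m2 B - psi_m1 \<theta>1' \<phi>1' m1 B * psi_m \<theta>2 \<phi>2 m2 B) \<le> \<epsilon>"
      unfolding \<psi>s .
  qed
qed

end

section \<open>The weighted Hilbert space\<close>

lemma integral_Ioc_sequence_limit:
  fixes g :: "real \<Rightarrow> 'a::euclidean_space"
  assumes g: "g absolutely_integrable_on S" and sub: "\<And>n. {s n<..<t n} \<subseteq> S"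
    and ev: "\<And>x. x \<in> S \<Longrightarrow> \<forall>\<^sub>F n in sequentially. x \<in> {s n<..<t n}"
  shows "(\<lambda>n. integral {s n..t n} g) \<longlonglongrightarrow> integral S g"
proof -
  have gi: "g integrable_on S" using g set_lebesgue_integral_eq_integral(1) by blast
  have "(\<lambda>n. integral S (\<lambda>x. if x \<in> {s n<..<t n} then g x else 0)) \<longlonglongrightarrow> integral S g"
  proof (rule dominated_convergence(2)[where h = "\<lambda>x. norm (g x)"])
    fix n
    have "g absolutely_integrable_on {s n<..<t n}"
      by (rule set_integrable_subset[OF g _ sub]) simp
    then have "g integrable_on {s n<..<t n}" using set_lebesgue_integral_eq_integral(1) by blast
    moreover have "{s n<..<t n} \<inter> S = {s n<..<t n}" using sub by blast
    ultimately show "(\<lambda>x. if x \<in> {s n<..<t n} then g x else 0) integrable_on S"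
      unfolding Henstock_Kurzweil_Integration.integrable_restrict_Int by simp
  next
    show "(\<lambda>x. norm (g x)) integrable_on S" using g by (simp add: absolutely_integrable_on_def)
  next
    fix x assume "x \<in> S"
    from ev[OF this] show "(\<lambda>n. if x \<in> {s n<..<t n} then g x else 0) \<longlonglongrightarrow> g x"
      by (rule tendsto_eventually[OF eventually_mono]) simp
  qed auto
  moreover have "integral S (\<lambda>x. if x \<in> {s n<..<t n} then g x else 0) = integral {s n..t n} g" for n
  proof -
    have "{s n<..<t n} \<inter> S = {s n<..<t n}" using sub by blast
    then show ?thesis
      unfolding Henstock_Kurzweil_Integration.integral_restrict_Int integral_open_interval_real by simp
  qed
  ultimately show ?thesis by simp
qed

lemma ereal_less_trans:
  "u < ereal x \<Longrightarrow> x < y \<Longrightarrow> u < ereal y" "x < y \<Longrightarrow> ereal y < u \<Longrightarrow> ereal x < u"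
  by (metis less_ereal.simps(1) less_trans)+

context sturm_liouville
begin

abbreviation \<mu> :: "real measure" where "\<mu> \<equiv> weighted_measure a b r"

lemma r_measurable: "r \<in> borel_measurable (lebesgue_on ein)"
  using coeffs by (simp add: sl_coefficients_def)

lemma weighted_measure_sub:
  fixes g :: "real \<Rightarrow> 'b::euclidean_space"
  assumes sub: "einterval a' b' \<subseteq> ein" and g: "g \<in> borel_measurable (lebesgue_on (einterval a' b'))"
  shows "integrable (weighted_measure a' b' r) g \<longleftrightarrow> (\<lambda>x. \<rho> x *\<^sub>R g x) absolutely_integrable_on einterval a' b'"
    "(\<lambda>x. \<rho> x *\<^sub>R g x) absolutely_integrable_on einterval a' b' \<Longrightarrow>
       (LINT x|weighted_measure a' b' r. g x) = integral (einterval a' b') (\<lambda>x. \<rho> x *\<^sub>R g x)"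
proof -
  have "r \<in> borel_measurable (lebesgue_on (einterval a' b'))"
    using r_measurable sub by (rule measurable_restrict_mono)
  then have \<rho>m: "\<rho> \<in> borel_measurable (lebesgue_on (einterval a' b'))"
    unfolding \<rho>_def[abs_def] by measurable
  have eq: "weighted_measure a' b' r = density (lebesgue_on (einterval a' b')) (\<lambda>x. ennreal (\<rho> x))"
    unfolding weighted_measure_def \<rho>_def max_def by (rule arg_cong[where f="density _"]) (auto simp: ennreal_neg)
  have S: "einterval a' b' \<inter> space lebesgue \<in> sets lebesgue" by simp
  show "integrable (weighted_measure a' b' r) g \<longleftrightarrow> (\<lambda>x. \<rho> x *\<^sub>R g x) absolutely_integrable_on einterval a' b'"
    unfolding eq integrable_density[OF g \<rho>m AE_I2[OF rho_nonneg]] integrable_restrict_space[OF S]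
    by (simp add: set_integrable_def)
  assume i: "(\<lambda>x. \<rho> x *\<^sub>R g x) absolutely_integrable_on einterval a' b'"
  show "(LINT x|weighted_measure a' b' r. g x) = integral (einterval a' b') (\<lambda>x. \<rho> x *\<^sub>R g x)"
    unfolding eq integral_density[OF g \<rho>m AE_I2[OF rho_nonneg]] integral_restrict_space[OF S]
    using set_lebesgue_integral_eq_integral(2)[OF i] by (simp add: set_lebesgue_integral_def)
qed

lemma L2_sub_iff:
  assumes "einterval a' b' \<subseteq> ein"
  shows "f \<in> L2 (weighted_measure a' b' r) \<longleftrightarrow> f \<in> borel_measurable (lebesgue_on (einterval a' b')) \<and>
     (\<lambda>t. \<rho> t * (cmod (f t))\<^sup>2) absolutely_integrable_on einterval a' b'"
proof -
  have "borel_measurable (weighted_measure a' b' r) = (borel_measurable (lebesgue_on (einterval a' b')) :: cfun set)"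
    unfolding weighted_measure_def by (rule measurable_cong_sets) auto
  moreover have "(\<lambda>x. (cmod (f x))\<^sup>2) \<in> borel_measurable (lebesgue_on (einterval a' b'))"
    if "f \<in> borel_measurable (lebesgue_on (einterval a' b'))" using that by measurable
  ultimately show ?thesis
    unfolding L2_def using weighted_measure_sub(1)[OF assms, of "\<lambda>x. (cmod (f x))\<^sup>2"] by auto
qed

lemmas L2_iff = L2_sub_iff[OF order_refl]

lemma AE_mu_iff: "(AE x in \<mu>. P x) \<longleftrightarrow> (AE x in lebesgue_on ein. P x)"
proof -
  obtain N0 where N0: "negligible N0" "\<And>x. x \<in> ein - N0 \<Longrightarrow> r x > 0 \<and> p x > 0 \<and> \<rho> x = r x"
    using positive_ae by metis
  have pos: "AE x in lebesgue_on ein. r x > 0"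
    unfolding AE_einterval_iff using N0 by blast
  have "(\<lambda>x. ennreal (r x)) \<in> borel_measurable (lebesgue_on ein)" using r_measurable by measurable
  then have "(AE x in \<mu>. P x) \<longleftrightarrow> (AE x in lebesgue_on ein. 0 < ennreal (r x) \<longrightarrow> P x)"
    unfolding weighted_measure_def by (rule AE_density)
  also have "\<dots> \<longleftrightarrow> (AE x in lebesgue_on ein. P x)"
  proof
    assume "AE x in lebesgue_on ein. 0 < ennreal (r x) \<longrightarrow> P x"
    with pos show "AE x in lebesgue_on ein. P x" by eventually_elim auto
  qed auto
  finally show ?thesis .
qed

lemma measurable_einterval_cong_AE:
  fixes f g :: cfun
  assumes f: "f \<in> borel_measurable (lebesgue_on ein)" and ae: "AE x in lebesgue_on ein. g x = f x"
  shows "g \<in> borel_measurable (lebesgue_on ein)"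
proof -
  obtain N where N: "negligible N" "\<And>x. x \<in> ein - N \<Longrightarrow> g x = f x"
    using ae unfolding AE_einterval_iff by blast
  have "f measurable_on ein" using f by (simp add: measurable_on_iff_borel_measurable)
  then have "g measurable_on ein" using N by (rule measurable_on_spike)
  then show ?thesis by (simp add: measurable_on_iff_borel_measurable)
qed

lemma L2_cong_AE:
  assumes f: "f \<in> L2 \<mu>" and ae: "AE x in lebesgue_on ein. g x = f x"
  shows "g \<in> L2 \<mu>"
proof -
  obtain N where N: "negligible N" "\<And>x. x \<in> ein - N \<Longrightarrow> g x = f x"
    using ae unfolding AE_einterval_iff by blast
  have "(\<lambda>t. \<rho> t * (cmod (g t))\<^sup>2) absolutely_integrable_on ein"
    by (rule absolutely_integrable_spike[OF _ N(1)]) (use f N(2) in \<open>auto simp: L2_iff\<close>)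
  then show ?thesis using measurable_einterval_cong_AE[OF _ ae] f by (simp add: L2_iff)
qed

lemma L2_product_integrable:
  assumes f: "f \<in> L2 \<mu>" and g: "g \<in> L2 \<mu>"
  shows "(\<lambda>t. complex_of_real (\<rho> t) * (f t * g t)) absolutely_integrable_on ein"
proof (rule measurable_bounded_by_integrable_imp_absolutely_integrable)
  have m: "f \<in> borel_measurable (lebesgue_on ein)" "g \<in> borel_measurable (lebesgue_on ein)"
    using f g by (auto simp: L2_iff)
  have "\<rho> \<in> borel_measurable (lebesgue_on ein)" unfolding \<rho>_def[abs_def] using r_measurable by measurable
  with m show "(\<lambda>t. complex_of_real (\<rho> t) * (f t * g t)) \<in> borel_measurable (lebesgue_on ein)" by measurable
  show "ein \<in> sets lebesgue" by simp
  show "(\<lambda>t. \<rho> t * (cmod (f t))\<^sup>2 + \<rho> t * (cmod (g t))\<^sup>2) integrable_on ein"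
    using f g by (intro integrable_add) (auto simp: L2_iff set_lebesgue_integral_eq_integral(1))
  fix t
  have "2 * (cmod (f t) * cmod (g t)) \<le> (cmod (f t))\<^sup>2 + (cmod (g t))\<^sup>2"
    using sum_squares_bound[of "cmod (f t)" "cmod (g t)"] by simp
  moreover have "0 \<le> cmod (f t) * cmod (g t)" by simp
  ultimately have "cmod (f t) * cmod (g t) \<le> (cmod (f t))\<^sup>2 + (cmod (g t))\<^sup>2" by linarith
  from mult_left_mono[OF this rho_nonneg[of t]]
  show "norm (complex_of_real (\<rho> t) * (f t * g t)) \<le> \<rho> t * (cmod (f t))\<^sup>2 + \<rho> t * (cmod (g t))\<^sup>2"
    by (simp add: norm_mult rho_nonneg algebra_simps)
qed

lemma L2_loc_int:
  assumes f: "f \<in> L2 \<mu>"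
  shows "loc_int a b (\<lambda>t. complex_of_real (\<rho> t) * f t)"
  unfolding loc_int_def
proof (intro allI impI)
  fix x y assume xy: "x \<in> ein" "y \<in> ein" "x \<le> y"
  have sub: "{x..y} \<subseteq> ein" using mem_einterval_between[OF xy(1,2)] by auto
  show "(\<lambda>t. complex_of_real (\<rho> t) * f t) absolutely_integrable_on {x..y}"
  proof (rule measurable_bounded_by_integrable_imp_absolutely_integrable)
    have m: "f \<in> borel_measurable (lebesgue_on {x..y})" "r \<in> borel_measurable (lebesgue_on {x..y})"
      using f r_measurable by (simp_all add: L2_iff measurable_restrict_mono[OF _ sub])
    then have "\<rho> \<in> borel_measurable (lebesgue_on {x..y})" unfolding \<rho>_def[abs_def] by measurable
    with m show "(\<lambda>t. complex_of_real (\<rho> t) * f t) \<in> borel_measurable (lebesgue_on {x..y})" by measurable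
    show "{x..y} \<in> sets lebesgue" by simp
    have i1: "(\<lambda>t. \<rho> t * (cmod (f t))\<^sup>2) absolutely_integrable_on {x..y}"
      by (rule set_integrable_subset[of _ ein]) (use f sub in \<open>auto simp: L2_iff\<close>)
    show "(\<lambda>t. \<rho> t + \<rho> t * (cmod (f t))\<^sup>2) integrable_on {x..y}"
      by (rule integrable_add[OF loc_intD(2)[OF rho_loc xy(1,2)] set_lebesgue_integral_eq_integral(1)[OF i1]])
    fix t
    have "cmod (f t) * 1 * 2 \<le> (cmod (f t))\<^sup>2 + 1\<^sup>2"
      using sum_squares_bound[of "cmod (f t)" 1] by simp
    moreover have "0 \<le> cmod (f t)" by simp
    ultimately have "cmod (f t) \<le> 1 + (cmod (f t))\<^sup>2" by (simp only: mult_1_right one_power2)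
    from mult_left_mono[OF this rho_nonneg[of t]]
    show "norm (complex_of_real (\<rho> t) * f t) \<le> \<rho> t + \<rho> t * (cmod (f t))\<^sup>2"
      by (simp add: norm_mult rho_nonneg algebra_simps)
  qed
qed

lemma L2_lincomb:
  assumes f: "f \<in> L2 \<mu>" and g: "g \<in> L2 \<mu>"
  shows "(\<lambda>t. \<alpha> * f t + \<beta> * g t) \<in> L2 \<mu>"
  unfolding L2_iff
proof
  have m: "f \<in> borel_measurable (lebesgue_on ein)" "g \<in> borel_measurable (lebesgue_on ein)"
    using f g by (auto simp: L2_iff)
  then show h: "(\<lambda>t. \<alpha> * f t + \<beta> * g t) \<in> borel_measurable (lebesgue_on ein)" by measurable
  show "(\<lambda>t. \<rho> t * (cmod (\<alpha> * f t + \<beta> * g t))\<^sup>2) absolutely_integrable_on ein"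
  proof (rule measurable_bounded_by_integrable_imp_absolutely_integrable)
    have "\<rho> \<in> borel_measurable (lebesgue_on ein)" unfolding \<rho>_def[abs_def] using r_measurable by measurable
    with h show "(\<lambda>t. \<rho> t * (cmod (\<alpha> * f t + \<beta> * g t))\<^sup>2) \<in> borel_measurable (lebesgue_on ein)" by measurable
    show "ein \<in> sets lebesgue" by simp
    show "(\<lambda>t. (2 * (cmod \<alpha>)\<^sup>2) * (\<rho> t * (cmod (f t))\<^sup>2) + (2 * (cmod \<beta>)\<^sup>2) * (\<rho> t * (cmod (g t))\<^sup>2)) integrable_on ein"
      using f g by (intro integrable_add integrable_on_cmult_left) (auto simp: L2_iff set_lebesgue_integral_eq_integral(1))
    fix t
    from mult_left_mono[OF norm_lincomb_square_le rho_nonneg[of t], of \<alpha> "f t" \<beta> "g t"]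
    show "norm (\<rho> t * (cmod (\<alpha> * f t + \<beta> * g t))\<^sup>2)
       \<le> (2 * (cmod \<alpha>)\<^sup>2) * (\<rho> t * (cmod (f t))\<^sup>2) + (2 * (cmod \<beta>)\<^sup>2) * (\<rho> t * (cmod (g t))\<^sup>2)"
      by (simp add: rho_nonneg algebra_simps)
  qed
qed

lemma L2_cnj: "f \<in> L2 \<mu> \<Longrightarrow> (\<lambda>t. cnj (f t)) \<in> L2 \<mu>"
  unfolding L2_iff by (auto intro: borel_measurable_continuous_on[of cnj, OF continuous_on_cnj[OF continuous_on_id], simplified])

lemma continuous_measurable_einterval:
  "continuous_on ein f \<Longrightarrow> (f::cfun) \<in> borel_measurable (lebesgue_on ein)"
  by (rule continuous_imp_measurable_on_sets_lebesgue) simp_all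

lemma L2_inner_eq:
  assumes f: "f \<in> L2 \<mu>" and g: "g \<in> L2 \<mu>"
  shows "L2_inner \<mu> f g = integral ein (\<lambda>t. complex_of_real (\<rho> t) * (cnj (f t) * g t))"
proof -
  have m: "(\<lambda>t. cnj (f t)) \<in> borel_measurable (lebesgue_on ein)" "g \<in> borel_measurable (lebesgue_on ein)"
    using L2_cnj[OF f] g by (auto simp: L2_iff)
  then have "(\<lambda>t. cnj (f t) * g t) \<in> borel_measurable (lebesgue_on ein)" by measurable
  from weighted_measure_sub(2)[OF order_refl this] show ?thesis
    using L2_product_integrable[OF L2_cnj[OF f] g] by (simp add: L2_inner_def scaleR_conv_of_real)
qed

lemma L2_imp_sq_int_right:
  assumes f: "f \<in> L2 \<mu>" and c: "continuous_on ein f"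
  shows "sq_int_right f"
  unfolding sq_int_right_def
proof
  fix d assume d: "d \<in> ein"
  have "energy f d B \<le> integral ein (\<lambda>t. \<rho> t * (cmod (f t))\<^sup>2)" if "B \<in> ein" for B
    unfolding energy_def
  proof (rule integral_subset_le)
    show "{d..B} \<subseteq> ein" using mem_einterval_between[OF d that] by auto
    show "(\<lambda>t. \<rho> t * (cmod (f t))\<^sup>2) integrable_on ein"
      using f by (auto simp: L2_iff set_lebesgue_integral_eq_integral(1))
  qed (auto simp: rho_nonneg intro: energy_integrable[OF c d that])
  then show "\<exists>K. \<forall>B\<in>ein. d \<le> B \<longrightarrow> energy f d B \<le> K" by blast
qed

lemma einterval_split:
  assumes c: "c \<in> ein"
  shows "ein = (einterval a (ereal c) \<union> {c}) \<union> einterval (ereal c) b"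
    "einterval a (ereal c) \<subseteq> ein" "einterval (ereal c) b \<subseteq> ein"
proof -
  show 1: "einterval a (ereal c) \<subseteq> ein" "einterval (ereal c) b \<subseteq> ein"
    using c by (auto simp: einterval_iff intro: ereal_less_trans)
  have "x \<in> (einterval a (ereal c) \<union> {c}) \<union> einterval (ereal c) b" if "x \<in> ein" for x
    using that by (cases x c rule: linorder_cases) (auto simp: einterval_iff)
  with 1 c show "ein = (einterval a (ereal c) \<union> {c}) \<union> einterval (ereal c) b" by blast
qed

lemma sequence_to_right_end:
  assumes c: "c \<in> ein"
  obtains X where "incseq X" "\<And>i. X i \<in> ein" "\<And>i. c < X i" "\<And>x. x \<in> ein \<Longrightarrow> \<forall>\<^sub>F i in sequentially. x < X i"
proof -
  have cb: "ereal c < b" using c by (simp add: einterval_iff)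
  obtain X where X: "incseq X" "\<And>i. ereal c < ereal (X i)" "\<And>i. ereal (X i) < b" "(\<lambda>i. ereal (X i)) \<longlonglongrightarrow> b"
    using ereal_incseq_approx[OF cb] by metis
  show thesis
  proof (rule that[OF X(1)])
    fix i show "X i \<in> ein" "c < X i"
      using X(2,3)[of i] c by (auto simp: einterval_iff intro: ereal_less_trans)
  next
    fix x assume "x \<in> ein"
    then have "\<forall>\<^sub>F i in sequentially. ereal x < ereal (X i)"
      using X(4) by (intro order_tendstoD) (auto simp: einterval_iff)
    then show "\<forall>\<^sub>F i in sequentially. x < X i" by simp
  qed
qed

lemma sq_int_right_absolutely_integrable:
  assumes f: "sq_int_right f" "continuous_on ein f" and c: "c \<in> ein"
  shows "(\<lambda>t. \<rho> t * (cmod (f t))\<^sup>2) absolutely_integrable_on einterval (ereal c) b"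
proof (rule nonnegative_absolutely_integrable_1)
  define h where "h = (\<lambda>t. \<rho> t * (cmod (f t))\<^sup>2)"
  obtain X where X: "incseq X" "\<And>i. X i \<in> ein" "\<And>i. c < X i" "\<And>x. x \<in> ein \<Longrightarrow> \<forall>\<^sub>F i in sequentially. x < X i"
    using sequence_to_right_end[OF c] by metis
  obtain K where K: "\<And>B. B \<in> ein \<Longrightarrow> c \<le> B \<Longrightarrow> energy f c B \<le> K"
    using sq_int_rightD[OF f(1) c] by metis
  have h0: "h t \<ge> 0" for t by (simp add: h_def rho_nonneg)
  have sub: "einterval (ereal c) b \<subseteq> ein" by (rule einterval_split(3)[OF c])
  have Isub: "{c<..<X k} \<inter> einterval (ereal c) b = {c<..<X k}" for k
    using X(2)[of k] by (auto simp: einterval_iff intro: ereal_less_trans)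
  have hk: "(\<lambda>t. if t \<in> {c<..<X k} then h t else 0) integrable_on einterval (ereal c) b"
    "integral (einterval (ereal c) b) (\<lambda>t. if t \<in> {c<..<X k} then h t else 0) = energy f c (X k)" for k
    using energy_integrable[OF f(2) c X(2)[of k]]
    unfolding Henstock_Kurzweil_Integration.integrable_restrict_Int Henstock_Kurzweil_Integration.integral_restrict_Int
      Isub energy_def h_def by (auto simp: integral_open_interval_real integrable_on_Icc_iff_Ioo)
  have "h integrable_on einterval (ereal c) b \<and>
    (\<lambda>k. integral (einterval (ereal c) b) (\<lambda>t. if t \<in> {c<..<X k} then h t else 0)) \<longlonglongrightarrow> integral (einterval (ereal c) b) h"
  proof (rule monotone_convergence_increasing[OF hk(1)])
    show "(if t \<in> {c<..<X k} then h t else 0) \<le> (if t \<in> {c<..<X (Suc k)} then h t else 0)" for k t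
      using incseq_SucD[OF X(1), of k] h0[of t] by auto
    show "(\<lambda>k. if t \<in> {c<..<X k} then h t else 0) \<longlonglongrightarrow> h t" if t: "t \<in> einterval (ereal c) b" for t
    proof (rule tendsto_eventually)
      have "c < t" "t \<in> ein" using t sub by (auto simp: einterval_iff)
      from X(4)[OF this(2)] show "\<forall>\<^sub>F k in sequentially. (if t \<in> {c<..<X k} then h t else 0) = h t"
        by (rule eventually_mono) (simp add: \<open>c < t\<close>)
    qed
    have "energy f c (X k) \<in> {0..K}" for k using K[OF X(2)] X(3)[of k] energy_nonneg by auto
    then show "bounded (range (\<lambda>k. integral (einterval (ereal c) b) (\<lambda>t. if t \<in> {c<..<X k} then h t else 0)))"
      unfolding hk(2) by (intro bounded_subset[OF bounded_closed_interval[of 0 K]]) auto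
  qed
  then show "(\<lambda>t. \<rho> t * (cmod (f t))\<^sup>2) integrable_on einterval (ereal c) b" by (simp add: h_def)
qed (simp add: rho_nonneg)

text \<open>
  Square integrability over the whole interval, with the limit circle hypothesis used at \<open>a\<close>.
\<close>

lemma L2_sol:
  assumes lc: "limit_circle_left a b p q r" and u: "sol z u u1" and i: "sq_int_right u"
  shows "u \<in> L2 \<mu>"
proof -
  have "is_solution a b p q r z u" using u is_solution_iff by blast
  then obtain c where c: "c \<in> ein" "u \<in> L2 (weighted_measure a (ereal c) r)"
    using lc unfolding limit_circle_left_def by blast
  have 1: "(\<lambda>t. \<rho> t * (cmod (u t))\<^sup>2) absolutely_integrable_on einterval a (ereal c)"
    using c(2) L2_sub_iff[OF einterval_split(2)[OF c(1)]] by blast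
  have 2: "(\<lambda>t. \<rho> t * (cmod (u t))\<^sup>2) absolutely_integrable_on einterval (ereal c) b"
    by (rule sq_int_right_absolutely_integrable[OF i sol_continuous(1)[OF u] c(1)])
  have 3: "(\<lambda>t. \<rho> t * (cmod (u t))\<^sup>2) absolutely_integrable_on {c}"
    by (rule absolutely_integrable_negligible) simp
  have "(\<lambda>t. \<rho> t * (cmod (u t))\<^sup>2) absolutely_integrable_on ein"
    using absolutely_integrable_Un[OF absolutely_integrable_Un[OF 1 3] 2] einterval_split(1)[OF c(1)] by simp
  then show ?thesis unfolding L2_iff using continuous_measurable_einterval[OF sol_continuous(1)[OF u]] by simp
qed

lemma limit_point_right_sq_int:
  assumes "limit_point_right a b p q r"
  shows "\<exists>z0 u0 u1. sol z0 u0 u1 \<and> \<not> sq_int_right u0"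
proof -
  obtain z u where u: "is_solution a b p q r z u" "\<And>c. c \<in> ein \<Longrightarrow> u \<notin> L2 (weighted_measure (ereal c) b r)"
    using assms unfolding limit_circle_right_def by blast
  obtain u1 where s: "sol z u u1" using u(1) is_solution_iff by blast
  have "\<not> sq_int_right u"
  proof
    assume i: "sq_int_right u"
    obtain c where c: "c \<in> ein" using einterval_nonempty[OF ab] by blast
    have "u \<in> borel_measurable (lebesgue_on (einterval (ereal c) b))"
      using continuous_measurable_einterval[OF sol_continuous(1)[OF s]] einterval_split(3)[OF c]
      by (rule measurable_restrict_mono)
    then have "u \<in> L2 (weighted_measure (ereal c) b r)"
      unfolding L2_sub_iff[OF einterval_split(3)[OF c]]
      using sq_int_right_absolutely_integrable[OF i sol_continuous(1)[OF s] c] by blast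
    then show False using u(2)[OF c] by blast
  qed
  then show ?thesis using s by blast
qed

text \<open>
  If the derivative is integrable over \<open>(a, b)\<close>, then the indefinite integral has a limit at
  \<open>a\<close>. The limit is taken in the extended reals, as \<open>a\<close> may be infinite.
\<close>

lemma ind_int_limit_left:
  assumes I: "ind_int a b F g" and g: "g absolutely_integrable_on ein" and c: "c \<in> ein"
  shows "((F \<circ> real_of_ereal) \<longlongrightarrow> F c - integral (einterval a (ereal c)) g) (at_right a)"
proof (rule tendsto_at_right_sequentially[of a "ereal c"])
  show "a < ereal c" using c by (simp add: einterval_iff)
  fix S assume S: "\<And>n. a < S n" "\<And>n. S n < ereal c" "S \<longlonglongrightarrow> a"
  define s where "s = (\<lambda>n. real_of_ereal (S n))"
  have "\<bar>S n\<bar> \<noteq> \<infinity>" for n using S(1,2)[of n] by auto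
  then have s: "ereal (s n) = S n" for n by (simp add: s_def ereal_real)
  have sc: "s n < c" "s n \<in> ein" for n
  proof -
    show "s n < c" using S(2)[of n] unfolding s[symmetric] by simp
    then show "s n \<in> ein" using S(1)[of n] c unfolding s[symmetric]
      by (auto simp: einterval_iff intro: ereal_less_trans)
  qed
  have g': "g absolutely_integrable_on einterval a (ereal c)"
    by (rule set_integrable_subset[OF g _ einterval_split(2)[OF c]]) simp
  have "(\<lambda>n. integral {s n..c} g) \<longlonglongrightarrow> integral (einterval a (ereal c)) g"
  proof (rule integral_Ioc_sequence_limit[OF g'])
    show "{s n<..<c} \<subseteq> einterval a (ereal c)" for n
    proof
      fix x assume x: "x \<in> {s n<..<c}"
      then have "ereal (s n) < ereal x" by simp
      then have "a < ereal x" using S(1)[of n] unfolding s[symmetric] by (rule less_trans[rotated])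
      then show "x \<in> einterval a (ereal c)" using x by (simp add: einterval_iff)
    qed
    show "\<forall>\<^sub>F n in sequentially. x \<in> {s n<..<c}" if x: "x \<in> einterval a (ereal c)" for x
    proof -
      have "\<forall>\<^sub>F n in sequentially. S n < ereal x"
        using S(3) x by (intro order_tendstoD) (auto simp: einterval_iff)
      then show ?thesis by eventually_elim (use x in \<open>auto simp: einterval_iff s[symmetric]\<close>)
    qed
  qed
  then have "(\<lambda>n. F c - integral {s n..c} g) \<longlonglongrightarrow> F c - integral (einterval a (ereal c)) g"
    by (intro tendsto_intros)
  moreover have "F c - integral {s n..c} g = F (s n)" for n
    using ind_intD(2)[OF I sc(2) c less_imp_le[OF sc(1)]] by (simp add: algebra_simps)
  ultimately show "(\<lambda>n. (F \<circ> real_of_ereal) (S n)) \<longlonglongrightarrow> F c - integral (einterval a (ereal c)) g"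
    by (simp add: s_def)
qed

lemma ind_int_limit_right:
  assumes I: "ind_int a b F g" and g: "g absolutely_integrable_on ein" and c: "c \<in> ein"
    and X: "\<And>i. X i \<in> ein" "\<And>i. c < X i" "\<And>x. x \<in> ein \<Longrightarrow> \<forall>\<^sub>F i in sequentially. x < X i"
  shows "(\<lambda>n. F (X n)) \<longlonglongrightarrow> F c + integral (einterval (ereal c) b) g"
proof -
  have g': "g absolutely_integrable_on einterval (ereal c) b"
    by (rule set_integrable_subset[OF g _ einterval_split(3)[OF c]]) simp
  have "(\<lambda>n. integral {c..X n} g) \<longlonglongrightarrow> integral (einterval (ereal c) b) g"
  proof (rule integral_Ioc_sequence_limit[OF g'])
    show "{c<..<X n} \<subseteq> einterval (ereal c) b" for n
    proof
      fix x assume x: "x \<in> {c<..<X n}"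
      have "ereal x < ereal (X n)" using x by simp
      moreover have "ereal (X n) < b" using X(1)[of n] by (simp add: einterval_iff)
      ultimately have "ereal x < b" by (rule less_trans)
      then show "x \<in> einterval (ereal c) b" using x by (simp add: einterval_iff)
    qed
    show "\<forall>\<^sub>F n in sequentially. x \<in> {c<..<X n}" if x: "x \<in> einterval (ereal c) b" for x
    proof -
      have "\<forall>\<^sub>F i in sequentially. x < X i" using X(3) einterval_split(3)[OF c] x by blast
      then show ?thesis by eventually_elim (use x in \<open>auto simp: einterval_iff\<close>)
    qed
  qed
  then have "(\<lambda>n. F c + integral {c..X n} g) \<longlonglongrightarrow> F c + integral (einterval (ereal c) b) g"
    by (intro tendsto_intros)
  moreover have "F c + integral {c..X n} g = F (X n)" for n
    using ind_intD(2)[OF I c X(1) less_imp_le[OF X(2)]] by (simp add: algebra_simps)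
  ultimately show ?thesis by simp
qed

end

section \<open>Wronskians at the left endpoint\<close>

context sturm_liouville
begin

lemma sys_lincomb:
  assumes f: "sys f f1 h" and g: "sys g g1 k"
  shows "sys (\<lambda>x. \<alpha> * f x + \<beta> * g x) (\<lambda>x. \<alpha> * f1 x + \<beta> * g1 x) (\<lambda>x. \<alpha> * h x + \<beta> * k x)"
proof -
  note F = f[unfolded sys_def, THEN conjunct1] f[unfolded sys_def, THEN conjunct2]
  note G = g[unfolded sys_def, THEN conjunct1] g[unfolded sys_def, THEN conjunct2]
  show ?thesis
    unfolding sys_def
    by (intro conjI ind_int_cong[OF ind_int_add[OF ind_int_cmult[OF F(1), of \<alpha>] ind_int_cmult[OF G(1), of \<beta>]]]
        ind_int_cong[OF ind_int_add[OF ind_int_cmult[OF F(2), of \<alpha>] ind_int_cmult[OF G(2), of \<beta>]]])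
      (simp_all add: algebra_simps)
qed

text \<open>
  \<open>f\<close> belongs to the domain of the maximal operator, has quasi-derivative \<open>f1\<close> on
  \<open>(a, b)\<close>, and is mapped to \<open>h\<close>. In contrast to the operator itself,
  \<open>f1\<close> may differ from the chosen quasi-derivative outside of \<open>(a, b)\<close> and
  \<open>h\<close> may differ from \<open>\<tau>f\<close> on a null set.
\<close>

definition max_data :: "cfun \<Rightarrow> cfun \<Rightarrow> cfun \<Rightarrow> bool" where
  "max_data f f1 h \<longleftrightarrow> sys f f1 h \<and> f \<in> L2 \<mu> \<and> h \<in> L2 \<mu>"

abbreviation "Tmax \<equiv> T_max a b p q r"
abbreviation "Wa \<equiv> wronskian_at_left_end a b p"

lemma max_data_of_Tmax:
  assumes "f \<in> fst Tmax"
  shows "max_data f (quasi_deriv a b p f) (tau a b p q r f)"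
  using assms sys_quasi_deriv[of f "tau a b p q r f" "{}"] L2_loc_int
  by (auto simp: max_data_def T_max_def)

lemma max_data_imp_Tmax:
  assumes d: "max_data f f1 h"
  shows "f \<in> fst Tmax" "AE x in \<mu>. snd Tmax f x = h x" "\<And>x. x \<in> ein \<Longrightarrow> quasi_deriv a b p f x = f1 x"
proof -
  have s: "sys f f1 h" using d by (simp add: max_data_def)
  show "AE x in \<mu>. snd Tmax f x = h x" unfolding AE_mu_iff using sysD(3)[OF s] by (simp add: T_max_def)
  have "tau a b p q r f \<in> L2 \<mu>"
    using L2_cong_AE[OF _ sysD(3)[OF s]] d by (simp add: max_data_def)
  then show "f \<in> fst Tmax" using d sysD(1)[OF s] by (simp add: T_max_def max_data_def)
  show "quasi_deriv a b p f x = f1 x" if "x \<in> ein" for x by (rule sysD(2)[OF s that])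
qed

lemma max_data_lincomb:
  "max_data f f1 h \<Longrightarrow> max_data g g1 k \<Longrightarrow>
   max_data (\<lambda>x. \<alpha> * f x + \<beta> * g x) (\<lambda>x. \<alpha> * f1 x + \<beta> * g1 x) (\<lambda>x. \<alpha> * h x + \<beta> * k x)"
  unfolding max_data_def using sys_lincomb L2_lincomb by blast

lemma max_data_cnj:
  "max_data f f1 h \<Longrightarrow> max_data (\<lambda>x. cnj (f x)) (\<lambda>x. cnj (f1 x)) (\<lambda>x. cnj (h x))"
  unfolding max_data_def using sys_cnj L2_cnj by blast

lemma max_data_cong:
  assumes "max_data f f1 h" "\<And>x. x \<in> ein \<Longrightarrow> g x = f x" "\<And>x. x \<in> ein \<Longrightarrow> g1 x = f1 x"
  shows "max_data g g1 h"
  using assms sys_cong[of f f1 h g g1 h] L2_cong_AE[of f g]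
  by (auto simp: max_data_def AE_einterval_iff intro: exI[of _ "{}"])

lemma max_data_of_sol: "sol z u u1 \<Longrightarrow> u \<in> L2 \<mu> \<Longrightarrow> max_data u u1 (\<lambda>x. z * u x)"
  using L2_lincomb[of u u z 0] by (simp add: max_data_def sol_def)

lemma at_right_left_end_nontrivial: "at_right a \<noteq> bot"
proof
  assume "at_right a = bot"
  then have "eventually (\<lambda>x. False) (at_right a)" by simp
  then obtain c where "a < c" "\<forall>y>a. y < c \<longrightarrow> False" unfolding eventually_at_right[OF ab] by blast
  then show False using dense by blast
qed

lemma eventually_in_einterval: "\<forall>\<^sub>F x in at_right a. real_of_ereal x \<in> ein"
  unfolding eventually_at_right[OF ab]
proof (intro exI[of _ b] conjI ab allI impI)
  fix y assume y: "a < y" "y < b"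
  then have "ereal (real_of_ereal y) = y" by (cases y) auto
  then show "real_of_ereal y \<in> ein" using y by (simp add: einterval_iff)
qed

text \<open>
  The Wronskian at \<open>a\<close> may be computed from any function that agrees with the Wronskian on
  \<open>(a, b)\<close>.
\<close>

lemma Wa_unique:
  assumes f: "max_data f f1 h" and g: "max_data g g1 k"
    and w: "\<And>x. x \<in> ein \<Longrightarrow> w x = f x * g1 x - f1 x * g x"
    and lim: "((w \<circ> real_of_ereal) \<longlongrightarrow> L) (at_right a)"
  shows "Wa f g = L"
  unfolding wronskian_at_left_end_def
proof (rule tendsto_Lim[OF at_right_left_end_nontrivial])
  show "((wronskian a b p f g \<circ> real_of_ereal) \<longlongrightarrow> L) (at_right a)"
  proof (rule Lim_transform_eventually[OF lim])
    show "\<forall>\<^sub>F x in at_right a. (w \<circ> real_of_ereal) x = (wronskian a b p f g \<circ> real_of_ereal) x"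
      using eventually_in_einterval
      by eventually_elim (simp add: w wronskian_def max_data_imp_Tmax(3)[OF f] max_data_imp_Tmax(3)[OF g])
  qed
qed

lemma Wa_value:
  assumes f: "max_data f f1 h" and g: "max_data g g1 k" and c: "c \<in> ein"
  shows "(\<lambda>t. complex_of_real (\<rho> t) * (h t * g t - f t * k t)) absolutely_integrable_on ein"
    "Wa f g = (f c * g1 c - f1 c * g c) - integral (einterval a (ereal c)) (\<lambda>t. complex_of_real (\<rho> t) * (h t * g t - f t * k t))"
    "(((\<lambda>x. f x * g1 x - f1 x * g x) \<circ> real_of_ereal) \<longlongrightarrow> Wa f g) (at_right a)"
proof -
  have "(\<lambda>t. complex_of_real (\<rho> t) * (h t * g t)) absolutely_integrable_on ein"
    "(\<lambda>t. complex_of_real (\<rho> t) * (f t * k t)) absolutely_integrable_on ein"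
    using f g L2_product_integrable by (auto simp: max_data_def)
  from set_integral_diff(1)[OF this]
  show i: "(\<lambda>t. complex_of_real (\<rho> t) * (h t * g t - f t * k t)) absolutely_integrable_on ein"
    by (simp add: right_diff_distrib)
  have I: "ind_int a b (\<lambda>x. f x * g1 x - f1 x * g x) (\<lambda>x. complex_of_real (\<rho> x) * (h x * g x - f x * k x))"
    using f g by (intro lagrange) (auto simp: max_data_def)
  note lim = ind_int_limit_left[OF I i c]
  show v: "Wa f g = (f c * g1 c - f1 c * g c) - integral (einterval a (ereal c)) (\<lambda>t. complex_of_real (\<rho> t) * (h t * g t - f t * k t))"
    by (rule Wa_unique[OF f g _ lim]) simp
  show "(((\<lambda>x. f x * g1 x - f1 x * g x) \<circ> real_of_ereal) \<longlongrightarrow> Wa f g) (at_right a)"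
    unfolding v by (rule lim)
qed

lemma Wa_tendsto:
  assumes f: "max_data f f1 h" and g: "max_data g g1 k"
  shows "((\<lambda>x. f (real_of_ereal x) * g1 (real_of_ereal x) - f1 (real_of_ereal x) * g (real_of_ereal x))
     \<longlongrightarrow> Wa f g) (at_right a)"
proof -
  obtain c where "c \<in> ein" using einterval_nonempty[OF ab] by blast
  from Wa_value(3)[OF f g this] show ?thesis by (simp add: o_def)
qed

lemma Wa_cong:
  assumes f: "max_data f f1 h" and g: "max_data g g1 k" and eq: "\<And>x. x \<in> ein \<Longrightarrow> g' x = g x"
  shows "Wa f g' = Wa f g"
  using Wa_tendsto[OF f g]
  by (intro Wa_unique[OF f max_data_cong[OF g, of g' g1], of "\<lambda>x. f x * g1 x - f1 x * g x"])
    (simp_all add: eq o_def)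

lemma Wa_lincomb:
  assumes f: "max_data f f1 h" and g: "max_data g g1 k" and g': "max_data g' g1' k'"
  shows "Wa f (\<lambda>x. \<alpha> * g x + \<beta> * g' x) = \<alpha> * Wa f g + \<beta> * Wa f g'"
proof (rule Wa_unique[OF f max_data_lincomb[OF g g']])
  show "(((\<lambda>x. \<alpha> * (f x * g1 x - f1 x * g x) + \<beta> * (f x * g1' x - f1 x * g' x)) \<circ> real_of_ereal)
     \<longlongrightarrow> \<alpha> * Wa f g + \<beta> * Wa f g') (at_right a)"
    unfolding o_def by (intro tendsto_intros Wa_tendsto[OF f g] Wa_tendsto[OF f g'])
qed (simp add: algebra_simps)

text \<open>
  The Pluecker identity for Wronskians, in the limit at \<open>a\<close>.
\<close>

lemma Wa_plucker:
  assumes v: "max_data v v' hv" and w: "max_data w w' hw" and f: "max_data f f1 h" and g: "max_data g g1 k"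
  shows "Wa v w * Wa f g = Wa v f * Wa w g - Wa v g * Wa w f"
proof (rule tendsto_unique[OF at_right_left_end_nontrivial])
  show "((\<lambda>x. (v (real_of_ereal x) * w' (real_of_ereal x) - v' (real_of_ereal x) * w (real_of_ereal x))
     * (f (real_of_ereal x) * g1 (real_of_ereal x) - f1 (real_of_ereal x) * g (real_of_ereal x))) \<longlongrightarrow> Wa v w * Wa f g) (at_right a)"
    by (intro tendsto_mult Wa_tendsto[OF v w] Wa_tendsto[OF f g])
  have "((\<lambda>x. (v (real_of_ereal x) * f1 (real_of_ereal x) - v' (real_of_ereal x) * f (real_of_ereal x))
     * (w (real_of_ereal x) * g1 (real_of_ereal x) - w' (real_of_ereal x) * g (real_of_ereal x))
     - (v (real_of_ereal x) * g1 (real_of_ereal x) - v' (real_of_ereal x) * g (real_of_ereal x))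
     * (w (real_of_ereal x) * f1 (real_of_ereal x) - w' (real_of_ereal x) * f (real_of_ereal x)))
     \<longlongrightarrow> Wa v f * Wa w g - Wa v g * Wa w f) (at_right a)"
    by (intro tendsto_mult tendsto_diff Wa_tendsto[OF v f] Wa_tendsto[OF w g] Wa_tendsto[OF v g] Wa_tendsto[OF w f])
  then show "((\<lambda>x. (v (real_of_ereal x) * w' (real_of_ereal x) - v' (real_of_ereal x) * w (real_of_ereal x))
     * (f (real_of_ereal x) * g1 (real_of_ereal x) - f1 (real_of_ereal x) * g (real_of_ereal x)))
     \<longlongrightarrow> Wa v f * Wa w g - Wa v g * Wa w f) (at_right a)"
    by (rule tendsto_cong[THEN iffD1, rotated]) (simp add: algebra_simps)
qed

context
  assumes lp: "limit_point_right a b p q r"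
begin

lemmas lp' = limit_point_right_sq_int[OF lp]

lemma weyl_solution:
  assumes c: "c \<in> ein" and z: "Im z \<noteq> 0"
  obtains \<theta> \<theta>1 \<phi> \<phi>1 m where "fundamental c z \<theta> \<theta>1 \<phi> \<phi>1"
    "\<And>B. B \<in> ein \<Longrightarrow> c < B \<Longrightarrow> m \<in> weyl_disk z \<theta> \<theta>1 \<phi> \<phi>1 B"
    "sol z (psi_m \<theta> \<phi> m) (psi_m1 \<theta>1 \<phi>1 m)" "sq_int_right (psi_m \<theta> \<phi> m)" "psi_m \<theta> \<phi> m c = 1"
proof -
  obtain \<theta> \<theta>1 \<phi> \<phi>1 where F: "fundamental c z \<theta> \<theta>1 \<phi> \<phi>1" using fundamental_exists[OF c] by blast
  obtain m where m: "\<And>B. B \<in> ein \<Longrightarrow> c < B \<Longrightarrow> m \<in> weyl_disk z \<theta> \<theta>1 \<phi> \<phi>1 B"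
    using weyl_point_exists[OF F z] by metis
  have s: "sol z (psi_m \<theta> \<phi> m) (psi_m1 \<theta>1 \<phi>1 m)" by (rule psi_m_sol[OF F z])
  show thesis
  proof (rule that[OF F m s])
    show "sq_int_right (psi_m \<theta> \<phi> m)"
      by (rule sq_int_rightI[OF sol_continuous(1)[OF s] c weyl_point_energy[OF F z m]])
    show "psi_m \<theta> \<phi> m c = 1" using fund[OF F z] by (simp add: psi_m_def[OF F z])
  qed
qed

text \<open>
  In the limit point case the square integrable solutions at a non-real parameter form a space of dimension at
  most one.
\<close>

lemma sq_int_solutions_proportional:
  assumes z: "Im z \<noteq> 0" and u: "sol z u u1" "sq_int_right u" and v: "sol z v v1" "sq_int_right v"
    and nz: "x0 \<in> ein" "v x0 \<noteq> 0"
  obtains k where "\<And>x. x \<in> ein \<Longrightarrow> u x = k * v x"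
proof -
  obtain c where c: "c \<in> ein" using einterval_nonempty[OF ab] by blast
  obtain \<theta> \<theta>1 \<phi> \<phi>1 m where F: "fundamental c z \<theta> \<theta>1 \<phi> \<phi>1"
    and i: "sq_int_right (psi_m \<theta> \<phi> m)"
    using weyl_solution[OF c z] by metis
  have U: "u x = u c * psi_m \<theta> \<phi> m x" and V: "v x = v c * psi_m \<theta> \<phi> m x" if "x \<in> ein" for x
    using sq_int_sol_multiple(1)[OF F z lp' i u that] sq_int_sol_multiple(1)[OF F z lp' i v that] by auto
  have "v c \<noteq> 0" using V[OF nz(1)] nz(2) by auto
  show thesis
  proof (rule that[of "u c / v c"])
    fix x assume x: "x \<in> ein"
    show "u x = u c / v c * v x" unfolding U[OF x] V[OF x] using \<open>v c \<noteq> 0\<close> by simp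
  qed
qed

lemma wronskian_vanishes_right:
  assumes z: "Im z1 \<noteq> 0" "Im z2 \<noteq> 0" and u: "sol z1 u u1" "sq_int_right u" and v: "sol z2 v v1" "sq_int_right v"
    and X: "\<And>i. X i \<in> ein" "\<And>x. x \<in> ein \<Longrightarrow> \<forall>\<^sub>F i in sequentially. x < X i"
  shows "(\<lambda>n. u (X n) * v1 (X n) - u1 (X n) * v (X n)) \<longlonglongrightarrow> 0"
proof (rule LIMSEQ_I)
  fix \<epsilon> :: real assume \<epsilon>: "\<epsilon> > 0"
  obtain c where c: "c \<in> ein" using einterval_nonempty[OF ab] by blast
  obtain \<theta>1 \<theta>1' \<phi>1 \<phi>1' m1 where F1: "fundamental c z1 \<theta>1 \<theta>1' \<phi>1 \<phi>1'"
    and m1: "\<And>B. B \<in> ein \<Longrightarrow> c < B \<Longrightarrow> m1 \<in> weyl_disk z1 \<theta>1 \<theta>1' \<phi>1 \<phi>1' B" and i1: "sq_int_right (psi_m \<theta>1 \<phi>1 m1)"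
    using weyl_solution[OF c z(1)] by metis
  obtain \<theta>2 \<theta>2' \<phi>2 \<phi>2' m2 where F2: "fundamental c z2 \<theta>2 \<theta>2' \<phi>2 \<phi>2'"
    and m2: "\<And>B. B \<in> ein \<Longrightarrow> c < B \<Longrightarrow> m2 \<in> weyl_disk z2 \<theta>2 \<theta>2' \<phi>2 \<phi>2' B" and i2: "sq_int_right (psi_m \<theta>2 \<phi>2 m2)"
    using weyl_solution[OF c z(2)] by metis
  define M where "M = cmod (u c * v c) + 1"
  have M: "M > 0" by (simp add: M_def add_nonneg_pos)
  then have "\<epsilon> / (2 * M) > 0" using \<epsilon> by simp
  then obtain B0 where B0: "B0 \<in> ein" "\<And>B. B \<in> ein \<Longrightarrow> B0 \<le> B \<Longrightarrow>
     cmod (psi_m \<theta>1 \<phi>1 m1 B * psi_m1 \<theta>2' \<phi>2' m2 B - psi_m1 \<theta>1' \<phi>1' m1 B * psi_m \<theta>2 \<phi>2 m2 B) \<le> \<epsilon> / (2 * M)"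
    using weyl_wronskian_limit[OF lp' z F1 F2 m1 m2] by metis
  obtain n0 where n0: "\<And>n. n \<ge> n0 \<Longrightarrow> B0 < X n"
    using X(2)[OF B0(1)] unfolding eventually_sequentially by blast
  show "\<exists>no. \<forall>n\<ge>no. norm (u (X n) * v1 (X n) - u1 (X n) * v (X n) - 0) < \<epsilon>"
  proof (intro exI[of _ n0] allI impI)
    fix n assume n: "n0 \<le> n"
    define B where "B = X n"
    have B: "B \<in> ein" "B0 \<le> B" using X(1) n0[OF n] by (auto simp: B_def)
    define w where "w = psi_m \<theta>1 \<phi>1 m1 B * psi_m1 \<theta>2' \<phi>2' m2 B - psi_m1 \<theta>1' \<phi>1' m1 B * psi_m \<theta>2 \<phi>2 m2 B"
    have U: "u B = u c * psi_m \<theta>1 \<phi>1 m1 B" "u1 B = u c * psi_m1 \<theta>1' \<phi>1' m1 B"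
      by (rule sq_int_sol_multiple[OF F1 z(1) lp' i1 u B(1)])+
    have V: "v B = v c * psi_m \<theta>2 \<phi>2 m2 B" "v1 B = v c * psi_m1 \<theta>2' \<phi>2' m2 B"
      by (rule sq_int_sol_multiple[OF F2 z(2) lp' i2 v B(1)])+
    have "u B * v1 B - u1 B * v B = (u c * v c) * w" unfolding U V w_def by (simp add: algebra_simps)
    then have "cmod (u B * v1 B - u1 B * v B) = cmod (u c * v c) * cmod w" by (simp add: norm_mult)
    also have "\<dots> \<le> M * (\<epsilon> / (2 * M))"
      using B0(2)[OF B] by (intro mult_mono) (auto simp: M_def w_def)
    also have "\<dots> < \<epsilon>" using M \<epsilon> by simp
    finally show "norm (u (X n) * v1 (X n) - u1 (X n) * v (X n) - 0) < \<epsilon>" by (simp add: B_def)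
  qed
qed

text \<open>
  Lagrange's identity integrated over all of \<open>(a, b)\<close>; there is no contribution from
  \<open>b\<close>.
\<close>

lemma Wa_solutions:
  assumes z: "Im z1 \<noteq> 0" "Im z2 \<noteq> 0" and u: "sol z1 u u1" "u \<in> L2 \<mu>" and v: "sol z2 v v1" "v \<in> L2 \<mu>"
  shows "- Wa u v = (z1 - z2) * integral ein (\<lambda>t. complex_of_real (\<rho> t) * (u t * v t))"
proof -
  obtain c where c: "c \<in> ein" using einterval_nonempty[OF ab] by blast
  obtain X where X: "\<And>i. X i \<in> ein" "\<And>i. c < X i" "\<And>x. x \<in> ein \<Longrightarrow> \<forall>\<^sub>F i in sequentially. x < X i"
    using sequence_to_right_end[OF c] by metis
  define g where "g = (\<lambda>t. complex_of_real (\<rho> t) * (z1 * u t * v t - u t * (z2 * v t)))"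
  note du = max_data_of_sol[OF u] and dv = max_data_of_sol[OF v]
  note val = Wa_value[OF du dv c, folded g_def]
  have I: "ind_int a b (\<lambda>x. u x * v1 x - u1 x * v x) g"
    unfolding g_def using u(1) v(1) by (intro lagrange) (auto simp: sol_def)
  have "(\<lambda>n. u (X n) * v1 (X n) - u1 (X n) * v (X n)) \<longlonglongrightarrow>
      (u c * v1 c - u1 c * v c) + integral (einterval (ereal c) b) g"
    by (rule ind_int_limit_right[OF I val(1) c X])
  moreover have "(\<lambda>n. u (X n) * v1 (X n) - u1 (X n) * v (X n)) \<longlonglongrightarrow> 0"
    using X L2_imp_sq_int_right[OF u(2) sol_continuous(1)[OF u(1)]] L2_imp_sq_int_right[OF v(2) sol_continuous(1)[OF v(1)]]
    by (intro wronskian_vanishes_right[OF z u(1) _ v(1)]) auto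
  ultimately have 1: "(u c * v1 c - u1 c * v c) + integral (einterval (ereal c) b) g = 0"
    by (rule LIMSEQ_unique)
  have gl: "g integrable_on einterval a (ereal c)" "g integrable_on einterval (ereal c) b"
    using set_integrable_subset[OF val(1) _ einterval_split(2)[OF c]] set_integrable_subset[OF val(1) _ einterval_split(3)[OF c]]
      set_lebesgue_integral_eq_integral(1) by auto
  have "integral ein g = integral (einterval a (ereal c) \<union> einterval (ereal c) b) g"
    by (rule integral_subset_negligible[symmetric])
      (use einterval_split[OF c] in \<open>auto intro: negligible_subset[of "{c}"]\<close>)
  also have "\<dots> = integral (einterval a (ereal c)) g + integral (einterval (ereal c) b) g"
  proof -
    have "einterval a (ereal c) \<inter> einterval (ereal c) b = {}" by (auto simp: einterval_iff)
    then show ?thesis using gl by (intro integral_Un) auto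
  qed
  finally have "integral ein g = - Wa u v"
    using val(2) eq_neg_iff_add_eq_0[THEN iffD2, OF 1] by simp
  moreover have "g = (\<lambda>t. (z1 - z2) * (complex_of_real (\<rho> t) * (u t * v t)))"
    by (auto simp: g_def algebra_simps)
  ultimately show ?thesis by simp
qed

end

end

section \<open>The Donoghue m-function\<close>

context sturm_liouville
begin

context
  fixes v1 v2 :: cfun
  assumes lc: "limit_circle_left a b p q r" and lp: "limit_point_right a b p q r"
    and bp: "boundary_pair a b p q r v1 v2"
begin

abbreviation "B0 \<equiv> bv a b p v2"
abbreviation "B1 \<equiv> bv' a b p v1"
abbreviation "\<psi> \<equiv> psi a b p q r v2"

lemma v_data:
  obtains w1 h1 w2 h2 where "max_data v1 w1 h1" "max_data v2 w2 h2"
  using bp max_data_of_Tmax unfolding boundary_pair_def by blast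

lemma bv_lincomb:
  assumes g: "max_data g g1 k" and g': "max_data g' g1' k'"
  shows "B0 (\<lambda>x. \<alpha> * g x + \<beta> * g' x) = \<alpha> * B0 g + \<beta> * B0 g'"
    "B1 (\<lambda>x. \<alpha> * g x + \<beta> * g' x) = \<alpha> * B1 g + \<beta> * B1 g'"
proof -
  obtain w1 h1 w2 h2 where v: "max_data v1 w1 h1" "max_data v2 w2 h2" using v_data by metis
  show "B0 (\<lambda>x. \<alpha> * g x + \<beta> * g' x) = \<alpha> * B0 g + \<beta> * B0 g'"
    "B1 (\<lambda>x. \<alpha> * g x + \<beta> * g' x) = \<alpha> * B1 g + \<beta> * B1 g'"
    unfolding bv_def bv'_def Wa_lincomb[OF v(1) g g'] Wa_lincomb[OF v(2) g g'] by simp_all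
qed

lemma bv_cmult:
  assumes g: "max_data g g1 k"
  shows "B0 (\<lambda>x. \<alpha> * g x) = \<alpha> * B0 g" "B1 (\<lambda>x. \<alpha> * g x) = \<alpha> * B1 g"
  using bv_lincomb[OF g g, of \<alpha> 0] by simp_all

lemma bv_cong:
  assumes g: "max_data g g1 k" and eq: "\<And>x. x \<in> ein \<Longrightarrow> g' x = g x"
  shows "B0 g' = B0 g" "B1 g' = B1 g"
proof -
  obtain w1 h1 w2 h2 where v: "max_data v1 w1 h1" "max_data v2 w2 h2" using v_data by metis
  show "B0 g' = B0 g" "B1 g' = B1 g"
    unfolding bv_def bv'_def using Wa_cong[OF v(1) g eq] Wa_cong[OF v(2) g eq] by simp_all
qed

lemma Wa_cnj_real:
  assumes v: "max_data v w h" and real: "\<And>x. x \<in> ein \<Longrightarrow> v x \<in> \<real>" and g: "max_data g g1 k"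
  shows "Wa v (\<lambda>x. cnj (g x)) = cnj (Wa v g)"
proof -
  have *: "max_data v (\<lambda>x. cnj (w x)) (\<lambda>x. cnj (h x))"
    by (rule max_data_cong[OF max_data_cnj[OF v]]) (use real in \<open>auto simp: Reals_cnj_iff\<close>)
  show ?thesis
  proof (rule Wa_unique[OF * max_data_cnj[OF g]])
    show "(((\<lambda>x. cnj (v x * g1 x - w x * g x)) \<circ> real_of_ereal) \<longlongrightarrow> cnj (Wa v g)) (at_right a)"
      unfolding o_def by (intro tendsto_cnj Wa_tendsto[OF v g])
  qed (use real in \<open>auto simp: Reals_cnj_iff\<close>)
qed

lemma bv_cnj:
  assumes g: "max_data g g1 k"
  shows "B0 (\<lambda>x. cnj (g x)) = cnj (B0 g)" "B1 (\<lambda>x. cnj (g x)) = cnj (B1 g)"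
proof -
  obtain w1 h1 w2 h2 where v: "max_data v1 w1 h1" "max_data v2 w2 h2" using v_data by metis
  have r: "v1 x \<in> \<real>" "v2 x \<in> \<real>" if "x \<in> ein" for x using bp that by (auto simp: boundary_pair_def)
  show "B0 (\<lambda>x. cnj (g x)) = cnj (B0 g)" "B1 (\<lambda>x. cnj (g x)) = cnj (B1 g)"
    unfolding bv_def bv'_def using Wa_cnj_real[OF v(1) r(1) g] Wa_cnj_real[OF v(2) r(2) g] by simp_all
qed

lemma Wa_boundary_values:
  assumes f: "max_data f f1 h" and g: "max_data g g1 k"
  shows "Wa f g = B0 f * B1 g - B1 f * B0 g"
proof -
  obtain w1 h1 w2 h2 where v: "max_data v1 w1 h1" "max_data v2 w2 h2" using v_data by metis
  have "Wa v1 v2 = 1" using bp by (simp add: boundary_pair_def)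
  then show ?thesis using Wa_plucker[OF v f g] by (simp add: bv_def bv'_def algebra_simps)
qed

text \<open>
  A solution that does not vanish at a point has positive norm near that point.
\<close>

lemma nonzero_energy:
  assumes u: "sol z u u1" "u \<in> L2 \<mu>" and x: "x \<in> ein" "u x \<noteq> 0"
  shows "integral ein (\<lambda>t. complex_of_real (\<rho> t) * (cnj (u t) * u t)) \<noteq> 0"
proof
  assume zero: "integral ein (\<lambda>t. complex_of_real (\<rho> t) * (cnj (u t) * u t)) = 0"
  define h where "h = (\<lambda>t. \<rho> t * (cmod (u t))\<^sup>2)"
  have hi: "h integrable_on ein"
    using u(2) by (auto simp: L2_iff h_def set_lebesgue_integral_eq_integral(1))
  have "(\<lambda>t. complex_of_real (\<rho> t) * (cnj (u t) * u t)) = (\<lambda>t. complex_of_real (h t))"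
    by (auto simp: h_def complex_norm_square mult.commute simp del: of_real_power)
  then have "integral ein h = 0" using zero integral_complex_of_real[OF hi] by simp
  obtain s t where st: "s \<in> ein" "t \<in> ein" "s < x" "x < t" using einterval_neighbourhood[OF x(1)] by metis
  have "energy u s t \<le> integral ein h"
    unfolding energy_def h_def
  proof (rule integral_subset_le)
    show "{s..t} \<subseteq> ein" using mem_einterval_between[OF st(1,2)] by auto
  qed (use hi in \<open>auto simp: h_def rho_nonneg intro: energy_integrable[OF sol_continuous(1)[OF u(1)] st(1,2)]\<close>)
  then have "energy u s t = 0" using \<open>integral ein h = 0\<close> energy_nonneg[of u s t] by simp
  then have "u x = 0" using energy_zero_imp_zero[OF sol_continuous(1)[OF u(1)] st(1,2), of x] st by auto
  then show False using x(2) by simp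
qed

text \<open>
  A solution with boundary value \<open>0\<close> would satisfy \<open>W(cnj u, u)(a) = 0\<close>, which by
  \<open>Wa_solutions\<close> is a non-zero multiple of its squared norm.
\<close>

lemma bv_nonzero:
  assumes z: "Im z \<noteq> 0" and u: "sol z u u1" "u \<in> L2 \<mu>" and x: "x \<in> ein" "u x \<noteq> 0"
  shows "B0 u \<noteq> 0"
proof
  assume b: "B0 u = 0"
  note d = max_data_of_sol[OF u]
  have "Wa (\<lambda>x. cnj (u x)) u = 0"
    using Wa_boundary_values[OF max_data_cnj[OF d] d] bv_cnj[OF d] b by simp
  moreover have "- Wa (\<lambda>x. cnj (u x)) u = (cnj z - z) * integral ein (\<lambda>t. complex_of_real (\<rho> t) * (cnj (u t) * u t))"
    using z by (intro Wa_solutions[OF lp _ z sol_cnj[OF u(1)] L2_cnj[OF u(2)] u]) simp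
  moreover have "cnj z - z \<noteq> 0" using z by (simp add: complex_eq_iff)
  ultimately show False using nonzero_energy[OF u x] by simp
qed

lemma solution_multiple:
  assumes z: "Im z \<noteq> 0" and u: "sol z u u1" "u \<in> L2 \<mu>" and v: "sol z v w" "v \<in> L2 \<mu>" "B0 v = 1"
    and x: "x \<in> ein"
  shows "u x = B0 u * v x"
proof -
  have "\<exists>x0\<in>ein. v x0 \<noteq> 0"
  proof (rule ccontr)
    assume "\<not> (\<exists>x0\<in>ein. v x0 \<noteq> 0)"
    then have eq: "\<And>x. x \<in> ein \<Longrightarrow> 0 * v x = v x" by auto
    have "B0 (\<lambda>x. 0 * v x) = B0 v" by (rule bv_cong(1)[OF max_data_of_sol[OF v(1,2)] eq])
    then show False using v(3) bv_cmult(1)[OF max_data_of_sol[OF v(1,2)], of 0] by simp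
  qed
  then obtain x0 where x0: "x0 \<in> ein" "v x0 \<noteq> 0" by blast
  obtain k where k: "\<And>x. x \<in> ein \<Longrightarrow> u x = k * v x"
    using sq_int_solutions_proportional[OF lp z u(1) _ v(1) _ x0]
      L2_imp_sq_int_right[OF u(2) sol_continuous(1)[OF u(1)]] L2_imp_sq_int_right[OF v(2) sol_continuous(1)[OF v(1)]]
    by metis
  have "B0 u = B0 (\<lambda>x. k * v x)"
  proof (rule bv_cong(1))
    show "max_data (\<lambda>x. k * v x) (\<lambda>x. k * w x + 0 * w x) (\<lambda>x. k * (z * v x) + 0 * (z * v x))"
      using max_data_lincomb[OF max_data_of_sol[OF v(1,2)] max_data_of_sol[OF v(1,2)], of k 0] by simp
  qed (rule k)
  then have "B0 u = k" using bv_cmult(1)[OF max_data_of_sol[OF v(1,2)], of k] v(3) by simp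
  then show ?thesis using k[OF x] by simp
qed

lemma psi_props:
  assumes z: "Im z \<noteq> 0"
  obtains y1 where "sol z (\<psi> z) y1" "\<psi> z \<in> L2 \<mu>" "B0 (\<psi> z) = 1"
proof -
  obtain c where c: "c \<in> ein" using einterval_nonempty[OF ab] by blast
  obtain u u1 where u: "sol z u u1" "sq_int_right u" "u c = 1"
    using weyl_solution[OF lp c z] by metis
  have uL: "u \<in> L2 \<mu>" by (rule L2_sol[OF lc u(1,2)])
  have nz: "B0 u \<noteq> 0" using bv_nonzero[OF z u(1) uL c] u(3) by simp
  \<comment> \<open>The normalisation is possible since non-trivial solutions have non-zero boundary value.\<close>
  define k where "k = 1 / B0 u"
  have "is_solution a b p q r z (\<lambda>x. k * u x)"
    unfolding is_solution_iff using sol_lincomb[OF u(1) u(1), of k 0] by auto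
  moreover have "(\<lambda>x. k * u x) \<in> L2 \<mu>" using L2_lincomb[OF uL uL, of k 0] by simp
  moreover have "B0 (\<lambda>x. k * u x) = 1" using bv_cmult(1)[OF max_data_of_sol[OF u(1) uL], of k] nz by (simp add: k_def)
  ultimately have "is_solution a b p q r z (\<psi> z) \<and> \<psi> z \<in> L2 \<mu> \<and> B0 (\<psi> z) = 1"
    unfolding psi_def by (intro someI[of "\<lambda>y. is_solution a b p q r z y \<and> y \<in> L2 \<mu> \<and> B0 y = 1"]) blast
  then show thesis using that is_solution_iff by blast
qed

text \<open>
  The fundamental identity for the second boundary values of the solutions \<open>\<psi>\<close>.
\<close>

lemma psi_difference:
  assumes z: "Im z1 \<noteq> 0" "Im z2 \<noteq> 0"
  shows "B1 (\<psi> z1) - B1 (\<psi> z2) = (z1 - z2) * integral ein (\<lambda>t. complex_of_real (\<rho> t) * (\<psi> z1 t * \<psi> z2 t))"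
proof -
  obtain y1 where y1: "sol z1 (\<psi> z1) y1" "\<psi> z1 \<in> L2 \<mu>" "B0 (\<psi> z1) = 1" using psi_props[OF z(1)] by metis
  obtain y2 where y2: "sol z2 (\<psi> z2) y2" "\<psi> z2 \<in> L2 \<mu>" "B0 (\<psi> z2) = 1" using psi_props[OF z(2)] by metis
  show ?thesis
    using Wa_solutions[OF lp z y1(1,2) y2(1,2)]
      Wa_boundary_values[OF max_data_of_sol[OF y1(1,2)] max_data_of_sol[OF y2(1,2)]] y1(3) y2(3) by simp
qed

lemma psi_cnj:
  assumes z: "Im z \<noteq> 0"
  shows "x \<in> ein \<Longrightarrow> \<psi> (cnj z) x = cnj (\<psi> z x)" "B1 (\<psi> (cnj z)) = cnj (B1 (\<psi> z))"
proof -
  obtain y where y: "sol z (\<psi> z) y" "\<psi> z \<in> L2 \<mu>" "B0 (\<psi> z) = 1" using psi_props[OF z] by metis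
  have z': "Im (cnj z) \<noteq> 0" using z by simp
  obtain w where w: "sol (cnj z) (\<psi> (cnj z)) w" "\<psi> (cnj z) \<in> L2 \<mu>" "B0 (\<psi> (cnj z)) = 1" using psi_props[OF z'] by metis
  note d = max_data_of_sol[OF y(1,2)]
  have b: "B0 (\<lambda>x. cnj (\<psi> z x)) = 1" using bv_cnj(1)[OF d] y(3) by simp
  show eq: "\<psi> (cnj z) x = cnj (\<psi> z x)" if "x \<in> ein" for x
    using solution_multiple[OF z' w(1,2) sol_cnj[OF y(1)] L2_cnj[OF y(2)] b that] w(3) by simp
  show "B1 (\<psi> (cnj z)) = cnj (B1 (\<psi> z))"
    using bv_cong(2)[OF max_data_cnj[OF d] eq] bv_cnj(2)[OF d] by simp
qed

abbreviation "N \<equiv> operator_kernel \<mu> Tmax \<i>"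

text \<open>
  The squared norm of the spanning vector of the kernel; it equals \<open>Im m(i)\<close> (\<open>nrm_eq\<close>).
\<close>

definition "nrm = L2_inner \<mu> (\<psi> \<i>) (\<psi> \<i>)"

lemma N_iff: "u \<in> N \<longleftrightarrow> (\<exists>u1. sol \<i> u u1) \<and> u \<in> L2 \<mu>"
proof
  assume "u \<in> N"
  then have u: "u \<in> fst Tmax" "AE x in \<mu>. snd Tmax u x - \<i> * u x = 0" by (auto simp: operator_kernel_def)
  then have "is_solution a b p q r \<i> u" "u \<in> L2 \<mu>"
    by (auto simp: is_solution_def AE_mu_iff T_max_def)
  then show "(\<exists>u1. sol \<i> u u1) \<and> u \<in> L2 \<mu>" using is_solution_iff by blast
next
  assume "(\<exists>u1. sol \<i> u u1) \<and> u \<in> L2 \<mu>"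
  then obtain u1 where "sol \<i> u u1" "u \<in> L2 \<mu>" by blast
  from max_data_imp_Tmax[OF max_data_of_sol[OF this]] show "u \<in> N"
    by (auto simp: operator_kernel_def elim: eventually_mono)
qed

lemma N_multiple:
  assumes "u \<in> N" "x \<in> ein"
  shows "u x = B0 u * \<psi> \<i> x"
proof -
  obtain u1 where u: "sol \<i> u u1" "u \<in> L2 \<mu>" using assms(1) N_iff by blast
  obtain y where y: "sol \<i> (\<psi> \<i>) y" "\<psi> \<i> \<in> L2 \<mu>" "B0 (\<psi> \<i>) = 1" using psi_props[of \<i>] by auto
  show ?thesis by (rule solution_multiple[OF _ u y assms(2)]) simp
qed

lemma N_lincomb: "u \<in> N \<Longrightarrow> v \<in> N \<Longrightarrow> (\<lambda>x. \<alpha> * u x + \<beta> * v x) \<in> N"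
  unfolding N_iff using sol_lincomb L2_lincomb by blast

lemma psi_i_props: "\<psi> \<i> \<in> N" "\<psi> \<i> \<in> L2 \<mu>" "B0 (\<psi> \<i>) = 1" "\<exists>y. sol \<i> (\<psi> \<i>) y"
proof -
  obtain y where y: "sol \<i> (\<psi> \<i>) y" "\<psi> \<i> \<in> L2 \<mu>" "B0 (\<psi> \<i>) = 1" using psi_props[of \<i>] by auto
  then show "\<psi> \<i> \<in> N" "\<psi> \<i> \<in> L2 \<mu>" "B0 (\<psi> \<i>) = 1" "\<exists>y. sol \<i> (\<psi> \<i>) y" using N_iff by blast+
qed

lemma space_mu: "space \<mu> = ein"
  by (simp add: weighted_measure_def space_restrict_space)

lemma L2_inner_cong:
  "(\<And>x. x \<in> ein \<Longrightarrow> f x = f' x) \<Longrightarrow> (\<And>x. x \<in> ein \<Longrightarrow> g x = g' x) \<Longrightarrow> L2_inner \<mu> f g = L2_inner \<mu> f' g'"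
  unfolding L2_inner_def by (rule Bochner_Integration.integral_cong) (auto simp: space_mu)

lemma L2_inner_lincomb:
  assumes f: "f \<in> L2 \<mu>" and g: "g \<in> L2 \<mu>" and h: "h \<in> L2 \<mu>"
  shows "L2_inner \<mu> f (\<lambda>x. \<alpha> * g x + \<beta> * h x) = \<alpha> * L2_inner \<mu> f g + \<beta> * L2_inner \<mu> f h"
proof -
  have i: "(\<lambda>t. complex_of_real (\<rho> t) * (cnj (f t) * g t)) integrable_on ein"
    "(\<lambda>t. complex_of_real (\<rho> t) * (cnj (f t) * h t)) integrable_on ein"
    using L2_product_integrable[OF L2_cnj[OF f]] g h set_lebesgue_integral_eq_integral(1) by blast+
  have "((\<lambda>t. \<alpha> * (complex_of_real (\<rho> t) * (cnj (f t) * g t)) + \<beta> * (complex_of_real (\<rho> t) * (cnj (f t) * h t)))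
     has_integral (\<alpha> * L2_inner \<mu> f g + \<beta> * L2_inner \<mu> f h)) ein"
    unfolding L2_inner_eq[OF f g] L2_inner_eq[OF f h]
    by (intro has_integral_add has_integral_mult_right integrable_integral i)
  moreover have "(\<lambda>t. \<alpha> * (complex_of_real (\<rho> t) * (cnj (f t) * g t)) + \<beta> * (complex_of_real (\<rho> t) * (cnj (f t) * h t)))
     = (\<lambda>t. complex_of_real (\<rho> t) * (cnj (f t) * (\<alpha> * g t + \<beta> * h t)))" by (auto simp: algebra_simps)
  ultimately show ?thesis unfolding L2_inner_eq[OF f L2_lincomb[OF g h]] by (simp add: integral_unique)
qed

lemma nrm_eq: "nrm = complex_of_real (Im (B1 (\<psi> \<i>)))" "nrm \<noteq> 0"
proof -
  have c: "cnj \<i> = - \<i>" by simp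
  have n: "nrm = integral ein (\<lambda>t. complex_of_real (\<rho> t) * (cnj (\<psi> \<i> t) * \<psi> \<i> t))"
    unfolding nrm_def by (rule L2_inner_eq[OF psi_i_props(2,2)])
  also have "\<dots> = integral ein (\<lambda>t. complex_of_real (\<rho> t) * (\<psi> \<i> t * \<psi> (- \<i>) t))"
    by (rule Henstock_Kurzweil_Integration.integral_cong) (use psi_cnj(1)[of \<i>] in \<open>simp add: c mult.commute\<close>)
  finally have "2 * \<i> * nrm = B1 (\<psi> \<i>) - B1 (\<psi> (- \<i>))" using psi_difference[of \<i> "- \<i>"] by simp
  also have "\<dots> = B1 (\<psi> \<i>) - cnj (B1 (\<psi> \<i>))" using psi_cnj(2)[of \<i>] c by simp
  also have "\<dots> = 2 * \<i> * complex_of_real (Im (B1 (\<psi> \<i>)))" by (simp add: complex_eq_iff)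
  finally show "nrm = complex_of_real (Im (B1 (\<psi> \<i>)))" by simp
  obtain y where y: "sol \<i> (\<psi> \<i>) y" using psi_i_props by blast
  have "\<exists>x\<in>ein. \<psi> \<i> x \<noteq> 0"
  proof (rule ccontr)
    assume "\<not> (\<exists>x\<in>ein. \<psi> \<i> x \<noteq> 0)"
    then have eq: "\<And>x. x \<in> ein \<Longrightarrow> 0 * \<psi> \<i> x = \<psi> \<i> x" by auto
    have "B0 (\<lambda>x. 0 * \<psi> \<i> x) = B0 (\<psi> \<i>)"
      by (rule bv_cong(1)[OF max_data_of_sol[OF y psi_i_props(2)] eq])
    then show False using psi_i_props(3) bv_cmult(1)[OF max_data_of_sol[OF y psi_i_props(2)], of 0] by simp
  qed
  then show "nrm \<noteq> 0" unfolding n using nonzero_energy[OF y psi_i_props(2)] by blast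
qed

text \<open>
  The orthogonality condition determines the choice in \<open>orth_proj\<close> on \<open>(a, b)\<close>, as
  \<open>N\<close> is spanned by \<open>\<psi>\<^sub>i\<close>.
\<close>

lemma orth_proj_N:
  assumes f: "f \<in> L2 \<mu>"
  shows "orth_proj \<mu> N f \<in> N"
    "x \<in> ein \<Longrightarrow> orth_proj \<mu> N f x = L2_inner \<mu> (\<psi> \<i>) f / nrm * \<psi> \<i> x"
proof -
  define P where "P = (\<lambda>h. h \<in> N \<and> (\<forall>k\<in>N. L2_inner \<mu> k (\<lambda>x. f x - h x) = 0))"
  have inner: "L2_inner \<mu> (\<psi> \<i>) (\<lambda>x. f x - h x) = L2_inner \<mu> (\<psi> \<i>) f - B0 h * nrm" if h: "h \<in> N" for h
  proof -
    have "L2_inner \<mu> (\<psi> \<i>) (\<lambda>x. f x - h x) = L2_inner \<mu> (\<psi> \<i>) (\<lambda>x. 1 * f x + (- B0 h) * \<psi> \<i> x)"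
      by (rule L2_inner_cong) (use N_multiple[OF h] in auto)
    then show ?thesis unfolding L2_inner_lincomb[OF psi_i_props(2) f psi_i_props(2)] by (simp add: nrm_def)
  qed
  have scale: "L2_inner \<mu> k g = cnj (B0 k) * L2_inner \<mu> (\<psi> \<i>) g" if k: "k \<in> N" for k g
  proof -
    have "L2_inner \<mu> k g = L2_inner \<mu> (\<lambda>x. B0 k * \<psi> \<i> x) g"
      by (rule L2_inner_cong) (use N_multiple[OF k] in auto)
    also have "\<dots> = cnj (B0 k) * L2_inner \<mu> (\<psi> \<i>) g"
      unfolding L2_inner_def by (simp add: mult.assoc)
    finally show ?thesis .
  qed
  define \<kappa> where "\<kappa> = L2_inner \<mu> (\<psi> \<i>) f / nrm"
  obtain y where y: "sol \<i> (\<psi> \<i>) y" using psi_i_props by blast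
  have hN: "(\<lambda>x. \<kappa> * \<psi> \<i> x) \<in> N" using N_lincomb[OF psi_i_props(1,1), of \<kappa> 0] by simp
  have "B0 (\<lambda>x. \<kappa> * \<psi> \<i> x) = \<kappa>"
    using bv_cmult(1)[OF max_data_of_sol[OF y psi_i_props(2)], of \<kappa>] psi_i_props(3) by simp
  then have orth: "L2_inner \<mu> (\<psi> \<i>) (\<lambda>x. f x - \<kappa> * \<psi> \<i> x) = 0"
    using inner[OF hN] nrm_eq(2) by (simp add: \<kappa>_def)
  have "L2_inner \<mu> k (\<lambda>x. f x - \<kappa> * \<psi> \<i> x) = 0" if "k \<in> N" for k
    unfolding scale[OF that] orth by simp
  then have "P (\<lambda>x. \<kappa> * \<psi> \<i> x)" using hN unfolding P_def by blast
  then have "P (Eps P)" by (rule someI[of P])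
  moreover have "orth_proj \<mu> N f = Eps P" unfolding orth_proj_def P_def ..
  ultimately have Po: "P (orth_proj \<mu> N f)" by (simp only:)
  then show oN: "orth_proj \<mu> N f \<in> N" by (simp add: P_def)
  have "L2_inner \<mu> (\<psi> \<i>) (\<lambda>x. f x - orth_proj \<mu> N f x) = 0" using Po psi_i_props(1) by (simp add: P_def)
  then have "B0 (orth_proj \<mu> N f) = \<kappa>" using inner[OF oN] nrm_eq(2) by (simp add: \<kappa>_def field_simps)
  then show "orth_proj \<mu> N f x = L2_inner \<mu> (\<psi> \<i>) f / nrm * \<psi> \<i> x" if "x \<in> ein"
    using N_multiple[OF oN that] by (simp add: \<kappa>_def)
qed

lemma orth_proj_of_N:
  assumes u: "u \<in> N" and x: "x \<in> ein"
  shows "orth_proj \<mu> N u x = u x"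
proof -
  have uL: "u \<in> L2 \<mu>" using u N_iff by blast
  have "L2_inner \<mu> (\<psi> \<i>) u = L2_inner \<mu> (\<psi> \<i>) (\<lambda>x. B0 u * \<psi> \<i> x + 0 * \<psi> \<i> x)"
    by (rule L2_inner_cong) (use N_multiple[OF u] in auto)
  also have "\<dots> = B0 u * nrm"
    unfolding L2_inner_lincomb[OF psi_i_props(2,2,2)] by (simp add: nrm_def)
  finally show ?thesis using orth_proj_N(2)[OF uL x] N_multiple[OF u x] nrm_eq(2) by simp
qed

text \<open>
  The resolvent on \<open>N\<close>. The function on the right-hand side has the required properties, and two
  functions with these properties differ by a square integrable solution with boundary value \<open>0\<close>.
\<close>

lemma resolvent_multiple:
  assumes z: "Im z \<noteq> 0" "z \<noteq> \<i>" and h: "\<And>x. x \<in> ein \<Longrightarrow> h x = \<kappa> * \<psi> \<i> x" and x: "x \<in> ein"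
  shows "resolvent \<mu> (T_0 a b p q r v2) z h x = \<kappa> / (z - \<i>) * (\<psi> z x - \<psi> \<i> x)"
    "resolvent \<mu> (T_0 a b p q r v2) z h \<in> L2 \<mu>"
proof -
  define R where "R = resolvent \<mu> (T_0 a b p q r v2) z h"
  define P where "P = (\<lambda>f. f \<in> fst (T_0 a b p q r v2) \<and> (AE x in \<mu>. snd (T_0 a b p q r v2) f x - z * f x = h x))"
  obtain y where y: "sol z (\<psi> z) y" "\<psi> z \<in> L2 \<mu>" "B0 (\<psi> z) = 1" using psi_props[OF z(1)] by metis
  obtain w where w: "sol \<i> (\<psi> \<i>) w" using psi_i_props by blast
  define l where "l = \<kappa> / (z - \<i>)"
  define f0 where "f0 = (\<lambda>x. l * \<psi> z x + (- l) * \<psi> \<i> x)"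
  note dz = max_data_of_sol[OF y(1,2)] and di = max_data_of_sol[OF w psi_i_props(2)]
  note d0 = max_data_lincomb[OF dz di, of l "- l", folded f0_def]
  have lz: "l * (z - \<i>) = \<kappa>" using z(2) by (simp add: l_def)
  have tau0: "AE x in \<mu>. snd Tmax f0 x - z * f0 x = h x"
    using max_data_imp_Tmax(2)[OF d0] AE_space
  proof eventually_elim
    case (elim x)
    then have "x \<in> ein" by (simp add: space_mu)
    have "snd Tmax f0 x - z * f0 x = l * (z - \<i>) * \<psi> \<i> x"
      unfolding elim(1) by (simp add: f0_def algebra_simps)
    then show ?case using lz h[OF \<open>x \<in> ein\<close>] by simp
  qed
  have "B0 f0 = 0" unfolding f0_def bv_lincomb(1)[OF dz di] using y(3) psi_i_props(3) by simp
  then have "P f0" unfolding P_def T_0_def using max_data_imp_Tmax(1)[OF d0] tau0 by simp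
  then have "P (Eps P)" by (rule someI[of P])
  moreover have "R = Eps P" unfolding R_def resolvent_def P_def ..
  ultimately have PR: "P R" by (simp only:)
  then have RT: "R \<in> fst Tmax" "B0 R = 0" "AE x in \<mu>. snd Tmax R x - z * R x = h x"
    by (auto simp: P_def T_0_def)
  then show RL: "resolvent \<mu> (T_0 a b p q r v2) z h \<in> L2 \<mu>" by (auto simp: T_max_def R_def)
  note dR = max_data_of_Tmax[OF RT(1)]
  \<comment> \<open>The difference to any other admissible choice is a solution with boundary value \<open>0\<close>.\<close>
  define g where "g = (\<lambda>x. 1 * R x + (-1) * f0 x)"
  note dg = max_data_lincomb[OF dR d0, of 1 "-1", folded g_def]
  have "AE x in \<mu>. snd Tmax g x = z * g x"
    using max_data_imp_Tmax(2)[OF dg] max_data_imp_Tmax(2)[OF d0] RT(3) tau0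
  proof eventually_elim
    case (elim x)
    have "snd Tmax g x = snd Tmax R x - snd Tmax f0 x"
      unfolding elim(1) using elim(2) by (simp add: T_max_def)
    also have "\<dots> = z * g x" using elim(3,4) by (simp add: g_def algebra_simps)
    finally show ?case .
  qed
  then have "is_solution a b p q r z g"
    using max_data_imp_Tmax(1)[OF dg] by (simp add: is_solution_def AE_mu_iff T_max_def)
  then obtain g1 where g1: "sol z g g1" using is_solution_iff by blast
  have gL: "g \<in> L2 \<mu>" using dg by (simp add: max_data_def)
  have "B0 g = 0" unfolding g_def bv_lincomb(1)[OF dR d0] using RT(2) \<open>B0 f0 = 0\<close> by simp
  then have "g x = 0" using solution_multiple[OF z(1) g1 gL y x] by simp
  then show "resolvent \<mu> (T_0 a b p q r v2) z h x = \<kappa> / (z - \<i>) * (\<psi> z x - \<psi> \<i> x)"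
    unfolding R_def[symmetric] by (simp add: g_def f0_def l_def algebra_simps)
qed

abbreviation "M \<equiv> donoghue_m \<mu> (T_0 a b p q r v2) N"

lemma M_at_i:
  "M \<i> u = (\<lambda>x. \<i> * u x)" "M (- \<i>) u = (\<lambda>x. - \<i> * u x)"
  by (simp_all add: donoghue_m_def)

text \<open>
  The scalar by which the Donoghue m-function acts.
\<close>

definition "m_fun z = - \<i> + (B1 (\<psi> z) - B1 (\<psi> (- \<i>))) / complex_of_real (Im (B1 (\<psi> \<i>)))"

lemma M_scalar:
  assumes z: "Im z \<noteq> 0" "z \<noteq> \<i>" "z \<noteq> - \<i>" and u: "u \<in> N"
  shows "M z u \<in> N" "x \<in> ein \<Longrightarrow> M z u x = m_fun z * u x"
proof -
  define h where "h = orth_proj \<mu> N u"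
  define R where "R = resolvent \<mu> (T_0 a b p q r v2) z h"
  have uL: "u \<in> L2 \<mu>" using u N_iff by blast
  have h: "h x = B0 u * \<psi> \<i> x" if "x \<in> ein" for x
    using orth_proj_of_N[OF u that] N_multiple[OF u that] by (simp add: h_def)
  have R: "R x = B0 u / (z - \<i>) * (\<psi> z x - \<psi> \<i> x)" if "x \<in> ein" for x
    unfolding R_def by (rule resolvent_multiple(1)[OF z(1,2) h that])
  have RL: "R \<in> L2 \<mu>"
  proof -
    obtain c where c: "c \<in> ein" using einterval_nonempty[OF ab] by blast
    show ?thesis unfolding R_def by (rule resolvent_multiple(2)[OF z(1,2) h c])
  qed
  have Meq: "M z u = (\<lambda>x. z * u x + (z\<^sup>2 + 1) * orth_proj \<mu> N R x)"
    by (simp add: donoghue_m_def h_def R_def)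
  show "M z u \<in> N" unfolding Meq by (rule N_lincomb[OF u orth_proj_N(1)[OF RL]])
  obtain y where y: "sol z (\<psi> z) y" "\<psi> z \<in> L2 \<mu>" "B0 (\<psi> z) = 1" using psi_props[OF z(1)] by metis
  define I where "I = L2_inner \<mu> (\<psi> \<i>) (\<psi> z)"
  have I: "(z + \<i>) * I = B1 (\<psi> z) - B1 (\<psi> (- \<i>))"
  proof -
    have "I = integral ein (\<lambda>t. complex_of_real (\<rho> t) * (cnj (\<psi> \<i> t) * \<psi> z t))"
      unfolding I_def by (rule L2_inner_eq[OF psi_i_props(2) y(2)])
    also have "\<dots> = integral ein (\<lambda>t. complex_of_real (\<rho> t) * (\<psi> z t * \<psi> (- \<i>) t))"
      by (rule Henstock_Kurzweil_Integration.integral_cong) (use psi_cnj(1)[of \<i>] in \<open>simp add: mult.commute\<close>)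
    finally show ?thesis using psi_difference[OF z(1), of "- \<i>"] by simp
  qed
  have inner: "L2_inner \<mu> (\<psi> \<i>) R = B0 u / (z - \<i>) * (I - nrm)"
  proof -
    define l where "l = B0 u / (z - \<i>)"
    have "L2_inner \<mu> (\<psi> \<i>) R = L2_inner \<mu> (\<psi> \<i>) (\<lambda>x. l * \<psi> z x + (- l) * \<psi> \<i> x)"
      by (rule L2_inner_cong) (use R in \<open>auto simp: l_def algebra_simps\<close>)
    then show ?thesis unfolding L2_inner_lincomb[OF psi_i_props(2) y(2) psi_i_props(2)]
      by (simp add: I_def nrm_def l_def algebra_simps)
  qed
  show "M z u x = m_fun z * u x" if x: "x \<in> ein"
  proof -
    have zi: "z - \<i> \<noteq> 0" using z(2) by simp
    \<comment> \<open>The factor \<open>z - \<i>\<close> cancels the denominator of the resolvent.\<close>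
    have zz: "z\<^sup>2 + 1 = (z + \<i>) * (z - \<i>)" by (simp add: algebra_simps power2_eq_square)
    have "(z\<^sup>2 + 1) * orth_proj \<mu> N R x = (z + \<i>) * (z - \<i>) * (B0 u / (z - \<i>) * (I - nrm) / nrm * \<psi> \<i> x)"
      unfolding orth_proj_N(2)[OF RL x] inner zz ..
    also have "\<dots> = (z + \<i>) * (I - nrm) / nrm * (B0 u * \<psi> \<i> x)"
      using zi by simp
    also have "\<dots> = ((z + \<i>) * I / nrm - (z + \<i>)) * (B0 u * \<psi> \<i> x)"
      using nrm_eq(2) by (simp add: field_simps)
    also have "\<dots> = ((B1 (\<psi> z) - B1 (\<psi> (- \<i>))) / nrm - (z + \<i>)) * u x"
      unfolding I N_multiple[OF u x, symmetric] ..
    finally have "M z u x = z * u x + ((B1 (\<psi> z) - B1 (\<psi> (- \<i>))) / nrm - (z + \<i>)) * u x"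
      unfolding Meq by simp
    also have "\<dots> = m_fun z * u x" unfolding m_fun_def nrm_eq(1) by (simp add: algebra_simps)
    finally show ?thesis .
  qed
qed

text \<open>
  Multiplication by a scalar, pointwise on \<open>(a, b)\<close>, is a bounded operator in the sense required
  here, in particular compatible with equality almost everywhere.
\<close>

lemma bounded_operator_of_scalar:
  assumes N: "\<And>u. u \<in> N \<Longrightarrow> A u \<in> N" and sc: "\<And>u x. u \<in> N \<Longrightarrow> x \<in> ein \<Longrightarrow> A u x = k * u x"
  shows "bounded_operator_on \<mu> N A"
  unfolding bounded_operator_on_def
proof (intro conjI ballI allI impI)
  show "A u \<in> N" if "u \<in> N" for u by (rule N[OF that])
  show "AE x in \<mu>. A u x = A v x" if u: "u \<in> N" and v: "v \<in> N" and ae: "AE x in \<mu>. u x = v x" for u v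
    using ae AE_space by eventually_elim (simp add: sc[OF u] sc[OF v] space_mu)
  show "AE x in \<mu>. A (\<lambda>y. \<alpha> * u y + \<beta> * v y) x = \<alpha> * A u x + \<beta> * A v x"
    if u: "u \<in> N" and v: "v \<in> N" for u v \<alpha> \<beta>
    using AE_space by eventually_elim
      (simp add: sc[OF u] sc[OF v] sc[OF N_lincomb[OF u v]] space_mu algebra_simps)
  show "\<exists>C. \<forall>u\<in>N. L2_norm \<mu> (A u) \<le> C * L2_norm \<mu> u"
  proof (intro exI ballI)
    fix u assume u: "u \<in> N"
    have "(LINT x|\<mu>. (cmod (A u x))\<^sup>2) = (LINT x|\<mu>. (cmod k)\<^sup>2 * (cmod (u x))\<^sup>2)"
      by (rule Bochner_Integration.integral_cong) (auto simp: space_mu sc[OF u] norm_mult power_mult_distrib)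
    then show "L2_norm \<mu> (A u) \<le> cmod k * L2_norm \<mu> u"
      unfolding L2_norm_def by (simp add: real_sqrt_mult)
  qed
qed

lemma donoghue_theorem:
  shows "(\<forall>z. z \<notin> \<real> \<longrightarrow> bounded_operator_on \<mu> N (M z)) \<and>
    is_scalar_operator_on \<mu> N (M \<i>) \<i> \<and>
    is_scalar_operator_on \<mu> N (M (- \<i>)) (- \<i>) \<and>
    (\<forall>z. z \<notin> \<real> \<and> z \<noteq> \<i> \<and> z \<noteq> - \<i> \<longrightarrow> is_scalar_operator_on \<mu> N (M z) (m_fun z))"
proof (intro conjI allI impI)
  fix z :: complex assume "z \<notin> \<real>"
  then have z: "Im z \<noteq> 0" by (simp add: complex_is_Real_iff)
  consider "z = \<i>" | "z = - \<i>" | "z \<noteq> \<i>" "z \<noteq> - \<i>" by blast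
  then show "bounded_operator_on \<mu> N (M z)"
  proof cases
    case 1
    show ?thesis
      by (rule bounded_operator_of_scalar[of _ \<i>]) (use N_lincomb[of _ _ \<i> 0] in \<open>auto simp: 1 M_at_i\<close>)
  next
    case 2
    show ?thesis
      by (rule bounded_operator_of_scalar[of _ "- \<i>"]) (use N_lincomb[of _ _ "- \<i>" 0] in \<open>auto simp: 2 M_at_i\<close>)
  next
    case 3
    show ?thesis
      by (rule bounded_operator_of_scalar[of "M z" "m_fun z"]) (rule M_scalar[OF z 3], assumption+)+
  qed
next
  show "is_scalar_operator_on \<mu> N (M \<i>) \<i>" "is_scalar_operator_on \<mu> N (M (- \<i>)) (- \<i>)"
    by (simp_all add: is_scalar_operator_on_def M_at_i)
next
  fix z :: complex assume z: "z \<notin> \<real> \<and> z \<noteq> \<i> \<and> z \<noteq> - \<i>"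
  then have z': "Im z \<noteq> 0" by (simp add: complex_is_Real_iff)
  show "is_scalar_operator_on \<mu> N (M z) (m_fun z)"
    unfolding is_scalar_operator_on_def
  proof
    fix u assume u: "u \<in> N"
    show "AE x in \<mu>. M z u x = m_fun z * u x"
      using AE_space by eventually_elim (use M_scalar(2)[OF z' _ _ u] z in \<open>auto simp: space_mu\<close>)
  qed
qed

end

end

theorem theorem5p1:
  fixes a b :: ereal and p q r :: "real \<Rightarrow> real" and v1 v2 :: "real \<Rightarrow> complex"
  defines "\<mu> \<equiv> weighted_measure a b r"
  defines "N \<equiv> operator_kernel \<mu> (T_max a b p q r) \<i>"
  defines "M \<equiv> donoghue_m \<mu> (T_0 a b p q r v2) N"
  defines "\<psi>' \<equiv> \<lambda>z. bv' a b p v1 (psi a b p q r v2 z)"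
  assumes "sl_coefficients a b p q r"
    and "limit_circle_left a b p q r"
    and "limit_point_right a b p q r"
    and "boundary_pair a b p q r v1 v2"
  shows "(\<forall>z. z \<notin> \<real> \<longrightarrow> bounded_operator_on \<mu> N (M z)) \<and>
    is_scalar_operator_on \<mu> N (M \<i>) \<i> \<and>
    is_scalar_operator_on \<mu> N (M (- \<i>)) (- \<i>) \<and>
    (\<forall>z. z \<notin> \<real> \<and> z \<noteq> \<i> \<and> z \<noteq> - \<i> \<longrightarrow>
       is_scalar_operator_on \<mu> N (M z)
         (- \<i> + (\<psi>' z - \<psi>' (- \<i>)) / complex_of_real (Im (\<psi>' \<i>))))"
proof -
  interpret sturm_liouville a b p q r by standard fact
  show ?thesis
    using donoghue_theorem[OF assms(6-8)] unfolding m_fun_def[OF assms(6-8)]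
    unfolding \<mu>_def N_def M_def \<psi>'_def .
qed

end
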